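(* The group of diffeomorphisms of finite type is properly contained in the group of diffeomorphisms of $S^1$ which, together with their inverses, can be expressed in terms of radicals. In turn this group is properly contained in $\mathrm{AlgDiff}(S^1)$, and in turn $\mathrm{AlgDiff}(S^1)$ is properly contained in $\mathrm{AlgHomeo}(S^1)$.
   Context: All homeomorphisms and diffeomorphisms of $S^1=\{|z|=1\}$ are orientation preserving. For a positive integer $n$ and $w_n\in\Delta=\{|w|<1\}$, $\phi_n(w_n;z)=z\,(1+\bar w_nz^{-n})^{1/n}/(1+w_nz^n)^{1/n}$ for $|z|=1$ (principal branches). The group of diffeomorphisms of finite type is the subgroup of $\mathrm{Diff}(S^1)$ generated by all $\phi_n(w_n)$, $n\ge1$, $w_n\in\Delta$. A homeomorphism or diffeomorphism $\sigma$ of $S^1$ is algebraic if there is a nonzero polynomial $p$ in two variables over $\mathbb C$ with $p(z,\sigma(z))=0$ for all $z\in S^1$; $\mathrm{AlgDiff}(S^1)$ and $\mathrm{AlgHomeo}(S^1)$ are the groups of algebraic diffeomorphisms and algebraic homeomorphisms of $S^1$, respectively. A diffeomorphism $\sigma$ can be expressed in terms of radicals if $w=\sigma(z)$ is an algebraic function of $z$ lying in a radical extension of $\mathbb C(z)$, i.e. it is obtained from rational functions by finitely many field operations and extractions of roots. *)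

theory Defs
  imports
    "HOL-Analysis.Analysis"
    "HOL-Computational_Algebra.Polynomial"
    "HOL-Algebra.Bij"
    "HOL-Algebra.Generated_Groups"
begin

abbreviation unit_circle :: "complex set" where
  "unit_circle \<equiv> sphere 0 1"

text \<open>
  Maps of the circle are functions on the complex plane that are extensional on the circle
  (they are \<open>undefined\<close> off it), so that equality of functions is equality of circle maps, and
  the ambient group is \<open>BijGroup unit_circle\<close>, with composition as multiplication.
\<close>

text \<open>A homeomorphism preserves orientation iff it has an increasing lift to the real line.\<close>

definition orientation_preserving :: "(complex \<Rightarrow> complex) \<Rightarrow> bool" where
  "orientation_preserving \<sigma> \<longleftrightarrow>
     (\<exists>F :: real \<Rightarrow> real. continuous_on UNIV F \<and> strict_mono F \<and>
        (\<forall>t. \<sigma> (cis t) = cis (F t)))"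

definition circle_homeos :: "(complex \<Rightarrow> complex) set" where
  "circle_homeos =
     {\<sigma> \<in> Bij unit_circle.
        homeomorphism unit_circle unit_circle \<sigma> (inv_into unit_circle \<sigma>) \<and>
        orientation_preserving \<sigma>}"

text \<open>\<open>C\<^sup>\<infinity>\<close> in the angular coordinate; \<open>D k\<close> is the \<open>k\<close>-th derivative.\<close>

definition circle_smooth :: "(complex \<Rightarrow> complex) \<Rightarrow> bool" where
  "circle_smooth \<sigma> \<longleftrightarrow>
     (\<exists>D :: nat \<Rightarrow> real \<Rightarrow> complex.
        (\<forall>t. D 0 t = \<sigma> (cis t)) \<and>
        (\<forall>k t. (D k has_vector_derivative D (Suc k) t) (at t)))"

definition circle_diffeos :: "(complex \<Rightarrow> complex) set" where
  "circle_diffeos =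
     {\<sigma> \<in> circle_homeos. circle_smooth \<sigma> \<and> circle_smooth (inv_into unit_circle \<sigma>)}"

text \<open>
  For \<open>n \<ge> 1\<close> and \<open>norm w < 1\<close> both bases have positive real part on the circle, and
  \<open>powr\<close> is the principal branch.
\<close>

definition phi :: "nat \<Rightarrow> complex \<Rightarrow> complex \<Rightarrow> complex" where
  "phi n w =
     (\<lambda>z \<in> unit_circle.
        z * (1 + cnj w * inverse (z ^ n)) powr (1 / of_nat n)
          / (1 + w * z ^ n) powr (1 / of_nat n))"

definition finite_type_diffeos :: "(complex \<Rightarrow> complex) set" where
  "finite_type_diffeos =
     generate (BijGroup unit_circle) {phi n w | n w. 1 \<le> n \<and> norm w < 1}"

text \<open>
  A polynomial in two variables is a polynomial in the second variable with coefficients that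
  are polynomials in the first, so its value at \<open>(z, w)\<close> is \<open>poly (poly p [:w:]) z\<close>.
\<close>

definition algebraic_map :: "(complex \<Rightarrow> complex) \<Rightarrow> bool" where
  "algebraic_map \<sigma> \<longleftrightarrow>
     (\<exists>p :: complex poly poly. p \<noteq> 0 \<and> (\<forall>z \<in> unit_circle. poly (poly p [:\<sigma> z:]) z = 0))"

definition AlgHomeo :: "(complex \<Rightarrow> complex) set" where
  "AlgHomeo = {\<sigma> \<in> circle_homeos. algebraic_map \<sigma>}"

definition AlgDiff :: "(complex \<Rightarrow> complex) set" where
  "AlgDiff = {\<sigma> \<in> circle_diffeos. algebraic_map \<sigma>}"

text \<open>
  Holomorphic functions on \<open>U\<close> obtained from rational functions by finitely many field
  operations and extractions of roots. An \<open>n\<close>-th root is any holomorphic branch on \<open>U\<close>.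
\<close>

inductive radical_on :: "complex set \<Rightarrow> (complex \<Rightarrow> complex) \<Rightarrow> bool" for U where
  rational: "\<lbrakk>\<And>z. z \<in> U \<Longrightarrow> poly q z \<noteq> 0\<rbrakk> \<Longrightarrow> radical_on U (\<lambda>z. poly p z / poly q z)"
| add: "\<lbrakk>radical_on U f; radical_on U g\<rbrakk> \<Longrightarrow> radical_on U (\<lambda>z. f z + g z)"
| diff: "\<lbrakk>radical_on U f; radical_on U g\<rbrakk> \<Longrightarrow> radical_on U (\<lambda>z. f z - g z)"
| mult: "\<lbrakk>radical_on U f; radical_on U g\<rbrakk> \<Longrightarrow> radical_on U (\<lambda>z. f z * g z)"
| divide: "\<lbrakk>radical_on U f; radical_on U g; \<And>z. z \<in> U \<Longrightarrow> g z \<noteq> 0\<rbrakk>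
           \<Longrightarrow> radical_on U (\<lambda>z. f z / g z)"
| root: "\<lbrakk>radical_on U f; 0 < n; g holomorphic_on U; \<And>z. z \<in> U \<Longrightarrow> g z ^ n = f z\<rbrakk>
         \<Longrightarrow> radical_on U g"

text \<open>
  Elements of a radical extension of the field of rational functions are multivalued functions
  with finitely many branch points and poles, also for the intermediate expressions. So
  \<open>\<sigma>\<close> is required to be algebraic and, at all but finitely many points of the circle, to
  coincide locally with a branch of a radical expression. For a smooth algebraic \<open>\<sigma>\<close>, which
  is analytic, the choice of the point is immaterial: all branches of \<open>\<sigma>\<close> are roots of one
  irreducible polynomial, hence they lie together in the normal closure of a radical extension
  as soon as one of them lies in a radical extension.
\<close>

definition radical_map :: "(complex \<Rightarrow> complex) \<Rightarrow> bool" where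
  "radical_map \<sigma> \<longleftrightarrow>
     algebraic_map \<sigma> \<and>
     (\<exists>E. finite E \<and>
        (\<forall>a \<in> unit_circle - E. \<exists>r > 0. \<exists>f. radical_on (ball a r) f \<and>
           (\<forall>z \<in> unit_circle \<inter> ball a r. \<sigma> z = f z)))"

definition radical_diffeos :: "(complex \<Rightarrow> complex) set" where
  "radical_diffeos =
     {\<sigma> \<in> circle_diffeos. radical_map \<sigma> \<and> radical_map (inv_into unit_circle \<sigma>)}"

end

theory Submission
  imports Defs "HOL-Complex_Analysis.Complex_Analysis" "HOL-Algebra.Finite_Extensions"
    "HOL-Computational_Algebra.Fundamental_Theorem_Algebra"
begin

text \<open>
  Why the four sets are groups. A circle homeomorphism is the same as an increasing lift to the
  line, and lifts can be composed and inverted; a lift is smooth exactly when its circle map is, and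
  the inverse function theorem gives smoothness of inverses. Algebraic relations \<open>f(z, v) = 0\<close>
  and \<open>g(v, w) = 0\<close> imply a relation between \<open>z\<close> and \<open>w\<close> by elimination of
  \<open>v\<close> (lemma \<open>elimination\<close>), and radical expressions can be substituted into one another.
  The inverse of \<open>\<phi>\<^sub>n(w)\<close> is \<open>\<phi>\<^sub>n(-w)\<close>: the composition is \<open>z\<close> times an
  \<open>n\<close>-th root of unity that depends continuously on \<open>w\<close>. So diffeomorphisms of finite type
  and their inverses are expressed by radicals.

  The inclusions are proper because of three examples, all of them twists
  \<open>z (1 + \<i> h(z)) / (1 - \<i> h(z))\<close> with \<open>h\<close> real. Twisting rotates \<open>z\<close> by the angle
  \<open>2 arctan (h z)\<close>; the result is algebraic if \<open>h\<close> is, and a diffeomorphism if \<open>h\<close>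
  is smooth with small derivative.

  For \<open>h(z) = |Im z| / 4\<close> the twist is algebraic but has corners at \<open>1\<close> and \<open>-1\<close>.

  For an algebraic diffeomorphism that is not radical, \<open>h\<close> is a small multiple of
  \<open>g(t\<^sub>0 + \<delta> Re z)\<close>, where \<open>g\<close> is a local inverse of the invariant \<open>J = H\<^sup>3 / f\<^sup>5\<close>
  of the icosahedral group, a rational function of degree 60. Radical expressions are kept away from
  \<open>g\<close> by a direct form of the easy half of Galois theory. The field C(v) generated by the germ
  \<open>v\<close> of \<open>g\<close> carries automorphisms \<open>S\<close>, \<open>T\<close> with
  \<open>S\<^sup>5 = T\<^sup>2 = (S T)\<^sup>3 = 1\<close> that fix \<open>J(v)\<close> but not \<open>v\<close>. If a power of
  \<open>\<alpha>\<close> is fixed, then the action extends to the field generated by \<open>\<alpha>\<close> in such a way that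
  \<open>\<alpha>\<close> itself is fixed (lemma \<open>ico_action_extend\<close>); the group with these relations is perfect, so
  it has no nontrivial homomorphism to the roots of unity and cannot move a radical that is
  present already. Therefore everything built from fixed elements by radicals can be made to be
  fixed, and \<open>v\<close> cannot be among it.

  For a radical diffeomorphism that is not of finite type, \<open>h(z) = Im z / 4\<close>. The twist is a rational
  function of degree 3, and its inverse is radical because cubic equations are solvable.
  The group of finite type is excluded by comparing degrees. From \<open>f' = \<phi>\<^sub>n(w) \<circ> f\<close> follows that
  \<open>f'\<^sup>n\<close> is a Moebius transform of \<open>f\<^sup>n\<close>, so C(f) and C(f') have the same degree \<open>n\<close>
  over the common subfield \<open>C(f\<^sup>n) = C(f'\<^sup>n)\<close>. Hence for \<open>f\<close> of finite type, C(z) and C(f)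
  have equal degrees in some common finite extension (lemma \<open>balanced_step\<close>). If \<open>f\<close> is rational,
  then C(f) is contained in C(z), equality of degrees forces equality of the fields, and
  \<open>f\<close> is injective; the cubic is not, as it has two zeros.
\<close>

hide_const (open) Polynomials.degree Polynomials.lead_coeff Module.smult

section \<open>Smooth curves\<close>

text \<open>
  Differentiability of order \<open>k\<close>, in a form that allows induction on \<open>k\<close> with the function arbitrary:
  the rules of differentiation then carry over one order at a time.
\<close>

primrec Ck :: "nat \<Rightarrow> (real \<Rightarrow> 'a::real_normed_vector) \<Rightarrow> bool" where
  "Ck 0 f \<longleftrightarrow> True"
| "Ck (Suc k) f \<longleftrightarrow> (\<exists>f'. (\<forall>t. (f has_vector_derivative f' t) (at t)) \<and> Ck k f')"

definition smooth :: "(real \<Rightarrow> 'a::real_normed_vector) \<Rightarrow> bool" where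
  "smooth f \<longleftrightarrow> (\<forall>k. Ck k f)"

lemma Ck_SucI: "(\<And>t. (f has_vector_derivative f' t) (at t)) \<Longrightarrow> Ck k f' \<Longrightarrow> Ck (Suc k) f"
  by auto

lemma Ck_Suc_D: "Ck (Suc k) f \<Longrightarrow> Ck k f"
proof (induction k arbitrary: f)
  case (Suc k)
  then obtain f' where "\<forall>t. (f has_vector_derivative f' t) (at t)" "Ck (Suc k) f'" by auto
  then show ?case using Suc.IH by auto
qed simp

lemma smoothD:
  assumes "smooth f"
  obtains f' where "\<And>t. (f has_vector_derivative f' t) (at t)" "smooth f'"
proof -
  define f' where "f' t = vector_derivative f (at t)" for t
  have *: "(\<forall>t. (f has_vector_derivative f' t) (at t)) \<and> Ck k f'" for k
  proof -
    have "Ck (Suc k) f" using assms by (auto simp: smooth_def)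
    then obtain g where g: "\<forall>t. (f has_vector_derivative g t) (at t)" "Ck k g" by auto
    then have "g = f'" unfolding f'_def by (auto intro!: ext vector_derivative_at[symmetric])
    then show ?thesis using g by simp
  qed
  then show ?thesis using that[of f'] by (auto simp: smooth_def)
qed

lemma smoothI: "(\<And>t. (f has_vector_derivative f' t) (at t)) \<Longrightarrow> smooth f' \<Longrightarrow> smooth f"
  unfolding smooth_def by (metis Ck.simps(2) Ck.simps(1) not0_implies_Suc)

text \<open>
  Derivatives are unique, so the sequence of all derivatives that smoothness asks for can be recovered
  from the existence of derivatives of each single order.
\<close>

lemma circle_smooth_iff: "circle_smooth \<sigma> \<longleftrightarrow> smooth (\<lambda>t. \<sigma> (cis t))"
proof
  assume "circle_smooth \<sigma>"
  then obtain D where D: "\<And>t. D 0 t = \<sigma> (cis t)" "\<And>k t. (D k has_vector_derivative D (Suc k) t) (at t)"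
    by (auto simp: circle_smooth_def)
  have "Ck k (D j)" for k j
  proof (induction k arbitrary: j)
    case (Suc k)
    then show ?case using D(2) by (intro Ck_SucI[of _ "D (Suc j)"]) auto
  qed simp
  moreover have "D 0 = (\<lambda>t. \<sigma> (cis t))" using D(1) by auto
  ultimately show "smooth (\<lambda>t. \<sigma> (cis t))" by (metis smooth_def)
next
  assume s: "smooth (\<lambda>t. \<sigma> (cis t))"
  define d where "d f t = vector_derivative f (at t)" for f :: "real \<Rightarrow> complex" and t
  define D where "D k = (d ^^ k) (\<lambda>t. \<sigma> (cis t))" for k
  have step: "(f has_vector_derivative d f t) (at t)" "smooth (d f)" if "smooth f" for f t
  proof -
    obtain f' where f': "\<And>t. (f has_vector_derivative f' t) (at t)" "smooth f'"
      by (rule smoothD[OF \<open>smooth f\<close>]) (rule that)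
    then have "d f = f'" unfolding d_def by (auto intro!: ext vector_derivative_at)
    then show "(f has_vector_derivative d f t) (at t)" "smooth (d f)" using f' by auto
  qed
  have "smooth (D k)" for k by (induction k) (auto simp: D_def s step)
  then have "(D k has_vector_derivative D (Suc k) t) (at t)" for k t
    using step(1)[of "D k"] by (simp add: D_def)
  then show "circle_smooth \<sigma>" unfolding circle_smooth_def by (intro exI[of _ D]) (auto simp: D_def)
qed

lemma Ck_const: "Ck k (\<lambda>t. c)"
proof (cases k)
  case (Suc j)
  have "Ck j (\<lambda>t :: real. 0 :: 'a)" for j
    by (induction j) (auto intro!: exI[of _ "\<lambda>t. 0"])
  then show ?thesis unfolding Suc by (intro Ck_SucI[of _ "\<lambda>t. 0"]) auto
qed simp

lemma Ck_ident: "Ck k (\<lambda>t. t)"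
  by (cases k) (auto intro!: exI[of _ "\<lambda>t. 1"] Ck_const has_vector_derivative_id[unfolded id_def])

lemma Ck_bounded_linear: "bounded_linear h \<Longrightarrow> Ck k f \<Longrightarrow> Ck k (\<lambda>t. h (f t))"
proof (induction k arbitrary: f)
  case (Suc k)
  from Suc.prems(2) obtain f' where f': "\<forall>t. (f has_vector_derivative f' t) (at t)" "Ck k f'" by auto
  then show ?case
    using Suc.IH[OF Suc.prems(1) f'(2)] bounded_linear.has_vector_derivative[OF Suc.prems(1)]
    by (intro Ck_SucI[of _ "\<lambda>t. h (f' t)"]) auto
qed simp

lemma Ck_add: "Ck k f \<Longrightarrow> Ck k g \<Longrightarrow> Ck k (\<lambda>t. f t + g t)"
proof (induction k arbitrary: f g)
  case (Suc k)
  obtain f' g' where "\<forall>t. (f has_vector_derivative f' t) (at t)" "Ck k f'"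
      "\<forall>t. (g has_vector_derivative g' t) (at t)" "Ck k g'" using Suc.prems by auto
  then show ?case
    using Suc.IH by (intro Ck_SucI[of _ "\<lambda>t. f' t + g' t"]) (auto intro!: has_vector_derivative_add)
qed simp

lemma Ck_bilinear: "bounded_bilinear pr \<Longrightarrow> Ck k f \<Longrightarrow> Ck k g \<Longrightarrow> Ck k (\<lambda>t. pr (f t) (g t))"
proof (induction k arbitrary: f g)
  case (Suc k)
  obtain f' g' where f': "\<forall>t. (f has_vector_derivative f' t) (at t)" "Ck k f'"
      and g': "\<forall>t. (g has_vector_derivative g' t) (at t)" "Ck k g'" using Suc.prems by auto
  have "((\<lambda>t. pr (f t) (g t)) has_vector_derivative pr (f t) (g' t) + pr (f' t) (g t)) (at t)" for t
    using bounded_bilinear.has_vector_derivative[OF Suc.prems(1)] f' g' by auto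
  moreover have "Ck k (\<lambda>t. pr (f t) (g' t) + pr (f' t) (g t))"
    by (intro Ck_add Suc.IH Suc.prems(1) f' g' Ck_Suc_D[OF Suc.prems(2)] Ck_Suc_D[OF Suc.prems(3)])
  ultimately show ?case by (rule Ck_SucI)
qed simp

lemma Ck_mult: "Ck k f \<Longrightarrow> Ck k g \<Longrightarrow> Ck k (\<lambda>t. f t * g t :: 'a::real_normed_algebra)"
  by (rule Ck_bilinear[OF bounded_bilinear_mult])

lemma Ck_compose: "Ck k f \<Longrightarrow> Ck k F \<Longrightarrow> Ck k (\<lambda>t. f (F t :: real))"
proof (induction k arbitrary: f)
  case (Suc k)
  obtain f' F' where f': "\<forall>t. (f has_vector_derivative f' t) (at t)" "Ck k f'"
      and F': "\<forall>t. (F has_vector_derivative F' t) (at t)" "Ck k F'" using Suc.prems by auto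
  have "((\<lambda>t. f (F t)) has_vector_derivative F' t *\<^sub>R f' (F t)) (at t)" for t
    using vector_diff_chain_at[of F "F' t" t f "f' (F t)"] f' F' by (simp add: o_def)
  moreover have "Ck k (\<lambda>t. F' t *\<^sub>R f' (F t))"
    by (intro Ck_bilinear[OF bounded_bilinear_scaleR] Suc.IH f' F' Ck_Suc_D[OF Suc.prems(2)])
  ultimately show ?case by (rule Ck_SucI)
qed simp

lemma Ck_inverse: "Ck k f \<Longrightarrow> (\<And>t. f t \<noteq> 0) \<Longrightarrow> Ck k (\<lambda>t. inverse (f t) :: real)"
proof (induction k arbitrary: f)
  case (Suc k)
  obtain f' where f': "\<forall>t. (f has_vector_derivative f' t) (at t)" "Ck k f'" using Suc.prems by auto
  have "((\<lambda>t. inverse (f t)) has_vector_derivative (- 1) * (f' t * (inverse (f t) * inverse (f t)))) (at t)" for t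
    using f'(1) Suc.prems(2)[of t] unfolding has_real_derivative_iff_has_vector_derivative[symmetric]
    by (auto intro!: derivative_eq_intros simp: power2_eq_square)
  moreover have "Ck k (\<lambda>t. (- 1) * (f' t * (inverse (f t) * inverse (f t))))"
    by (intro Ck_mult Ck_const Suc.IH f' Suc.prems(2) Ck_Suc_D[OF Suc.prems(1)])
  ultimately show ?case by (rule Ck_SucI)
qed simp

lemma Ck_holomorphic:
  assumes V: "open V" "\<And>t. c t \<in> V"
  shows "f holomorphic_on V \<Longrightarrow> Ck k c \<Longrightarrow> Ck k (\<lambda>t. f (c t))"
proof (induction k arbitrary: f)
  case (Suc k)
  obtain c' where c': "\<forall>t. (c has_vector_derivative c' t) (at t)" "Ck k c'" using Suc.prems by auto
  have "((\<lambda>t. f (c t)) has_vector_derivative c' t * deriv f (c t)) (at t)" for t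
  proof -
    have "(f has_field_derivative deriv f (c t)) (at (c t))"
      by (rule holomorphic_derivI[OF Suc.prems(1) V(1) V(2)])
    then show ?thesis
      using field_vector_diff_chain_at[of c "c' t" t f "deriv f (c t)"] c'(1) unfolding o_def by blast
  qed
  moreover have "Ck k (\<lambda>t. c' t * deriv f (c t))"
    by (rule Ck_mult[OF c'(2) Suc.IH[OF holomorphic_deriv[OF Suc.prems(1) V(1)] Ck_Suc_D[OF Suc.prems(2)]]])
  ultimately show ?case by (rule Ck_SucI)
qed simp

lemma smooth_const: "smooth (\<lambda>t. a)"
  and smooth_ident: "smooth (\<lambda>t. t)"
  and smooth_bounded_linear: "bounded_linear h \<Longrightarrow> smooth f \<Longrightarrow> smooth (\<lambda>t. h (f t))"
  and smooth_add: "smooth f \<Longrightarrow> smooth g \<Longrightarrow> smooth (\<lambda>t. f t + g t)"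
  and smooth_mult: "smooth p \<Longrightarrow> smooth q \<Longrightarrow> smooth (\<lambda>t. p t * q t :: 'b::real_normed_algebra)"
  and smooth_compose: "smooth f \<Longrightarrow> smooth F \<Longrightarrow> smooth (\<lambda>t. f (F t :: real))"
  and smooth_inverse: "smooth F \<Longrightarrow> (\<And>t. F t \<noteq> 0) \<Longrightarrow> smooth (\<lambda>t. inverse (F t) :: real)"
  and smooth_holomorphic: "open V \<Longrightarrow> (\<And>t. c t \<in> V) \<Longrightarrow> H holomorphic_on V \<Longrightarrow> smooth c \<Longrightarrow> smooth (\<lambda>t. H (c t))"
  unfolding smooth_def
  by (auto intro: Ck_const Ck_ident Ck_bounded_linear Ck_add Ck_mult Ck_compose Ck_inverse Ck_holomorphic)

lemma smooth_of_real: "smooth f \<Longrightarrow> smooth (\<lambda>t. complex_of_real (f t))"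
  by (rule smooth_bounded_linear[OF bounded_linear_of_real])

lemma smooth_cis: "smooth cis"
proof -
  have "smooth (\<lambda>t. exp (\<i> * complex_of_real t))"
  proof (rule smooth_holomorphic[of UNIV _ exp])
    show "smooth (\<lambda>t. \<i> * complex_of_real t)"
      by (rule smooth_mult[OF smooth_const smooth_of_real[OF smooth_ident]])
  qed (auto intro: holomorphic_intros)
  moreover have "cis = (\<lambda>t. exp (\<i> * complex_of_real t))" by (auto simp: cis_conv_exp)
  ultimately show ?thesis by simp
qed

lemma smooth_arctan: assumes "smooth f" shows "smooth (\<lambda>t. arctan (f t))"
proof -
  obtain f' where f': "\<And>t. (f has_vector_derivative f' t) (at t)" "smooth f'" by (rule smoothD[OF assms]) (rule that)
  have nz: "1 + f t * f t \<noteq> 0" for t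
  proof -
    have "0 \<le> f t * f t" by simp
    then show ?thesis by linarith
  qed
  have "((\<lambda>t. arctan (f t)) has_vector_derivative f' t * inverse (1 + f t * f t)) (at t)" for t
    using f'(1)[of t] unfolding has_real_derivative_iff_has_vector_derivative[symmetric]
    by (auto intro!: derivative_eq_intros simp: power2_eq_square)
  moreover have "smooth (\<lambda>t. f' t * inverse (1 + f t * f t))"
    by (intro smooth_mult smooth_inverse smooth_add smooth_const assms f' nz)
  ultimately show ?thesis by (rule smoothI)
qed

text \<open>
  A bootstrap: \<open>G' = 1 / (F' \<circ> G)\<close>, so \<open>G'\<close> is differentiable as often as \<open>G\<close>.
\<close>

lemma smooth_inverse_function:
  fixes F G :: "real \<Rightarrow> real"
  assumes F: "smooth F" "\<And>t. (F has_real_derivative F' t) (at t)" "\<And>t. F' t \<noteq> 0"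
    and G: "\<And>s. F (G s) = s" "continuous_on UNIV G"
  shows "smooth G"
proof -
  obtain F'' where "\<And>t. (F has_vector_derivative F'' t) (at t)" "smooth F''" by (rule smoothD[OF F(1)]) (rule that)
  then have "F'' = F'" using F(2)
    by (auto intro!: ext simp: has_real_derivative_iff_has_vector_derivative dest: vector_derivative_unique_at)
  then have F': "smooth F'" using \<open>smooth F''\<close> by simp
  have der: "(G has_vector_derivative inverse (F' (G s))) (at s)" for s
    unfolding has_real_derivative_iff_has_vector_derivative[symmetric]
  proof (rule DERIV_inverse_function[of F "F' (G s)" G s "s - 1" "s + 1"])
    show "isCont G s" using G(2) continuous_on_eq_continuous_at[of UNIV G] by auto
  qed (use F G in auto)
  have "Ck k G" for k
  proof (induction k)
    case (Suc k)
    have "Ck k (\<lambda>s. inverse (F' (G s)))"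
      by (rule Ck_inverse[OF Ck_compose[OF _ Suc]]) (use F' F(3) in \<open>auto simp: smooth_def\<close>)
    then show ?case by (rule Ck_SucI[OF der])
  qed simp
  then show ?thesis by (simp add: smooth_def)
qed

text \<open>
  Near each point the lift is the angle of the circle map, relative to its value at that point, and the
  angle can be computed with the principal branch of the logarithm.
\<close>

lemma smooth_lift:
  fixes F :: "real \<Rightarrow> real"
  assumes cont: "continuous_on UNIV F" and sm: "smooth (\<lambda>t. cis (F t))"
  shows "smooth F"
proof -
  obtain c' where c': "\<And>t. ((\<lambda>t. cis (F t)) has_vector_derivative c' t) (at t)" "smooth c'"
    by (rule smoothD[OF sm]) (rule that)
  have "(F has_vector_derivative Im (c' t * cnj (cis (F t)))) (at t)" for t
  proof -
    have "isCont F t" using cont continuous_on_eq_continuous_at[of UNIV F] by auto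
    then obtain e where e: "e > 0" "\<And>s. dist s t < e \<Longrightarrow> dist (F s) (F t) < 1"
      unfolding continuous_at_eps_delta dist_real_def by (metis zero_less_one)
    define h where "h s = cis (F s) * cnj (cis (F t))" for s
    have h: "(h has_vector_derivative c' t * cnj (cis (F t))) (at t)"
      unfolding h_def by (auto intro!: derivative_eq_intros c'(1))
    have ht: "h t = 1" by (simp add: h_def cis_cnj cis_mult)
    have "(Ln has_field_derivative inverse (h t)) (at (h t))" by (rule has_field_derivative_Ln) (simp add: ht)
    then have "((\<lambda>s. Ln (h s)) has_vector_derivative c' t * cnj (cis (F t)) * inverse (h t)) (at t)"
      using field_vector_diff_chain_at[OF h] by (simp add: o_def)
    then have "((\<lambda>s. Im (Ln (h s)) + F t) has_vector_derivative Im (c' t * cnj (cis (F t)))) (at t)"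
      unfolding ht by (auto intro!: derivative_eq_intros bounded_linear.has_vector_derivative[OF bounded_linear_Im])
    then show ?thesis
    proof (rule has_vector_derivative_transform_within_open[of _ _ _ "ball t e"])
      fix s assume "s \<in> ball t e"
      then have "\<bar>F s - F t\<bar> < 1" using e(2)[of s] by (simp add: dist_commute dist_real_def)
      then have b: "- pi < F s - F t" "F s - F t \<le> pi" using pi_gt3 by auto
      have "h s = exp (\<i> * of_real (F s - F t))" by (simp only: h_def cis_cnj cis_mult cis_conv_exp[symmetric]) simp
      then have "Ln (h s) = \<i> * of_real (F s - F t)" using b by (simp add: Ln_exp)
      then show "Im (Ln (h s)) + F t = F s" by simp
    qed (use e in auto)
  qed
  moreover have "smooth (\<lambda>t. Im (c' t * cnj (cis (F t))))"
    by (intro smooth_bounded_linear[OF bounded_linear_Im] smooth_mult c' smooth_bounded_linear[OF bounded_linear_cnj] sm)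
  ultimately show ?thesis by (rule smoothI)
qed

lemma continuous_on_restrict: "continuous_on S f \<Longrightarrow> continuous_on S (restrict f S)"
  by (rule continuous_on_eq) auto

section \<open>Lifts of circle homeomorphisms\<close>

lemma cis_eq_iff_lift: "cis a = cis b \<longleftrightarrow> (\<exists>n::int. a = b + 2 * pi * of_int n)"
proof
  assume "cis a = cis b"
  then have "cis (a - b) = 1" by (simp add: cis_divide[symmetric])
  then have "cos (a - b) = 1" by (metis cis.sel(1) one_complex.sel(1))
  then obtain n :: int where "a - b = of_int n * 2 * pi" using cos_one_2pi_int by blast
  then show "\<exists>n::int. a = b + 2 * pi * of_int n" by (intro exI[of _ n]) (simp add: algebra_simps)
next
  assume "\<exists>n::int. a = b + 2 * pi * of_int n"
  then show "cis a = cis b" by (auto simp: cis_mult[symmetric] cis_multiple_2pi)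
qed

lemma unit_circle_cis: "z \<in> unit_circle \<Longrightarrow> \<exists>t. z = cis t"
  by (metis cis_Arg norm_eq_zero rcis_cmod_Arg rcis_def mem_sphere_0 mult_1 of_real_1)

lemma cis_in_unit_circle [simp]: "cis t \<in> unit_circle"
  by simp

text \<open>
  Over one period a lift increases by a positive multiple of \<open>2\<pi>\<close>, so it is unbounded in both directions.
\<close>

lemma lift_surj:
  assumes F: "continuous_on UNIV F" "strict_mono F" "\<And>t. \<sigma> (cis t) = cis (F t)"
  shows "\<exists>t. F t = s"
proof -
  have step: "F t + 2 * pi \<le> F (t + 2 * pi)" for t
  proof -
    have "cis (F (t + 2 * pi)) = cis (F t)" using F(3)[of "t + 2 * pi"] F(3)[of t] by (simp add: cis_mult[symmetric])
    then obtain n :: int where n: "F (t + 2 * pi) = F t + 2 * pi * of_int n" using cis_eq_iff_lift by blast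
    moreover have "F t < F (t + 2 * pi)" using F(2) by (simp add: strict_mono_def)
    ultimately have "0 < 2 * pi * real_of_int n" by linarith
    then have "n \<ge> 1" by (simp add: zero_less_mult_iff)
    then have "2 * pi * 1 \<le> 2 * pi * real_of_int n" by (intro mult_left_mono) auto
    then show ?thesis using n by simp
  qed
  have up: "F 0 + 2 * pi * real n \<le> F (2 * pi * real n)" for n
  proof (induction n)
    case (Suc n)
    then show ?case using step[of "2 * pi * real n"] by (simp add: algebra_simps)
  qed simp
  have down: "F (- (2 * pi * real n)) \<le> F 0 - 2 * pi * real n" for n
  proof (induction n)
    case (Suc n)
    then show ?case using step[of "- (2 * pi * real (Suc n))"] by (simp add: algebra_simps)
  qed simp
  obtain n :: nat where n: "\<bar>s - F 0\<bar> \<le> real n" using real_arch_simple by blast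
  have "real n \<le> 2 * pi * real n" using mult_right_mono[of 1 "2 * pi" "real n"] pi_gt3 by simp
  then have "F (- (2 * pi * real n)) \<le> s" "s \<le> F (2 * pi * real n)"
    using n up[of n] down[of n] by linarith+
  moreover have "- (2 * pi * real n) \<le> 2 * pi * real n" by simp
  ultimately show ?thesis
    using IVT'[of F "- (2 * pi * real n)" s "2 * pi * real n"] F(1) continuous_on_subset by blast
qed

lemma lift_inverse:
  assumes F: "continuous_on UNIV F" "strict_mono F" "\<And>t. \<sigma> (cis t) = cis (F t)"
  obtains G where "continuous_on UNIV G" "strict_mono G" "\<And>s. F (G s) = s" "\<And>t. G (F t) = t"
proof -
  define G where "G = inv_into UNIV F"
  have inj: "inj F" using F(2) by (rule strict_mono_imp_inj_on)
  have FG: "F (G s) = s" for s unfolding G_def using lift_surj[OF F] by (metis f_inv_into_f rangeI)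
  have GF: "G (F t) = t" for t unfolding G_def using inj by simp
  have mono: "strict_mono G"
    unfolding strict_mono_def using F(2) FG by (metis strict_mono_less)
  have "isCont G (F t)" for t
    by (rule isCont_inverse_function[of 1]) (use F(1) GF continuous_on_eq_continuous_at[of UNIV F] in auto)
  then have "continuous_on UNIV G"
    using FG by (metis continuous_at_imp_continuous_on)
  then show ?thesis using that mono FG GF by blast
qed

lemma circle_homeosE:
  assumes "\<sigma> \<in> circle_homeos"
  obtains F where "continuous_on UNIV F" "strict_mono F" "\<And>t. \<sigma> (cis t) = cis (F t)"
  using assms by (auto simp: circle_homeos_def orientation_preserving_def)

lemma circle_homeos_Bij: "\<sigma> \<in> circle_homeos \<Longrightarrow> \<sigma> \<in> Bij unit_circle"
  by (simp add: circle_homeos_def)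

lemma circle_homeos_continuous: "\<sigma> \<in> circle_homeos \<Longrightarrow> continuous_on unit_circle \<sigma>"
  by (auto simp: circle_homeos_def homeomorphism_def)

lemma Bij_unit_circle:
  assumes "\<sigma> \<in> Bij unit_circle"
  shows "z \<in> unit_circle \<Longrightarrow> \<sigma> z \<in> unit_circle"
    and "z \<in> unit_circle \<Longrightarrow> inv_into unit_circle \<sigma> z \<in> unit_circle"
    and "z \<in> unit_circle \<Longrightarrow> inv_into unit_circle \<sigma> (\<sigma> z) = z"
    and "z \<in> unit_circle \<Longrightarrow> \<sigma> (inv_into unit_circle \<sigma> z) = z"
proof -
  assume z: "z \<in> unit_circle"
  have b: "bij_betw \<sigma> unit_circle unit_circle" using assms by (simp add: Bij_def)
  show "\<sigma> z \<in> unit_circle" "inv_into unit_circle \<sigma> z \<in> unit_circle"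
    using bij_betwE[OF b] bij_betwE[OF bij_betw_inv_into[OF b]] z by blast+
  show "inv_into unit_circle \<sigma> (\<sigma> z) = z" "\<sigma> (inv_into unit_circle \<sigma> z) = z"
    using bij_betw_inv_into_left[OF b z] bij_betw_inv_into_right[OF b z] .
qed

lemma circle_homeosI:
  assumes "\<sigma> \<in> Bij unit_circle" "continuous_on unit_circle \<sigma>" "orientation_preserving \<sigma>"
  shows "\<sigma> \<in> circle_homeos"
proof -
  have b: "bij_betw \<sigma> unit_circle unit_circle" using assms(1) by (simp add: Bij_def)
  have "continuous_on (\<sigma> ` unit_circle) (inv_into unit_circle \<sigma>)"
    by (rule continuous_on_inv[OF assms(2) compact_sphere]) (use b in \<open>auto simp: bij_betw_def\<close>)
  then have "continuous_on unit_circle (inv_into unit_circle \<sigma>)" using b by (simp add: bij_betw_def)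
  then have "homeomorphism unit_circle unit_circle \<sigma> (inv_into unit_circle \<sigma>)"
    by (rule homeomorphismI[OF assms(2)]) (use Bij_unit_circle[OF assms(1)] in blast)+
  then show ?thesis using assms by (simp add: circle_homeos_def)
qed

text \<open>
  Degree one of the lift makes the circle map injective.
\<close>

lemma circle_homeo_of_lift:
  assumes ext: "\<sigma> \<in> extensional unit_circle" and cont: "continuous_on unit_circle \<sigma>"
    and F: "continuous_on UNIV F" "strict_mono F" "\<And>t. F (t + 2 * pi) = F t + 2 * pi" "\<And>t. \<sigma> (cis t) = cis (F t)"
  shows "\<sigma> \<in> circle_homeos"
proof (rule circle_homeosI)
  show "orientation_preserving \<sigma>" using F by (auto simp: orientation_preserving_def)
  have per: "F (t + 2 * pi * of_int n) = F t + 2 * pi * of_int n" for t and n :: int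
  proof (induction n rule: int_induct[of _ 0])
    case (step1 n)
    then show ?case using F(3)[of "t + 2 * pi * of_int n"] by (simp add: algebra_simps)
  next
    case (step2 n)
    then show ?case using F(3)[of "t + 2 * pi * of_int (n - 1)"] by (simp add: algebra_simps)
  qed simp
  have "inj_on \<sigma> unit_circle"
  proof (rule inj_onI)
    fix z w assume "z \<in> unit_circle" "w \<in> unit_circle" "\<sigma> z = \<sigma> w"
    then obtain a b where ab: "z = cis a" "w = cis b" using unit_circle_cis by blast
    then have "cis (F a) = cis (F b)" using \<open>\<sigma> z = \<sigma> w\<close> F(4) by simp
    then obtain n :: int where "F a = F (b + 2 * pi * of_int n)" using cis_eq_iff_lift per by auto
    then have "a = b + 2 * pi * of_int n" using F(2) by (metis strict_mono_eq)
    then show "z = w" using ab cis_eq_iff_lift by blast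
  qed
  moreover have "\<sigma> ` unit_circle = unit_circle"
  proof
    show "\<sigma> ` unit_circle \<subseteq> unit_circle"
    proof (rule image_subsetI)
      fix z assume "z \<in> unit_circle"
      then obtain t where "z = cis t" using unit_circle_cis by blast
      then show "\<sigma> z \<in> unit_circle" using F(4) by simp
    qed
    show "unit_circle \<subseteq> \<sigma> ` unit_circle"
    proof
      fix z assume "z \<in> unit_circle"
      then obtain s where s: "z = cis s" using unit_circle_cis by blast
      obtain t where "F t = s" using lift_surj[OF F(1,2,4)] by blast
      then have "z = \<sigma> (cis t)" using s F(4) by simp
      then show "z \<in> \<sigma> ` unit_circle" by simp
    qed
  qed
  ultimately show "\<sigma> \<in> Bij unit_circle" using ext by (simp add: Bij_def bij_betw_def)
qed (rule cont)

subsection \<open>The groups of homeomorphisms and of diffeomorphisms\<close>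

lemma subgroup_BijGroupI:
  assumes sub: "A \<subseteq> Bij S" and one: "(\<lambda>x\<in>S. x) \<in> A"
    and comp: "\<And>\<sigma> \<tau>. \<sigma> \<in> A \<Longrightarrow> \<tau> \<in> A \<Longrightarrow> compose S \<sigma> \<tau> \<in> A"
    and inv: "\<And>\<sigma>. \<sigma> \<in> A \<Longrightarrow> restrict (inv_into S \<sigma>) S \<in> A"
  shows "subgroup A (BijGroup S)"
proof (rule group.subgroupI[OF group_BijGroup])
  show "A \<subseteq> carrier (BijGroup S)" using sub by (simp add: BijGroup_def)
  show "A \<noteq> {}" using one by auto
  show "inv\<^bsub>BijGroup S\<^esub> a \<in> A" if "a \<in> A" for a
    using inv[OF that] inv_BijGroup[of a S] that sub by auto
  show "a \<otimes>\<^bsub>BijGroup S\<^esub> b \<in> A" if "a \<in> A" "b \<in> A" for a b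
    using comp[OF that] that sub by (auto simp: BijGroup_def)
qed

lemma id_circle_homeo: "(\<lambda>z\<in>unit_circle. z) \<in> circle_homeos"
proof (rule circle_homeo_of_lift[of _ "\<lambda>t. t"])
  show "continuous_on unit_circle (\<lambda>z\<in>unit_circle. z)"
    by (intro continuous_on_restrict continuous_intros)
qed (auto simp: strict_mono_def intro: continuous_intros)

lemma compose_circle_homeo:
  assumes "\<sigma> \<in> circle_homeos" "\<tau> \<in> circle_homeos"
  shows "compose unit_circle \<sigma> \<tau> \<in> circle_homeos"
proof (rule circle_homeosI)
  note B = circle_homeos_Bij[OF assms(1)] circle_homeos_Bij[OF assms(2)]
  show "compose unit_circle \<sigma> \<tau> \<in> Bij unit_circle" using B by (rule compose_Bij)
  have "continuous_on unit_circle (\<lambda>z. \<sigma> (\<tau> z))"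
    by (rule continuous_on_compose2[OF circle_homeos_continuous[OF assms(1)] circle_homeos_continuous[OF assms(2)]])
      (use Bij_unit_circle(1)[OF B(2)] in blast)
  then show "continuous_on unit_circle (compose unit_circle \<sigma> \<tau>)"
    unfolding compose_def by (rule continuous_on_restrict)
  obtain F where F: "continuous_on UNIV F" "strict_mono F" "\<And>t. \<sigma> (cis t) = cis (F t)" using assms(1) by (rule circle_homeosE) (rule that)
  obtain G where G: "continuous_on UNIV G" "strict_mono G" "\<And>t. \<tau> (cis t) = cis (G t)" using assms(2) by (rule circle_homeosE) (rule that)
  have "continuous_on UNIV (\<lambda>t. F (G t))" using continuous_on_compose2[OF F(1) G(1)] by simp
  moreover have "strict_mono (\<lambda>t. F (G t))" using F(2) G(2) by (simp add: strict_mono_def)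
  moreover have "compose unit_circle \<sigma> \<tau> (cis t) = cis (F (G t))" for t using F(3) G(3) by (simp add: compose_def)
  ultimately show "orientation_preserving (compose unit_circle \<sigma> \<tau>)" unfolding orientation_preserving_def by blast
qed

lemma inverse_lift:
  assumes \<sigma>: "\<sigma> \<in> Bij unit_circle" and F: "\<And>t. \<sigma> (cis t) = cis (F t)" "\<And>s. F (G s) = s"
  shows "inv_into unit_circle \<sigma> (cis s) = cis (G s)"
  using Bij_unit_circle(3)[OF \<sigma> cis_in_unit_circle, of "G s"] unfolding F(1) F(2) .

lemma inverse_circle_homeo:
  assumes "\<sigma> \<in> circle_homeos"
  shows "restrict (inv_into unit_circle \<sigma>) unit_circle \<in> circle_homeos"
proof (rule circle_homeosI)
  note B = circle_homeos_Bij[OF assms]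
  show "restrict (inv_into unit_circle \<sigma>) unit_circle \<in> Bij unit_circle" by (rule restrict_inv_into_Bij[OF B])
  have "continuous_on unit_circle (inv_into unit_circle \<sigma>)" using assms by (auto simp: circle_homeos_def homeomorphism_def)
  then show "continuous_on unit_circle (restrict (inv_into unit_circle \<sigma>) unit_circle)" by (rule continuous_on_restrict)
  obtain F where F: "continuous_on UNIV F" "strict_mono F" "\<And>t. \<sigma> (cis t) = cis (F t)" using assms by (rule circle_homeosE) (rule that)
  obtain G where G: "continuous_on UNIV G" "strict_mono G" "\<And>s. F (G s) = s" using lift_inverse[OF F] by metis
  then show "orientation_preserving (restrict (inv_into unit_circle \<sigma>) unit_circle)"
    unfolding orientation_preserving_def using inverse_lift[OF B F(3) G(3)] by auto
qed

theorem subgroup_circle_homeos: "subgroup circle_homeos (BijGroup unit_circle)"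
  using circle_homeos_Bij id_circle_homeo compose_circle_homeo inverse_circle_homeo
  by (intro subgroup_BijGroupI) auto

lemma circle_smooth_lift:
  assumes "continuous_on UNIV F" "\<And>t. \<sigma> (cis t) = cis (F t)"
  shows "circle_smooth \<sigma> \<longleftrightarrow> smooth F"
  unfolding circle_smooth_iff assms(2)
  using smooth_lift[OF assms(1)] smooth_compose[OF smooth_cis, of F] by (rule iffI)

lemma circle_smooth_cong: "(\<And>z. z \<in> unit_circle \<Longrightarrow> \<sigma> z = \<tau> z) \<Longrightarrow> circle_smooth \<sigma> \<longleftrightarrow> circle_smooth \<tau>"
  unfolding circle_smooth_iff by simp

lemma circle_smooth_compose:
  assumes "\<sigma> \<in> circle_homeos" "\<tau> \<in> circle_homeos" "circle_smooth \<sigma>" "circle_smooth \<tau>"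
  shows "circle_smooth (\<lambda>z. \<sigma> (\<tau> z))"
proof -
  obtain F where F: "continuous_on UNIV F" "strict_mono F" "\<And>t. \<sigma> (cis t) = cis (F t)" using assms(1) by (rule circle_homeosE) (rule that)
  obtain G where G: "continuous_on UNIV G" "strict_mono G" "\<And>t. \<tau> (cis t) = cis (G t)" using assms(2) by (rule circle_homeosE) (rule that)
  have "continuous_on UNIV (\<lambda>t. F (G t))" using continuous_on_compose2[OF F(1) G(1)] by simp
  moreover have "smooth (\<lambda>t. F (G t))"
    using assms(3,4) circle_smooth_lift[OF F(1,3)] circle_smooth_lift[OF G(1,3)] smooth_compose by blast
  ultimately show ?thesis using circle_smooth_lift[of "\<lambda>t. F (G t)" "\<lambda>z. \<sigma> (\<tau> z)"] F(3) G(3) by simp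
qed

lemma inverse_of_inverse:
  assumes "\<sigma> \<in> Bij S" "z \<in> S"
  shows "inv_into S (restrict (inv_into S \<sigma>) S) z = \<sigma> z"
proof -
  have b: "bij_betw \<sigma> S S" using assms by (simp add: Bij_def)
  have "inj_on (restrict (inv_into S \<sigma>) S) S" using bij_betw_inv_into[OF b] by (auto simp: bij_betw_def)
  moreover have "\<sigma> z \<in> S" "restrict (inv_into S \<sigma>) S (\<sigma> z) = z" using b assms(2) by (auto simp: bij_betw_def inv_into_f_f)
  ultimately show ?thesis by (metis inv_into_f_eq)
qed

lemma inverse_of_compose:
  assumes "\<sigma> \<in> Bij S" "\<tau> \<in> Bij S" "z \<in> S"
  shows "inv_into S (compose S \<sigma> \<tau>) z = inv_into S \<tau> (inv_into S \<sigma> z)"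
proof (rule inv_into_f_eq)
  have b: "bij_betw \<sigma> S S" "bij_betw \<tau> S S" using assms by (simp_all add: Bij_def)
  show "inj_on (compose S \<sigma> \<tau>) S" using compose_Bij[OF assms(1,2)] by (simp add: Bij_def bij_betw_def)
  have 1: "inv_into S \<sigma> z \<in> S" using b(1) assms(3) by (auto simp: bij_betw_def intro: inv_into_into)
  then show 2: "inv_into S \<tau> (inv_into S \<sigma> z) \<in> S" using b(2) by (metis bij_betw_def inv_into_into)
  show "compose S \<sigma> \<tau> (inv_into S \<tau> (inv_into S \<sigma> z)) = z"
    using 1 2 b assms(3) by (simp add: compose_def bij_betw_def f_inv_into_f)
qed

text \<open>
  Diffeomorphisms and radical diffeomorphisms are both defined by a condition on a map and on its
  inverse. Such a set is a subgroup as soon as the condition is stable under composition; inverses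
  are built in.
\<close>

lemma subgroup_two_sided:
  fixes P :: "(complex \<Rightarrow> complex) \<Rightarrow> bool"
  assumes cong: "\<And>\<sigma> \<tau>. (\<And>z. z \<in> unit_circle \<Longrightarrow> \<sigma> z = \<tau> z) \<Longrightarrow> P \<sigma> \<Longrightarrow> P \<tau>"
    and H: "subgroup H (BijGroup unit_circle)"
    and id: "P (\<lambda>z. z)"
    and comp: "\<And>\<sigma> \<tau>. \<sigma> \<in> H \<Longrightarrow> \<tau> \<in> H \<Longrightarrow> P \<sigma> \<Longrightarrow> P \<tau> \<Longrightarrow> P (\<lambda>z. \<sigma> (\<tau> z))"
  shows "subgroup {\<sigma> \<in> H. P \<sigma> \<and> P (inv_into unit_circle \<sigma>)} (BijGroup unit_circle)"
proof (rule subgroup_BijGroupI)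
  let ?S = unit_circle
  have HB: "\<sigma> \<in> Bij ?S" if "\<sigma> \<in> H" for \<sigma> using subgroup.subset[OF H] that by (auto simp: BijGroup_def)
  have Hinv: "restrict (inv_into ?S \<sigma>) ?S \<in> H" if "\<sigma> \<in> H" for \<sigma>
    using subgroup.m_inv_closed[OF H that] inv_BijGroup[OF HB[OF that]] by simp
  show "{\<sigma> \<in> H. P \<sigma> \<and> P (inv_into ?S \<sigma>)} \<subseteq> Bij ?S" using HB by auto
  have idH: "(\<lambda>x\<in>?S. x) \<in> H" using subgroup.one_closed[OF H] by (simp add: BijGroup_def)
  have "P (\<lambda>x\<in>?S. x)" by (rule cong[OF _ id]) simp
  moreover have "P (inv_into ?S (\<lambda>x\<in>?S. x))"
  proof (rule cong[OF _ id])
    fix z :: complex assume z: "z \<in> ?S"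
    have "inj_on (\<lambda>x\<in>?S. x) ?S" by (simp add: inj_on_def)
    then show "z = inv_into ?S (\<lambda>x\<in>?S. x) z" using z by (metis inv_into_f_f restrict_apply')
  qed
  ultimately show "(\<lambda>x\<in>?S. x) \<in> {\<sigma> \<in> H. P \<sigma> \<and> P (inv_into ?S \<sigma>)}" using idH by simp
  fix \<sigma> assume "\<sigma> \<in> {\<sigma> \<in> H. P \<sigma> \<and> P (inv_into ?S \<sigma>)}"
  then have \<sigma>: "\<sigma> \<in> H" "P \<sigma>" "P (inv_into ?S \<sigma>)" by auto
  have "P (restrict (inv_into ?S \<sigma>) ?S)" by (rule cong[OF _ \<sigma>(3)]) simp
  note rinv = this
  moreover have "P (inv_into ?S (restrict (inv_into ?S \<sigma>) ?S))"
    by (rule cong[OF _ \<sigma>(2)]) (simp add: inverse_of_inverse[OF HB[OF \<sigma>(1)]] del: mem_sphere_0)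
  ultimately show "restrict (inv_into ?S \<sigma>) ?S \<in> {\<sigma> \<in> H. P \<sigma> \<and> P (inv_into ?S \<sigma>)}" using Hinv[OF \<sigma>(1)] by simp
  fix \<tau> assume "\<tau> \<in> {\<sigma> \<in> H. P \<sigma> \<and> P (inv_into ?S \<sigma>)}"
  then have \<tau>: "\<tau> \<in> H" "P \<tau>" "P (inv_into ?S \<tau>)" by auto
  have "P (restrict (inv_into ?S \<tau>) ?S)" by (rule cong[OF _ \<tau>(3)]) simp
  then have "P (\<lambda>z. restrict (inv_into ?S \<tau>) ?S (restrict (inv_into ?S \<sigma>) ?S z))"
    using comp[OF Hinv[OF \<tau>(1)] Hinv[OF \<sigma>(1)]] rinv by blast
  then have "P (inv_into ?S (compose ?S \<sigma> \<tau>))"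
    by (rule cong[rotated]) (simp only: inverse_of_compose[OF HB[OF \<sigma>(1)] HB[OF \<tau>(1)]]
        Bij_unit_circle(2)[OF HB[OF \<sigma>(1)]] restrict_apply')
  moreover have "P (compose ?S \<sigma> \<tau>)"
    by (rule cong[OF _ comp[OF \<sigma>(1) \<tau>(1) \<sigma>(2) \<tau>(2)]]) (simp add: compose_def)
  moreover have "compose ?S \<sigma> \<tau> \<in> H"
    using subgroup.m_closed[OF H \<sigma>(1) \<tau>(1)] HB[OF \<sigma>(1)] HB[OF \<tau>(1)] by (simp add: BijGroup_def)
  ultimately show "compose ?S \<sigma> \<tau> \<in> {\<sigma> \<in> H. P \<sigma> \<and> P (inv_into ?S \<sigma>)}" by simp
qed

theorem subgroup_circle_diffeos: "subgroup circle_diffeos (BijGroup unit_circle)"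
  unfolding circle_diffeos_def
proof (rule subgroup_two_sided[OF _ subgroup_circle_homeos])
  show "circle_smooth (\<lambda>z. z)" by (simp add: circle_smooth_iff smooth_cis)
  show "circle_smooth \<tau>" if "\<And>z. z \<in> unit_circle \<Longrightarrow> \<sigma> z = \<tau> z" "circle_smooth \<sigma>" for \<sigma> \<tau>
    using circle_smooth_cong[of \<sigma> \<tau>] that by blast
qed (rule circle_smooth_compose)

section \<open>Twists\<close>

text \<open>
  For real \<open>x\<close> the factor \<open>(1 + \<i> x) / (1 - \<i> x)\<close> has modulus 1 and argument
  \<open>2 arctan x\<close>. So a twist rotates each \<open>z\<close> by an angle depending on \<open>z\<close>, and still is a
  rational expression in \<open>z\<close> and \<open>h z\<close>.
\<close>

definition twist :: "(complex \<Rightarrow> real) \<Rightarrow> complex \<Rightarrow> complex" where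
  "twist h = (\<lambda>z\<in>unit_circle. z * (1 + \<i> * of_real (h z)) / (1 - \<i> * of_real (h z)))"

lemma cis_double_arctan: "cis (2 * arctan x) = (1 + \<i> * of_real x) / (1 - \<i> * of_real x)"
proof -
  define s where "s = sqrt (1 + x\<^sup>2)"
  have "0 < 1 + x\<^sup>2" by (rule add_pos_nonneg) auto
  then have s: "s > 0" by (simp add: s_def)
  have p: "1 + \<i> * of_real x = of_real s * cis (arctan x)" and m: "1 - \<i> * of_real x = of_real s * cis (- arctan x)"
    using s by (auto simp: complex_eq_iff cos_arctan sin_arctan s_def[symmetric])
  have "(1 + \<i> * of_real x) / (1 - \<i> * of_real x) = cis (arctan x) / cis (- arctan x)"
    unfolding p m using s by simp
  then show ?thesis by (simp only: cis_divide) simp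
qed

lemma twist_cis: "twist h (cis t) = cis (t + 2 * arctan (h (cis t)))"
  unfolding twist_def cis_mult[symmetric] cis_double_arctan by simp

lemma one_minus_i_real_nonzero: "1 - \<i> * of_real x \<noteq> 0"
  by (simp add: complex_eq_iff)

lemma twist_continuous: "continuous_on unit_circle h \<Longrightarrow> continuous_on unit_circle (twist h)"
  unfolding twist_def using one_minus_i_real_nonzero
  by (intro continuous_on_restrict continuous_intros) auto

lemma circle_curve_continuous:
  assumes "continuous_on unit_circle h" shows "continuous_on UNIV (\<lambda>t. h (cis t))"
  by (rule continuous_on_compose2[OF assms]) (auto intro: continuous_intros)

lemma twist_homeo:
  assumes h: "continuous_on unit_circle h" and mono: "strict_mono (\<lambda>t. t + 2 * arctan (h (cis t)))"
  shows "twist h \<in> circle_homeos"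
proof (rule circle_homeo_of_lift[OF _ twist_continuous[OF h] _ mono _ twist_cis])
  show "twist h \<in> extensional unit_circle" by (simp add: twist_def)
  show "continuous_on UNIV (\<lambda>t. t + 2 * arctan (h (cis t)))"
    by (intro continuous_intros circle_curve_continuous[OF h])
  show "t + 2 * pi + 2 * arctan (h (cis (t + 2 * pi))) = t + 2 * arctan (h (cis t)) + 2 * pi" for t
    by (simp add: cis_mult[symmetric])
qed

text \<open>
  The lift \<open>t + 2 arctan (h (cis t))\<close> has derivative \<open>1 + 2 h' / (1 + h\<^sup>2)\<close>, which is positive
  for \<open>|h'| < 1/2\<close>.
\<close>

lemma twist_diffeo:
  assumes h: "continuous_on unit_circle h" "smooth (\<lambda>t. h (cis t))"
    and d: "\<And>t. ((\<lambda>t. h (cis t)) has_real_derivative h' t) (at t)" "\<And>t. \<bar>h' t\<bar> < 1 / 2"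
  shows "twist h \<in> circle_diffeos"
proof -
  define F where "F t = t + 2 * arctan (h (cis t))" for t
  define F' where "F' t = 1 + 2 * (h' t / (1 + (h (cis t))\<^sup>2))" for t
  have sq: "1 \<le> 1 + x\<^sup>2" for x :: real by simp
  have F': "(F has_real_derivative F' t) (at t)" for t
    unfolding F_def F'_def using sq[of "h (cis t)"]
    by (auto intro!: derivative_eq_intros d simp: divide_simps)
  have pos: "F' t > 0" for t
  proof -
    have "\<bar>h' t / (1 + (h (cis t))\<^sup>2)\<bar> \<le> \<bar>h' t\<bar>"
    proof -
      have "0 < 1 + (h (cis t))\<^sup>2" using sq[of "h (cis t)"] by linarith
      moreover have "\<bar>h' t\<bar> * 1 \<le> \<bar>h' t\<bar> * (1 + (h (cis t))\<^sup>2)"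
        using sq[of "h (cis t)"] by (intro mult_left_mono) auto
      ultimately show ?thesis by (simp add: abs_divide divide_le_eq)
    qed
    then show ?thesis using d(2)[of t] unfolding F'_def by linarith
  qed
  have mono: "strict_mono F"
    unfolding strict_mono_def using DERIV_pos_imp_increasing F' pos by metis
  have homeo: "twist h \<in> circle_homeos" using twist_homeo[OF h(1)] mono unfolding F_def[abs_def] .
  have contF: "continuous_on UNIV F" unfolding F_def by (intro continuous_intros circle_curve_continuous[OF h(1)])
  have tF: "twist h (cis t) = cis (F t)" for t unfolding F_def by (rule twist_cis)
  have "smooth (\<lambda>t. t + 2 * arctan (h (cis t)))"
    by (rule smooth_add[OF smooth_ident smooth_mult[OF smooth_const smooth_arctan[OF h(2)]]])
  then have smF: "smooth F" by (simp add: F_def[abs_def])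
  obtain G where G: "continuous_on UNIV G" "\<And>s. F (G s) = s"
    using lift_inverse[OF contF mono tF] by metis
  have "smooth G" using smooth_inverse_function[OF smF F' _ G(2,1)] pos by (metis less_irrefl)
  moreover have "inv_into unit_circle (twist h) (cis s) = cis (G s)" for s
    by (rule inverse_lift[OF circle_homeos_Bij[OF homeo] tF G(2)])
  ultimately have "circle_smooth (inv_into unit_circle (twist h))"
    using circle_smooth_lift[OF G(1)] by blast
  then show ?thesis using homeo circle_smooth_lift[OF contF tF] smF by (simp add: circle_diffeos_def)
qed

section \<open>Diffeomorphisms of finite type\<close>

text \<open>
  The formula for \<open>\<phi>\<^sub>n(w)\<close> defines a holomorphic function near the circle. The domain is where both
  radicands have positive real part, so that the principal root is holomorphic.
\<close>

definition Phi :: "nat \<Rightarrow> complex \<Rightarrow> complex \<Rightarrow> complex" where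
  "Phi n w z = z * (1 + cnj w * inverse (z ^ n)) powr (1 / of_nat n) / (1 + w * z ^ n) powr (1 / of_nat n)"

definition Phi_domain :: "nat \<Rightarrow> complex \<Rightarrow> complex set" where
  "Phi_domain n w = {z. z \<noteq> 0 \<and> 0 < Re (1 + cnj w * inverse (z ^ n)) \<and> 0 < Re (1 + w * z ^ n)}"

lemma phi_eq_Phi: "z \<in> unit_circle \<Longrightarrow> phi n w z = Phi n w z"
  by (simp add: phi_def Phi_def)

lemma open_Phi_domain: "open (Phi_domain n w)"
proof -
  have "continuous_on {z. z \<noteq> 0} (\<lambda>z. Re (1 + cnj w * inverse (z ^ n)))"
    by (rule continuous_on_Re, intro continuous_intros ballI) simp
  moreover have "open {z :: complex. z \<noteq> 0}" by (simp add: open_Collect_neq)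
  ultimately have "open ({z. z \<noteq> 0} \<inter> (\<lambda>z. Re (1 + cnj w * inverse (z ^ n))) -` {0<..})"
    by (intro continuous_open_preimage) auto
  moreover have "continuous_on UNIV (\<lambda>z. Re (1 + w * z ^ n))"
    by (rule continuous_on_Re, intro continuous_intros)
  then have "open ((\<lambda>z. Re (1 + w * z ^ n)) -` {0<..})"
    by (intro open_vimage) auto
  ultimately have "open (({z. z \<noteq> 0} \<inter> (\<lambda>z. Re (1 + cnj w * inverse (z ^ n))) -` {0<..}) \<inter> (\<lambda>z. Re (1 + w * z ^ n)) -` {0<..})"
    by (rule open_Int)
  moreover have "Phi_domain n w = ({z. z \<noteq> 0} \<inter> (\<lambda>z. Re (1 + cnj w * inverse (z ^ n))) -` {0<..}) \<inter> (\<lambda>z. Re (1 + w * z ^ n)) -` {0<..}"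
    unfolding Phi_domain_def by blast
  ultimately show ?thesis by simp
qed

lemma Phi_domainD:
  assumes "z \<in> Phi_domain n w"
  shows "z \<noteq> 0" "1 + cnj w * inverse (z ^ n) \<notin> \<real>\<^sub>\<le>\<^sub>0" "1 + w * z ^ n \<notin> \<real>\<^sub>\<le>\<^sub>0"
    "1 + cnj w * inverse (z ^ n) \<noteq> 0" "1 + w * z ^ n \<noteq> 0"
proof -
  have 1: "u \<notin> \<real>\<^sub>\<le>\<^sub>0 \<and> u \<noteq> 0" if "0 < Re u" for u
    using that by (auto simp: complex_nonpos_Reals_iff)
  have 2: "z \<noteq> 0" "0 < Re (1 + cnj w * inverse (z ^ n))" "0 < Re (1 + w * z ^ n)"
    using assms unfolding Phi_domain_def by blast+
  show "z \<noteq> 0" "1 + cnj w * inverse (z ^ n) \<notin> \<real>\<^sub>\<le>\<^sub>0" "1 + w * z ^ n \<notin> \<real>\<^sub>\<le>\<^sub>0"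
    "1 + cnj w * inverse (z ^ n) \<noteq> 0" "1 + w * z ^ n \<noteq> 0"
    using 1[OF 2(2)] 1[OF 2(3)] 2(1) by blast+
qed

lemma Re_one_plus_pos: "norm v < 1 \<Longrightarrow> 0 < Re (1 + v)"
  using abs_Re_le_cmod[of v] by simp

lemma unit_circle_Phi_domain:
  assumes w: "norm w < 1" and z: "z \<in> unit_circle" shows "z \<in> Phi_domain n w"
proof -
  have "norm (cnj w * inverse (z ^ n)) < 1" "norm (w * z ^ n) < 1"
    using w z by (simp_all add: norm_mult norm_power norm_inverse)
  then have "0 < Re (1 + cnj w * inverse (z ^ n))" "0 < Re (1 + w * z ^ n)"
    using Re_one_plus_pos by blast+
  moreover have "z \<noteq> 0" using z by auto
  ultimately show ?thesis unfolding Phi_domain_def by blast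
qed

lemma Phi_holomorphic: "0 < n \<Longrightarrow> Phi n w holomorphic_on Phi_domain n w"
  unfolding Phi_def[abs_def]
  by (intro holomorphic_intros) (simp_all add: Phi_domainD)

lemma powr_root: "0 < n \<Longrightarrow> x \<noteq> 0 \<Longrightarrow> (x powr (1 / of_nat n)) ^ n = (x :: complex)"
  by (simp add: powr_def exp_of_nat_mult[symmetric] mult.commute)

lemma Phi_power:
  assumes n: "0 < n" and z: "z \<in> Phi_domain n w"
  shows "Phi n w z ^ n = (z ^ n + cnj w) / (1 + w * z ^ n)"
proof -
  have nz: "1 + cnj w * inverse (z ^ n) \<noteq> 0" "1 + w * z ^ n \<noteq> 0" "z \<noteq> 0"
    using Phi_domainD[OF z] by blast+
  have "Phi n w z ^ n = z ^ n * (1 + cnj w * inverse (z ^ n)) / (1 + w * z ^ n)"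
    unfolding Phi_def using powr_root[OF n nz(1)] powr_root[OF n nz(2)] by (simp add: power_mult_distrib power_divide)
  moreover have "z ^ n * (1 + cnj w * inverse (z ^ n)) = z ^ n + cnj w" using nz(3) by (simp add: distrib_left)
  ultimately show ?thesis by simp
qed

lemma powr_root_Re_pos:
  assumes n: "0 < n" and u: "0 < Re u" shows "0 < Re (u powr (1 / of_nat n))"
proof -
  have u0: "u \<noteq> 0" using u by auto
  have "\<bar>Im (Ln u)\<bar> < pi / 2" using Re_Ln_pos_lt[OF u0] u by blast
  then have "\<bar>Im (Ln u) / n\<bar> < pi / 2"
  proof -
    have "\<bar>Im (Ln u) / n\<bar> = \<bar>Im (Ln u)\<bar> / n" by simp
    also have "\<dots> \<le> \<bar>Im (Ln u)\<bar>" using n by (simp add: divide_le_eq mult_le_cancel_left1)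
    finally show ?thesis using \<open>\<bar>Im (Ln u)\<bar> < pi / 2\<close> by (rule le_less_trans)
  qed
  then have "0 < cos (Im (Ln u) / n)" by (intro cos_gt_zero_pi) linarith+
  moreover have "u powr (1 / of_nat n) = exp (Ln u / of_nat n)" using u0 by (simp add: powr_def)
  ultimately show ?thesis by (simp add: Re_exp Im_divide_of_nat)
qed

text \<open>
  On the circle the two radicands are conjugate, so \<open>\<phi>\<^sub>n(w; z) = z cnj q / q\<close> for the root
  \<open>q\<close> of the denominator; this is the twist by minus the slope of \<open>q\<close>.
\<close>

lemma phi_is_twist:
  assumes n: "0 < n" and w: "norm w < 1"
  shows "phi n w = twist (\<lambda>z. - Im ((1 + w * z ^ n) powr (1 / of_nat n)) / Re ((1 + w * z ^ n) powr (1 / of_nat n)))"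
    (is "_ = twist ?h")
proof
  fix z
  show "phi n w z = twist ?h z"
  proof (cases "z \<in> unit_circle")
    case z: True
    define u where "u = 1 + w * z ^ n"
    define q where "q = u powr (1 / of_nat n)"
    have u: "0 < Re u" using unit_circle_Phi_domain[OF w z, of n] by (simp add: Phi_domain_def u_def)
    then have q: "0 < Re q" unfolding q_def by (rule powr_root_Re_pos[OF n])
    have "cnj z = inverse z" using z complex_norm_square[of z] by (metis inverse_unique mem_sphere_0 of_real_1 power_one)
    then have 1: "1 + cnj w * inverse (z ^ n) = cnj u" by (simp add: u_def power_inverse)
    have 2: "cnj u powr (1 / of_nat n) = cnj q"
      unfolding q_def using u by (subst cnj_powr) auto
    have "phi n w z = z * cnj q / q"
      unfolding phi_eq_Phi[OF z] Phi_def 1 2 u_def[symmetric] q_def[symmetric] ..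
    moreover define x where "x = ?h z"
    moreover have "q = of_real (Re q) * (1 - \<i> * of_real x)" "cnj q = of_real (Re q) * (1 + \<i> * of_real x)"
      using q unfolding x_def q_def[symmetric] u_def[symmetric] by (auto simp: complex_eq_iff)
    then have "cnj q / q = (1 + \<i> * of_real x) / (1 - \<i> * of_real x)"
      using q by (metis mult_divide_mult_cancel_left of_real_eq_0_iff less_irrefl)
    ultimately show ?thesis unfolding twist_def restrict_apply'[OF z] x_def[symmetric]
      by (simp only: times_divide_eq_right[symmetric])
  qed (simp add: phi_def twist_def)
qed

lemma continuous_on_root:
  assumes "continuous_on A u" "\<And>x. x \<in> A \<Longrightarrow> u x \<notin> \<real>\<^sub>\<le>\<^sub>0"
  shows "continuous_on A (\<lambda>x. u x powr (1 / of_nat n :: complex))"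
proof (rule continuous_on_eq)
  show "continuous_on A (\<lambda>x. exp (1 / of_nat n * Ln (u x)))"
    by (rule continuous_on_exp, rule continuous_on_mult, rule continuous_on_const, rule continuous_on_Ln')
      (use assms in auto)
  show "exp (1 / of_nat n * Ln (u x)) = u x powr (1 / of_nat n)" if "x \<in> A" for x
    using assms(2)[OF that] by (auto simp: powr_def)
qed

lemma continuous_on_Phi:
  assumes "continuous_on A w" "continuous_on A f" "\<And>x. x \<in> A \<Longrightarrow> f x \<in> Phi_domain n (w x)"
  shows "continuous_on A (\<lambda>x. Phi n (w x) (f x))"
  unfolding Phi_def
proof (rule continuous_on_divide)
  note D = Phi_domainD[OF assms(3)]
  have "continuous_on A (\<lambda>x. 1 + cnj (w x) * inverse (f x ^ n))"
    using D(1) by (intro continuous_intros assms) auto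
  then show "continuous_on A (\<lambda>x. f x * (1 + cnj (w x) * inverse (f x ^ n)) powr (1 / of_nat n))"
    using D(2) by (intro continuous_on_mult assms continuous_on_root)
  have "continuous_on A (\<lambda>x. 1 + w x * f x ^ n)" by (intro continuous_intros assms)
  then show "continuous_on A (\<lambda>x. (1 + w x * f x ^ n) powr (1 / of_nat n))"
    using D(3) by (intro continuous_on_root)
qed (simp add: Phi_domainD(5)[OF assms(3)])

lemma phi_in_unit_circle:
  assumes "0 < n" "norm w < 1" "z \<in> unit_circle" shows "phi n w z \<in> unit_circle"
proof -
  obtain t where "z = cis t" using unit_circle_cis[OF assms(3)] by blast
  then show ?thesis using twist_cis by (simp add: phi_is_twist[OF assms(1,2)])
qed

text \<open>
  Taking \<open>n\<close>-th powers turns \<open>\<phi>\<^sub>n(w)\<close> into a Moebius transformation of \<open>z\<^sup>n\<close>, whose inverse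
  belongs to \<open>- w\<close>. So the composition is \<open>z\<close> up to an \<open>n\<close>-th root of unity. Shrinking
  \<open>w\<close> to \<open>0\<close> along \<open>s w\<close> shows that this root of unity is \<open>1\<close>.
\<close>

lemma phi_inverse:
  assumes n: "0 < n" and w: "norm w < 1" and z: "z \<in> unit_circle"
  shows "phi n (- w) (phi n w z) = z"
proof -
  define c where "c s = Phi n (- (of_real s * w)) (Phi n (of_real s * w) z) / z" for s :: real
  have sw: "norm (of_real s * w) < 1" if "s \<in> {0..1}" for s
  proof -
    have "norm (of_real s * w) \<le> 1 * norm w" unfolding norm_mult using that by (intro mult_right_mono) auto
    then show ?thesis using w by simp
  qed
  have z0: "z \<noteq> 0" using z by auto
  define v where "v s = Phi n (of_real s * w) z" for s
  have v: "v s \<in> unit_circle" if "s \<in> {0..1}" for s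
    using phi_in_unit_circle[OF n sw[OF that] z] phi_eq_Phi[OF z] by (simp add: v_def)
  have dom: "z \<in> Phi_domain n (of_real s * w)" "v s \<in> Phi_domain n (- (of_real s * w))" if "s \<in> {0..1}" for s
    using unit_circle_Phi_domain[OF sw[OF that] z] unit_circle_Phi_domain[OF _ v[OF that]] sw[OF that] by auto
  have cn: "c s ^ n = 1" if s: "s \<in> {0..1}" for s
  proof -
    let ?w = "of_real s * w"
    have d: "1 + ?w * z ^ n \<noteq> 0" "1 - ?w * v s ^ n \<noteq> 0"
      using Phi_domainD(5)[OF dom(1)[OF s]] Phi_domainD(5)[OF dom(2)[OF s]] by simp_all
    have 1: "v s ^ n = (z ^ n + cnj ?w) / (1 + ?w * z ^ n)"
      unfolding v_def by (rule Phi_power[OF n dom(1)[OF s]])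
    have "Phi n (- ?w) (v s) ^ n = (v s ^ n - cnj ?w) / (1 - ?w * v s ^ n)"
      using Phi_power[OF n dom(2)[OF s]] by simp
    also have "\<dots> = z ^ n"
    proof -
      have "v s ^ n * (1 + ?w * z ^ n) = z ^ n + cnj ?w" using 1 d(1) by simp
      then have "v s ^ n - cnj ?w = z ^ n * (1 - ?w * v s ^ n)" by (simp add: algebra_simps)
      then show ?thesis using d(2) by simp
    qed
    finally show ?thesis using z0 unfolding c_def v_def by (simp add: power_divide)
  qed
  have contv: "continuous_on {0..1} v"
    unfolding v_def by (rule continuous_on_Phi) (use dom(1) in \<open>auto intro!: continuous_intros\<close>)
  \<comment> \<open>A continuous function with finitely many values on an interval is constant.\<close>
  have "continuous_on {0..1} c"
    unfolding c_def v_def[symmetric]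
  proof (rule continuous_on_divide)
    show "continuous_on {0..1} (\<lambda>s. Phi n (- (of_real s * w)) (v s))"
      by (rule continuous_on_Phi) (use dom(2) in \<open>auto intro!: continuous_intros contv\<close>)
  qed (use z0 in auto)
  moreover have "finite (c ` {0..1})"
    by (rule finite_subset[OF _ finite_roots_unity[of n]]) (use n cn in auto)
  ultimately have "c constant_on {0..1}"
    using continuous_finite_range_constant[of "{0..1::real}" c] by simp
  then have "c 1 = c 0" by (auto simp: constant_on_def)
  also have "\<dots> = 1" using z0 by (simp add: c_def Phi_def)
  finally have "Phi n (- w) (Phi n w z) = z" using z0 by (simp add: c_def)
  then show ?thesis using phi_in_unit_circle[OF n w z] phi_eq_Phi z by simp
qed

lemma phi_Bij:
  assumes n: "0 < n" and w: "norm w < 1"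
  shows "phi n w \<in> Bij unit_circle" "z \<in> unit_circle \<Longrightarrow> inv_into unit_circle (phi n w) z = phi n (- w) z"
proof -
  have w': "norm (- w) < 1" using w by simp
  have bij: "bij_betw (phi n w) unit_circle unit_circle"
    by (rule bij_betw_byWitness[where f' = "phi n (- w)"])
      (use phi_inverse[OF n w] phi_inverse[OF n w'] phi_in_unit_circle[OF n w] phi_in_unit_circle[OF n w'] in auto)
  then show "phi n w \<in> Bij unit_circle" by (simp add: Bij_def phi_def)
  show "inv_into unit_circle (phi n w) z = phi n (- w) z" if "z \<in> unit_circle"
    using bij phi_inverse[OF n w' that] phi_in_unit_circle[OF n w' that]
    by (intro inv_into_f_eq) (auto simp: bij_betw_def)
qed

text \<open>
  The lift is injective because \<open>\<phi>\<^sub>n(w)\<close> is, hence monotone; it is increasing because it commutes with the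
  translation by \<open>2\<pi>\<close>.
\<close>

lemma phi_homeo:
  assumes n: "0 < n" and w: "norm w < 1"
  shows "phi n w \<in> circle_homeos"
proof -
  define h where "h z = - Im ((1 + w * z ^ n) powr (1 / of_nat n)) / Re ((1 + w * z ^ n) powr (1 / of_nat n))" for z
  have tw: "phi n w = twist h" unfolding h_def by (rule phi_is_twist[OF n w])
  have Re: "0 < Re (1 + w * z ^ n)" if "z \<in> unit_circle" for z
    using unit_circle_Phi_domain[OF w that, of n] by (simp add: Phi_domain_def)
  have Re2: "0 < Re ((1 + w * z ^ n) powr (1 / of_nat n))" if "z \<in> unit_circle" for z
    by (rule powr_root_Re_pos[OF n Re[OF that]])
  have cont_q: "continuous_on unit_circle (\<lambda>z. (1 + w * z ^ n) powr (1 / of_nat n))"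
    by (rule continuous_on_root) (use Phi_domainD(3)[OF unit_circle_Phi_domain[OF w]] in \<open>auto intro!: continuous_intros\<close>)
  have h: "continuous_on unit_circle h"
    unfolding h_def
    by (intro continuous_on_divide continuous_on_minus continuous_on_Im continuous_on_Re cont_q)
      (use Re2 in fastforce)
  define F where "F t = t + 2 * arctan (h (cis t))" for t
  have F: "phi n w (cis t) = cis (F t)" for t unfolding tw F_def by (rule twist_cis)
  have per: "F (t + 2 * pi * real k) = F t + 2 * pi * real k" for t k
    unfolding F_def by (simp add: cis_mult[symmetric] cis_multiple_2pi)
  have contF: "continuous_on A F" for A
    unfolding F_def by (intro continuous_intros continuous_on_subset[OF circle_curve_continuous[OF h]]) auto
  have inj: "inj F"
  proof (rule injI)
    fix s t assume eq: "F s = F t"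
    then have "phi n w (cis s) = phi n w (cis t)" using F by simp
    then have "cis s = cis t" using phi_Bij(1)[OF n w] by (auto simp: Bij_def bij_betw_def inj_on_def)
    then obtain m :: int where m: "s = t + 2 * pi * of_int m" using cis_eq_iff_lift by blast
    have "cis s = cis t" by fact
    then have "F s - s = F t - t" by (simp add: F_def)
    then show "s = t" using eq by simp
  qed
  have mono: "strict_mono F"
  proof (rule strict_monoI)
    fix a b :: real assume "a < b"
    \<comment> \<open>Compare \<open>F b\<close> with the values at \<open>a\<close> and at a translate of \<open>a\<close> beyond \<open>b\<close>.\<close>
    obtain k :: nat where k: "b - a < real k" using reals_Archimedean2 by blast
    have "real k \<le> 2 * pi * real k" using mult_right_mono[of 1 "2 * pi" "real k"] pi_gt3 by simp
    then have b: "b < a + 2 * pi * real k" using k by simp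
    have "F a < F b \<and> F b < F (a + 2 * pi * real k) \<or> F (a + 2 * pi * real k) < F b \<and> F b < F a"
      using continuous_inj_imp_mono[OF \<open>a < b\<close> b contF inj_on_subset[OF inj]] by auto
    then show "F a < F b" using per[of a k] \<open>a < b\<close> b by auto
  qed
  show ?thesis unfolding tw by (rule twist_homeo[OF h]) (use mono in \<open>simp add: F_def[abs_def]\<close>)
qed

lemma phi_smooth:
  assumes n: "0 < n" and w: "norm w < 1"
  shows "circle_smooth (phi n w)"
proof -
  have "smooth (\<lambda>t. Phi n w (cis t))"
    by (rule smooth_holomorphic[OF open_Phi_domain _ Phi_holomorphic[OF n] smooth_cis])
      (rule unit_circle_Phi_domain[OF w cis_in_unit_circle])
  then show ?thesis unfolding circle_smooth_iff by (simp add: phi_eq_Phi)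
qed

lemma phi_diffeo:
  assumes "0 < n" "norm w < 1" shows "phi n w \<in> circle_diffeos"
proof -
  have "circle_smooth (inv_into unit_circle (phi n w))"
    using circle_smooth_cong[of "inv_into unit_circle (phi n w)" "phi n (- w)"]
      phi_Bij(2)[OF assms] phi_smooth[OF assms(1), of "- w"] assms(2) by simp
  then show ?thesis using phi_homeo[OF assms] phi_smooth[OF assms] by (simp add: circle_diffeos_def)
qed

theorem subgroup_finite_type: "subgroup finite_type_diffeos (BijGroup unit_circle)"
  unfolding finite_type_diffeos_def
  by (rule group.generate_is_subgroup[OF group_BijGroup]) (auto simp: BijGroup_def phi_Bij(1))

section \<open>Algebraic maps\<close>

definition ev2 :: "complex poly poly \<Rightarrow> complex \<Rightarrow> complex \<Rightarrow> complex" where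
  "ev2 p z w = poly (poly p [:w:]) z"

lemma ev2_simps [simp]:
  "ev2 0 z w = 0" "ev2 (pCons a p) z w = poly a z + w * ev2 p z w" "ev2 (p + q) z w = ev2 p z w + ev2 q z w"
  "ev2 (p * q) z w = ev2 p z w * ev2 q z w" "ev2 (smult m p) z w = poly m z * ev2 p z w"
  by (simp_all add: ev2_def)

lemma ev2_slice: "ev2 p z w = poly (map_poly (\<lambda>a. poly a z) p) w"
  by (induction p) (auto simp: map_poly_pCons)

text \<open>
  Polynomial functions of two variables. Closure properties of the functions are convenient where
  explicit coefficients would be unreadable.
\<close>

definition bipoly :: "(complex \<Rightarrow> complex \<Rightarrow> complex) \<Rightarrow> bool" where
  "bipoly f \<longleftrightarrow> (\<exists>p. \<forall>z w. f z w = ev2 p z w)"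

lemma bipoly_const: "bipoly (\<lambda>z w. c)"
  unfolding bipoly_def by (intro exI[of _ "[:[:c:]:]"]) simp

lemma bipoly_fst: "bipoly (\<lambda>z w. z)"
  unfolding bipoly_def by (intro exI[of _ "[:[:0, 1:]:]"]) simp

lemma bipoly_snd: "bipoly (\<lambda>z w. w)"
  unfolding bipoly_def by (intro exI[of _ "[:0, 1:]"]) (simp add: one_pCons)

lemma bipoly_add: "bipoly f \<Longrightarrow> bipoly g \<Longrightarrow> bipoly (\<lambda>z w. f z w + g z w)"
  unfolding bipoly_def by (metis ev2_simps(3))

lemma bipoly_mult: "bipoly f \<Longrightarrow> bipoly g \<Longrightarrow> bipoly (\<lambda>z w. f z w * g z w)"
  unfolding bipoly_def by (metis ev2_simps(4))

lemma bipoly_diff: "bipoly f \<Longrightarrow> bipoly g \<Longrightarrow> bipoly (\<lambda>z w. f z w - g z w)"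
  using bipoly_add[of f "\<lambda>z w. - 1 * g z w"] bipoly_mult[OF bipoly_const[of "- 1"], of g] by simp

lemma bipoly_power: "bipoly f \<Longrightarrow> bipoly (\<lambda>z w. f z w ^ n)"
  by (induction n) (auto intro: bipoly_const bipoly_mult)

lemma bipoly_prod: "(\<And>i. i \<in> A \<Longrightarrow> bipoly (f i)) \<Longrightarrow> bipoly (\<lambda>z w. \<Prod>i\<in>A. f i z w)"
  by (induction A rule: infinite_finite_induct) (auto intro: bipoly_const bipoly_mult)

lemmas bipoly_intros = bipoly_const bipoly_fst bipoly_snd bipoly_add bipoly_mult bipoly_diff bipoly_power

lemma bipoly_poly: "bipoly f \<Longrightarrow> bipoly (\<lambda>z w. poly p (f z w))"
  by (induction p) (auto intro: bipoly_intros)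

lemma bipoly_swap: assumes "bipoly f" shows "bipoly (\<lambda>z w. f w z)"
proof -
  obtain p where p: "\<And>z w. f z w = ev2 p z w" using assms by (auto simp: bipoly_def)
  have "bipoly (\<lambda>z w. ev2 p w z)"
  proof (induction p)
    case (pCons a p)
    show ?case
      using bipoly_add[OF bipoly_poly[OF bipoly_snd, of a] bipoly_mult[OF bipoly_fst pCons.IH]] by simp
  qed (simp add: bipoly_const)
  then show ?thesis by (simp add: p)
qed

lemma ev2_nonzero: assumes "p \<noteq> 0" obtains z w where "ev2 p z w \<noteq> 0"
proof -
  have inj: "inj (\<lambda>w :: complex. [:w:])" by (auto simp: inj_def)
  have "infinite (range (\<lambda>w :: complex. [:w:]))"
    using finite_imageD[OF _ inj] infinite_UNIV_char_0 by blast
  then have "\<not> range (\<lambda>w. [:w:]) \<subseteq> {x. poly p x = 0}"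
    using poly_roots_finite[OF assms] finite_subset by blast
  then obtain w where "poly p [:w:] \<noteq> 0" by auto
  then obtain z where "poly (poly p [:w:]) z \<noteq> 0" using poly_all_0_iff_0 by blast
  then show ?thesis using that by (simp add: ev2_def)
qed

lemma algebraic_map_iff:
  "algebraic_map \<sigma> \<longleftrightarrow> (\<exists>f. bipoly f \<and> (\<exists>z w. f z w \<noteq> 0) \<and> (\<forall>z\<in>unit_circle. f z (\<sigma> z) = 0))"
proof
  assume "algebraic_map \<sigma>"
  then obtain p where p: "p \<noteq> 0" "\<forall>z\<in>unit_circle. ev2 p z (\<sigma> z) = 0"
    by (auto simp: algebraic_map_def ev2_def)
  then show "\<exists>f. bipoly f \<and> (\<exists>z w. f z w \<noteq> 0) \<and> (\<forall>z\<in>unit_circle. f z (\<sigma> z) = 0)"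
  proof -
    obtain z w where "ev2 p z w \<noteq> 0" by (rule ev2_nonzero[OF p(1)]) (rule that)
    then show ?thesis using p(2) by (intro exI[of _ "ev2 p"]) (auto simp: bipoly_def)
  qed
next
  assume "\<exists>f. bipoly f \<and> (\<exists>z w. f z w \<noteq> 0) \<and> (\<forall>z\<in>unit_circle. f z (\<sigma> z) = 0)"
  then obtain f p z w where f: "\<And>z w. f z w = ev2 p z w" "f z w \<noteq> 0" "\<forall>z\<in>unit_circle. f z (\<sigma> z) = 0"
    unfolding bipoly_def by metis
  then have "p \<noteq> 0" by auto
  then show "algebraic_map \<sigma>" unfolding algebraic_map_def using f by (auto simp: ev2_def)
qed

lemma algebraic_mapI:
  "bipoly f \<Longrightarrow> f z w \<noteq> 0 \<Longrightarrow> (\<And>z. z \<in> unit_circle \<Longrightarrow> f z (\<sigma> z) = 0) \<Longrightarrow> algebraic_map \<sigma>"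
  unfolding algebraic_map_iff by blast

subsection \<open>Elimination\<close>

text \<open>
  The Euclidean algorithm by pseudo-division, which stays inside the polynomials over a domain: it
  ends either with a nonzero constant in the ideal of \<open>P\<close> and \<open>Q\<close>, or with a common factor.
\<close>

lemma elimination_or_common_factor:
  fixes P Q :: "'a::idom poly"
  shows "Q \<noteq> 0 \<Longrightarrow>
    (\<exists>A B c. c \<noteq> 0 \<and> A * P + B * Q = [:c:]) \<or>
    (\<exists>G P' Q' c. c \<noteq> 0 \<and> 0 < Polynomial.degree G \<and> smult c P = G * P' \<and> smult c Q = G * Q')"
proof (induction "Polynomial.degree Q" arbitrary: P Q rule: less_induct)
  case less
  show ?case
  proof (cases "Polynomial.degree Q = 0")
    case True
    then obtain c where "Q = [:c:]" by (metis degree_eq_zeroE)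
    then have "c \<noteq> 0 \<and> 0 * P + 1 * Q = [:c:]" using less.prems by auto
    then show ?thesis by blast
  next
    case False
    define r where "r = pseudo_mod P Q"
    obtain a q where a: "a \<noteq> 0" "smult a P = Q * q + r"
      using pseudo_mod(1)[OF less.prems, of P] r_def by blast
    have r: "r = 0 \<or> Polynomial.degree r < Polynomial.degree Q"
      unfolding r_def by (rule pseudo_mod(2)[OF less.prems])
    show ?thesis
    proof (cases "r = 0")
      case True
      have "smult a Q = Q * [:a:]" by simp
      then show ?thesis using a True False by (metis add.right_neutral gr0I)
    next
      case r0: False
      then have "Polynomial.degree r < Polynomial.degree Q" using r by simp
      from less.hyps[OF this r0, of Q] show ?thesis
      proof (elim disjE exE conjE)
        fix A B c assume c: "c \<noteq> 0" "A * Q + B * r = [:c:]"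
        have "smult a B * P + (A - B * q) * Q = A * Q + B * (smult a P - Q * q)" by (simp add: algebra_simps)
        also have "\<dots> = [:c:]" using a(2) c(2) by simp
        finally show ?thesis using c(1) by blast
      next
        fix G Q1 r1 c assume c: "c \<noteq> 0" "0 < Polynomial.degree G" "smult c Q = G * Q1" "smult c r = G * r1"
        have "smult (c * a) P = smult c (Q * q + r)" using a(2) by (metis smult_smult)
        also have "\<dots> = smult c Q * q + smult c r" by (simp add: smult_add_right)
        also have "\<dots> = G * (Q1 * q + r1)" unfolding c(3,4) by (simp add: algebra_simps)
        finally have "smult (c * a) P = G * (Q1 * q + r1)" .
        moreover have "smult (c * a) Q = G * (smult a Q1)" using c(3) by (metis mult.commute mult_smult_right smult_smult)
        ultimately show ?thesis using c(1,2) a(1) by (metis mult_eq_0_iff)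
      qed
    qed
  qed
qed

text \<open>
  Polynomials in \<open>v\<close> whose coefficients are polynomials in \<open>z\<close> and \<open>w\<close>.
\<close>

definition ev3 :: "complex poly poly poly \<Rightarrow> complex \<Rightarrow> complex \<Rightarrow> complex \<Rightarrow> complex" where
  "ev3 P z w v = ev2 (poly P [:[:v:]:]) z w"

lemma ev3_simps [simp]:
  "ev3 0 z w v = 0" "ev3 (pCons a P) z w v = ev2 a z w + v * ev3 P z w v"
  "ev3 (P + Q) z w v = ev3 P z w v + ev3 Q z w v" "ev3 (P * Q) z w v = ev3 P z w v * ev3 Q z w v"
  "ev3 (smult c P) z w v = ev2 c z w * ev3 P z w v"
  by (simp_all add: ev3_def)

lemma ev3_slice: "ev3 P z w v = poly (map_poly (\<lambda>r. ev2 r z w) P) v"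
  by (induction P) (auto simp: map_poly_pCons)

lemma ev2_zeros_fst_finite:
  assumes "ev2 p z0 w \<noteq> 0" shows "finite {z. ev2 p z w = 0}"
proof -
  have "poly p [:w:] \<noteq> 0" using assms by (auto simp: ev2_def)
  then show ?thesis unfolding ev2_def by (rule poly_roots_finite)
qed

lemma ev2_zeros_snd_finite:
  assumes "ev2 p z w0 \<noteq> 0" shows "finite {w. ev2 p z w = 0}"
proof -
  have "map_poly (\<lambda>a. poly a z) p \<noteq> 0" using assms by (auto simp: ev2_slice)
  then show ?thesis unfolding ev2_slice by (rule poly_roots_finite)
qed

text \<open>
  If the Euclidean algorithm in \<open>v\<close> over the polynomials in \<open>z\<close>, \<open>w\<close> ends in a constant, then this constant
  is the relation. A common factor cannot occur: at a generic point \<open>(z\<^sub>0, w\<^sub>0)\<close> it would have a root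
  \<open>v\<^sub>0\<close>, and then \<open>v\<^sub>0\<close> would be one of the finitely many zeros of \<open>f(z\<^sub>0, \<cdot>)\<close> while
  \<open>w\<^sub>0\<close> is chosen outside the finitely many zeros of \<open>g(v\<^sub>0, \<cdot>)\<close>. The hypothesis on
  \<open>g\<close> says that no line \<open>v = const\<close> lies in its zero set.
\<close>

lemma elimination:
  assumes f: "bipoly f" "f z1 v1 \<noteq> 0" and g: "bipoly g" "\<And>v. \<exists>w. g v w \<noteq> 0"
  shows "\<exists>r. bipoly r \<and> (\<exists>z w. r z w \<noteq> 0) \<and> (\<forall>z v w. f z v = 0 \<longrightarrow> g v w = 0 \<longrightarrow> r z w = 0)"
proof -
  obtain F where F: "\<And>z v. f z v = ev2 F z v" using f by (auto simp: bipoly_def)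
  obtain G where G: "\<And>v w. g v w = ev2 G w v" using bipoly_swap[OF g(1)] unfolding bipoly_def by blast
  obtain G2 where G2: "\<And>v w. g v w = ev2 G2 v w" using g by (auto simp: bipoly_def)
  define P where "P = map_poly (\<lambda>a. [:a:]) F"
  define Q where "Q = map_poly (\<lambda>b. map_poly (\<lambda>c. [:c:]) b) G"
  have P: "ev3 P z w v = f z v" for z w v
    unfolding P_def F by (induction F) (auto simp: map_poly_pCons)
  have "ev2 (map_poly (\<lambda>c. [:c:]) b) z w = poly b w" for b z w
    by (induction b) (auto simp: map_poly_pCons)
  then have Q: "ev3 Q z w v = g v w" for z w v
    unfolding Q_def G by (induction G) (auto simp: map_poly_pCons)
  have "Q \<noteq> 0" using Q g(2) by (metis ev3_simps(1))
  from elimination_or_common_factor[OF this, of P] show ?thesis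
  proof (elim disjE exE conjE)
    fix A B c assume c: "c \<noteq> 0" "A * P + B * Q = [:c:]"
    have "ev2 c z w = 0" if "f z v = 0" "g v w = 0" for z v w
    proof -
      have "ev3 (A * P + B * Q) z w v = 0" using that by (simp add: P Q)
      then show ?thesis unfolding c(2) by simp
    qed
    moreover obtain z w where "ev2 c z w \<noteq> 0" using ev2_nonzero[OF c(1)] .
    ultimately show ?thesis by (intro exI[of _ "ev2 c"]) (auto simp: bipoly_def)
  next
    fix D P' Q' c assume D: "c \<noteq> 0" "0 < Polynomial.degree D" "smult c P = D * P'" "smult c Q = D * Q'"
    define l where "l = c * Polynomial.lead_coeff D"
    have "l \<noteq> 0" using D(1,2) by (auto simp: l_def)
    then obtain za wa where l: "ev2 l za wa \<noteq> 0" using ev2_nonzero by blast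
    have "finite ({z. ev2 l z wa = 0} \<union> {z. ev2 F z v1 = 0})"
      using ev2_zeros_fst_finite[OF l] ev2_zeros_fst_finite[of F z1 v1] f(2) F by simp
    then obtain z0 where z0: "ev2 l z0 wa \<noteq> 0" "ev2 F z0 v1 \<noteq> 0"
    proof -
      assume fn: "finite ({z. ev2 l z wa = 0} \<union> {z. ev2 F z v1 = 0})"
      obtain z0 where "z0 \<notin> {z. ev2 l z wa = 0} \<union> {z. ev2 F z v1 = 0}"
        using ex_new_if_finite[OF infinite_UNIV_char_0[where 'a = complex] fn] by (elim exE) (rule that)
      then show ?thesis by (intro that[of z0]) simp_all
    qed
    have fin: "finite {w. ev2 G2 v w = 0}" for v
      using g(2)[of v] ev2_zeros_snd_finite[of G2 v] G2 by auto
    have "finite ({w. ev2 l z0 w = 0} \<union> (\<Union>v\<in>{v. ev2 F z0 v = 0}. {w. ev2 G2 v w = 0}))"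
      using ev2_zeros_snd_finite[OF z0(1)] ev2_zeros_snd_finite[OF z0(2)] fin by simp
    then obtain w0 where w0: "ev2 l z0 w0 \<noteq> 0" "\<And>v. f z0 v = 0 \<Longrightarrow> g v w0 \<noteq> 0"
    proof -
      assume fn: "finite ({w. ev2 l z0 w = 0} \<union> (\<Union>v\<in>{v. ev2 F z0 v = 0}. {w. ev2 G2 v w = 0}))"
      obtain w0 where "w0 \<notin> {w. ev2 l z0 w = 0} \<union> (\<Union>v\<in>{v. ev2 F z0 v = 0}. {w. ev2 G2 v w = 0})"
        using ex_new_if_finite[OF infinite_UNIV_char_0[where 'a = complex] fn] by (elim exE) (rule that)
      then show ?thesis by (intro that[of w0]) (simp_all add: F G2)
    qed
    define d where "d = map_poly (\<lambda>r. ev2 r z0 w0) D"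
    have cl: "ev2 c z0 w0 \<noteq> 0" "ev2 (Polynomial.lead_coeff D) z0 w0 \<noteq> 0" using w0(1) by (auto simp: l_def)
    then have "Polynomial.coeff d (Polynomial.degree D) \<noteq> 0" by (simp add: d_def coeff_map_poly)
    then have "0 < Polynomial.degree d" using D(2) le_degree by fastforce
    then have "\<not> constant (poly d)" by (simp add: constant_degree)
    then obtain v0 where "poly d v0 = 0" using fundamental_theorem_of_algebra by blast
    then have Dv: "ev3 D z0 w0 v0 = 0" by (simp add: ev3_slice d_def)
    have "ev3 (smult c P) z0 w0 v0 = 0" "ev3 (smult c Q) z0 w0 v0 = 0" unfolding D(3,4) using Dv by simp_all
    then have "f z0 v0 = 0" "g v0 w0 = 0" using cl by (simp_all add: P Q)
    then show ?thesis using w0(2) by blast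
  qed
qed

text \<open>
  Dividing out the linear factors common to all coefficients removes the lines \<open>v = const\<close> from the
  zero set.
\<close>

lemma ev2_primitive_part:
  "p \<noteq> 0 \<Longrightarrow> \<exists>m q. m \<noteq> 0 \<and> p = smult m q \<and> (\<forall>v. \<exists>w. ev2 q v w \<noteq> 0)"
proof (induction "Polynomial.degree (Polynomial.lead_coeff p)" arbitrary: p rule: less_induct)
  case less
  show ?case
  proof (cases "\<forall>v. \<exists>w. ev2 p v w \<noteq> 0")
    case True
    then show ?thesis by (intro exI[of _ 1] exI[of _ p]) simp
  next
    case False
    then obtain v where "\<forall>w. ev2 p v w = 0" by blast
    then have "map_poly (\<lambda>a. poly a v) p = 0" unfolding ev2_slice by (simp add: poly_all_0_iff_0)
    then have "poly (Polynomial.coeff p i) v = 0" for i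
      by (metis coeff_0 coeff_map_poly poly_0)
    then have dv: "[:- v, 1:] dvd Polynomial.coeff p i" for i by (simp add: poly_eq_0_iff_dvd)
    define q where "q = map_poly (\<lambda>a. a div [:- v, 1:]) p"
    have coeff: "Polynomial.coeff p i = [:- v, 1:] * Polynomial.coeff q i" for i
      unfolding q_def using dv[of i] by (subst coeff_map_poly) (auto simp only: div_0 dvd_mult_div_cancel)
    then have pq: "p = smult [:- v, 1:] q" by (intro poly_eqI) simp
    then have q0: "q \<noteq> 0" using less.prems by auto
    have "Polynomial.lead_coeff p = [:- v, 1:] * Polynomial.lead_coeff q" unfolding pq by (rule lead_coeff_smult)
    then have "Polynomial.degree (Polynomial.lead_coeff p) = 1 + Polynomial.degree (Polynomial.lead_coeff q)"
      using q0 by (simp only:) (subst degree_mult_eq, auto)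
    then have "Polynomial.degree (Polynomial.lead_coeff q) < Polynomial.degree (Polynomial.lead_coeff p)" by simp
    from less.hyps[OF this q0] obtain m r where "m \<noteq> 0" "q = smult m r" "\<forall>v. \<exists>w. ev2 r v w \<noteq> 0" by blast
    moreover from this have "[:- v, 1:] * m \<noteq> 0" by (simp only: mult_eq_0_iff) simp
    ultimately show ?thesis unfolding pq by (intro exI[of _ "[:- v, 1:] * m"] exI[of _ r]) (simp del: mult_pCons_left)
  qed
qed

text \<open>
  Elimination needs a relation for \<open>\<sigma>\<close> without lines \<open>v = const\<close>, so the relation is replaced by its
  primitive part. This loses finitely many points of the circle, which the factor
  \<open>\<Prod>b\<in>B. z - b\<close> brings back.
\<close>

theorem algebraic_map_compose:
  assumes \<tau>: "\<tau> \<in> Bij unit_circle" and alg: "algebraic_map \<sigma>" "algebraic_map \<tau>"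
  shows "algebraic_map (\<lambda>z. \<sigma> (\<tau> z))"
proof -
  obtain f z1 v1 where f: "bipoly f" "f z1 v1 \<noteq> 0" "\<forall>z\<in>unit_circle. f z (\<tau> z) = 0"
    using alg(2) by (auto simp: algebraic_map_iff)
  obtain p where p: "p \<noteq> 0" "\<forall>v\<in>unit_circle. ev2 p v (\<sigma> v) = 0"
    using alg(1) by (auto simp: algebraic_map_def ev2_def)
  obtain m q where m: "m \<noteq> 0" "p = smult m q" "\<And>v. \<exists>w. ev2 q v w \<noteq> 0"
    using ev2_primitive_part[OF p(1)] by blast
  have bq: "bipoly (ev2 q)" by (auto simp: bipoly_def)
  obtain r zr wr where r: "bipoly r" "r zr wr \<noteq> 0" "\<And>z v w. f z v = 0 \<Longrightarrow> ev2 q v w = 0 \<Longrightarrow> r z w = 0"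
    using elimination[OF f(1,2) bq m(3)] by blast
  define B where "B = {z\<in>unit_circle. poly m (\<tau> z) = 0}"
  have "inj_on \<tau> B" using \<tau> by (auto simp: Bij_def bij_betw_def B_def intro: inj_on_subset)
  moreover have "finite (\<tau> ` B)" by (rule finite_subset[OF _ poly_roots_finite[OF m(1)]]) (auto simp: B_def)
  ultimately have B: "finite B" by (rule finite_imageD[rotated])
  have bip: "bipoly (\<lambda>z w. r z w * (\<Prod>b\<in>B. z - b))"
    by (intro bipoly_mult r(1) bipoly_prod bipoly_diff bipoly_fst bipoly_const)
  have "finite {z. r z wr = 0}"
  proof -
    obtain pr where "\<And>z w. r z w = ev2 pr z w" using r(1) by (auto simp: bipoly_def)
    then show ?thesis using ev2_zeros_fst_finite[of pr zr wr] r(2) by simp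
  qed
  then obtain z2 where "r z2 wr \<noteq> 0" "z2 \<notin> B"
    using ex_new_if_finite[OF infinite_UNIV_char_0[where 'a = complex], of "{z. r z wr = 0} \<union> B"] B by auto
  then have "r z2 wr * (\<Prod>b\<in>B. z2 - b) \<noteq> 0" using B by auto
  then show ?thesis
  proof (rule algebraic_mapI[OF bip])
    fix z assume z: "z \<in> unit_circle"
    show "r z (\<sigma> (\<tau> z)) * (\<Prod>b\<in>B. z - b) = 0"
    proof (cases "z \<in> B")
      case False
      then have "poly m (\<tau> z) \<noteq> 0" using z by (simp add: B_def)
      moreover have "poly m (\<tau> z) * ev2 q (\<tau> z) (\<sigma> (\<tau> z)) = 0"
        using p(2) Bij_unit_circle(1)[OF \<tau> z] unfolding m(2) by simp
      ultimately have "ev2 q (\<tau> z) (\<sigma> (\<tau> z)) = 0" by simp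
      then have "r z (\<sigma> (\<tau> z)) = 0" using r(3) f(3) z by blast
      then show ?thesis by simp
    qed (use B in auto)
  qed
qed

lemma algebraic_map_inverse:
  assumes "\<sigma> \<in> Bij unit_circle" "algebraic_map \<sigma>"
  shows "algebraic_map (inv_into unit_circle \<sigma>)"
proof -
  obtain f z w where f: "bipoly f" "f z w \<noteq> 0" "\<forall>z\<in>unit_circle. f z (\<sigma> z) = 0"
    using assms(2) by (auto simp: algebraic_map_iff)
  show ?thesis
  proof (rule algebraic_mapI[OF bipoly_swap[OF f(1)] f(2)])
    fix z assume "z \<in> unit_circle"
    then show "f (inv_into unit_circle \<sigma> z) z = 0"
      using f(3) Bij_unit_circle(2,4)[OF assms(1)] by metis
  qed
qed

lemma algebraic_map_cong: "(\<And>z. z \<in> unit_circle \<Longrightarrow> \<sigma> z = \<tau> z) \<Longrightarrow> algebraic_map \<sigma> \<Longrightarrow> algebraic_map \<tau>"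
  by (simp add: algebraic_map_def)

lemma algebraic_map_id: "algebraic_map (\<lambda>z. z)"
  by (rule algebraic_mapI[of "\<lambda>z w. w - z" 0 1]) (auto intro: bipoly_intros)

lemma subgroup_algebraic:
  assumes H: "subgroup H (BijGroup unit_circle)"
  shows "subgroup {\<sigma> \<in> H. algebraic_map \<sigma>} (BijGroup unit_circle)"
proof -
  have HB: "\<sigma> \<in> Bij unit_circle" if "\<sigma> \<in> H" for \<sigma>
    using subgroup.subset[OF H] that by (auto simp: BijGroup_def)
  have "subgroup {\<sigma> \<in> H. algebraic_map \<sigma> \<and> algebraic_map (inv_into unit_circle \<sigma>)} (BijGroup unit_circle)"
    by (rule subgroup_two_sided[where P = algebraic_map, OF _ H algebraic_map_id])
      (use algebraic_map_cong algebraic_map_compose HB in blast)+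
  moreover have "{\<sigma> \<in> H. algebraic_map \<sigma> \<and> algebraic_map (inv_into unit_circle \<sigma>)} = {\<sigma> \<in> H. algebraic_map \<sigma>}"
    using algebraic_map_inverse HB by blast
  ultimately show ?thesis by simp
qed

theorem subgroup_AlgHomeo: "subgroup AlgHomeo (BijGroup unit_circle)"
  unfolding AlgHomeo_def by (rule subgroup_algebraic[OF subgroup_circle_homeos])

theorem subgroup_AlgDiff: "subgroup AlgDiff (BijGroup unit_circle)"
  unfolding AlgDiff_def by (rule subgroup_algebraic[OF subgroup_circle_diffeos])

section \<open>Subfields, simple extensions and their homomorphisms\<close>

text \<open>
  Subfields as subsets of a field given by its type. The tower of radical extensions is a chain of such subsets of
  one field of Laurent series, which avoids abstract constructions of extensions.
\<close>

definition subfld :: "'a::field set \<Rightarrow> bool" where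
  "subfld L \<longleftrightarrow> 0 \<in> L \<and> 1 \<in> L \<and> (\<forall>x\<in>L. \<forall>y\<in>L. x + y \<in> L \<and> x * y \<in> L) \<and>
     (\<forall>x\<in>L. - x \<in> L \<and> inverse x \<in> L)"

lemma subfld_0: "subfld L \<Longrightarrow> 0 \<in> L" and subfld_1: "subfld L \<Longrightarrow> 1 \<in> L"
  and subfld_add: "subfld L \<Longrightarrow> x \<in> L \<Longrightarrow> y \<in> L \<Longrightarrow> x + y \<in> L"
  and subfld_mult: "subfld L \<Longrightarrow> x \<in> L \<Longrightarrow> y \<in> L \<Longrightarrow> x * y \<in> L"
  and subfld_uminus: "subfld L \<Longrightarrow> x \<in> L \<Longrightarrow> - x \<in> L"
  and subfld_inverse: "subfld L \<Longrightarrow> x \<in> L \<Longrightarrow> inverse x \<in> L"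
  by (auto simp: subfld_def)

lemma subfld_diff: "subfld L \<Longrightarrow> x \<in> L \<Longrightarrow> y \<in> L \<Longrightarrow> x - y \<in> L"
  using subfld_add[of L x "- y"] subfld_uminus by auto

lemma subfld_divide: "subfld L \<Longrightarrow> x \<in> L \<Longrightarrow> y \<in> L \<Longrightarrow> x / y \<in> L"
  by (simp add: divide_inverse subfld_mult subfld_inverse)

lemma subfld_power: "subfld L \<Longrightarrow> x \<in> L \<Longrightarrow> x ^ n \<in> L"
  by (induction n) (auto simp: subfld_1 subfld_mult)

lemma subfld_sum: "subfld L \<Longrightarrow> (\<And>i. i \<in> A \<Longrightarrow> f i \<in> L) \<Longrightarrow> sum f A \<in> L"
  by (induction A rule: infinite_finite_induct) (auto simp: subfld_0 subfld_add)

lemma subfld_of_nat: "subfld L \<Longrightarrow> of_nat n \<in> L"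
  by (induction n) (auto simp: subfld_0 subfld_1 subfld_add)

lemma subfld_numeral: "subfld L \<Longrightarrow> numeral n \<in> L"
  by (metis of_nat_numeral subfld_of_nat)

lemmas subfld_intros = subfld_0 subfld_1 subfld_add subfld_mult subfld_uminus subfld_inverse
  subfld_diff subfld_divide subfld_power subfld_numeral

definition polys :: "'a::field set \<Rightarrow> 'a poly set" where
  "polys L = {p. \<forall>i. Polynomial.coeff p i \<in> L}"

lemma polys_coeff: "p \<in> polys L \<Longrightarrow> Polynomial.coeff p i \<in> L"
  by (simp add: polys_def)

lemma polys_0: "subfld L \<Longrightarrow> 0 \<in> polys L"
  by (simp add: polys_def subfld_0)

lemma polys_pCons: "a \<in> L \<Longrightarrow> p \<in> polys L \<Longrightarrow> pCons a p \<in> polys L"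
  by (auto simp: polys_def coeff_pCons split: nat.split)

lemma polys_add: "subfld L \<Longrightarrow> p \<in> polys L \<Longrightarrow> q \<in> polys L \<Longrightarrow> p + q \<in> polys L"
  by (simp add: polys_def subfld_add)

lemma polys_diff: "subfld L \<Longrightarrow> p \<in> polys L \<Longrightarrow> q \<in> polys L \<Longrightarrow> p - q \<in> polys L"
  by (simp add: polys_def subfld_diff)

lemma polys_mult: "subfld L \<Longrightarrow> p \<in> polys L \<Longrightarrow> q \<in> polys L \<Longrightarrow> p * q \<in> polys L"
  by (auto simp: polys_def coeff_mult intro!: subfld_sum subfld_mult)

lemma polys_1: "subfld L \<Longrightarrow> 1 \<in> polys L"
  by (auto simp: polys_def coeff_1 subfld_0 subfld_1)

lemma polys_monom: "subfld L \<Longrightarrow> a \<in> L \<Longrightarrow> Polynomial.monom a n \<in> polys L"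
  by (auto simp: polys_def coeff_monom subfld_0)

lemma poly_in_subfld: "subfld L \<Longrightarrow> p \<in> polys L \<Longrightarrow> x \<in> L \<Longrightarrow> poly p x \<in> L"
proof (induction p)
  case (pCons a p)
  have "a \<in> L" using polys_coeff[OF pCons.prems(2), of 0] by simp
  moreover have "p \<in> polys L"
    unfolding polys_def using polys_coeff[OF pCons.prems(2), of "Suc _"] by auto
  ultimately show ?case using pCons by (auto intro: subfld_add subfld_mult)
qed (simp add: subfld_0)

lemma polys_division:
  assumes L: "subfld L" and g: "g \<in> polys L" "g \<noteq> 0"
  shows "f \<in> polys L \<Longrightarrow>
    \<exists>q r. q \<in> polys L \<and> r \<in> polys L \<and> f = q * g + r \<and> (r = 0 \<or> Polynomial.degree r < Polynomial.degree g)"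
proof (induction "Polynomial.degree f" arbitrary: f rule: less_induct)
  case less
  show ?case
  proof (cases "f = 0 \<or> Polynomial.degree f < Polynomial.degree g")
    case True
    then have "f = 0 * g + f \<and> (f = 0 \<or> Polynomial.degree f < Polynomial.degree g)" by simp
    then show ?thesis using less.prems polys_0[OF L] by blast
  next
    case False
    then have f0: "f \<noteq> 0" and dge: "Polynomial.degree g \<le> Polynomial.degree f" by auto
    define c where "c = lead_coeff f / lead_coeff g"
    define m where "m = Polynomial.monom c (Polynomial.degree f - Polynomial.degree g)"
    have cL: "c \<in> L" unfolding c_def
      by (intro subfld_divide[OF L] polys_coeff less.prems g)
    have c0: "c \<noteq> 0" using f0 g by (simp add: c_def)
    have mL: "m \<in> polys L" unfolding m_def by (rule polys_monom[OF L cL])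
    have degmg: "Polynomial.degree (m * g) = Polynomial.degree f"
      using c0 g dge by (simp add: m_def degree_mult_eq Polynomial.degree_monom_eq)
    have lcmg: "lead_coeff (m * g) = lead_coeff f"
    proof -
      have "lead_coeff m = c" unfolding m_def by (rule lead_coeff_monom)
      then show ?thesis using g unfolding lead_coeff_mult by (simp add: c_def)
    qed
    have f'L: "f - m * g \<in> polys L" by (intro polys_diff polys_mult L less.prems mL g)
    show ?thesis
    proof (cases "Polynomial.degree f = 0")
      case True
      then have "f - m * g = 0"
      proof (intro poly_eqI)
        fix n
        show "Polynomial.coeff (f - m * g) n = Polynomial.coeff 0 n"
          using lcmg True by (cases n) (auto simp: degmg coeff_eq_0)
      qed
      then have "f = m * g + 0" by simp
      then show ?thesis using mL polys_0[OF L] by blast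
    next
      case False
      have "Polynomial.degree (f - m * g) < Polynomial.degree f"
      proof -
        have le: "Polynomial.degree (f - m * g) \<le> Polynomial.degree f"
          by (rule Polynomial.degree_diff_le) (simp_all add: degmg)
        have "Polynomial.coeff (f - m * g) (Polynomial.degree f) = 0"
          using lcmg unfolding degmg by simp
        then have "Polynomial.degree (f - m * g) = Polynomial.degree f \<Longrightarrow> f - m * g = 0"
          by (metis leading_coeff_0_iff)
        then show ?thesis using le False by fastforce
      qed
      from less.hyps[OF this f'L] obtain q r where
        qr: "q \<in> polys L" "r \<in> polys L" "f - m * g = q * g + r"
            "r = 0 \<or> Polynomial.degree r < Polynomial.degree g" by blast
      then have "f = (q + m) * g + r" by (simp add: algebra_simps)
      then show ?thesis using qr polys_add[OF L qr(1) mL] by blast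
    qed
  qed
qed

text \<open>
  The values off \<open>L\<close> are arbitrary; a homomorphism is extended by giving it new values there.
\<close>

definition hom_on :: "'a::field set \<Rightarrow> ('a \<Rightarrow> 'b::field) \<Rightarrow> bool" where
  "hom_on L h \<longleftrightarrow> (\<forall>x\<in>L. \<forall>y\<in>L. h (x + y) = h x + h y \<and> h (x * y) = h x * h y) \<and> h 1 = 1"

lemma hom_on_add: "hom_on L h \<Longrightarrow> x \<in> L \<Longrightarrow> y \<in> L \<Longrightarrow> h (x + y) = h x + h y"
  and hom_on_mult: "hom_on L h \<Longrightarrow> x \<in> L \<Longrightarrow> y \<in> L \<Longrightarrow> h (x * y) = h x * h y"
  and hom_on_1: "hom_on L h \<Longrightarrow> h 1 = 1"
  by (auto simp: hom_on_def)

lemma hom_on_0: "hom_on L h \<Longrightarrow> subfld L \<Longrightarrow> h 0 = 0"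
proof -
  assume "hom_on L h" "subfld L"
  then have "h (0 + 0) = h 0 + h 0" by (intro hom_on_add subfld_0)
  then have "h 0 + 0 = h 0 + h 0" by simp
  then show ?thesis by (metis add_left_imp_eq)
qed

lemma hom_on_uminus: "hom_on L h \<Longrightarrow> subfld L \<Longrightarrow> x \<in> L \<Longrightarrow> h (- x) = - h x"
  using hom_on_add[of L h x "- x"] hom_on_0[of L h] subfld_uminus[of L x]
  by (metis add.right_inverse add_eq_0_iff2)

lemma hom_on_diff: "hom_on L h \<Longrightarrow> subfld L \<Longrightarrow> x \<in> L \<Longrightarrow> y \<in> L \<Longrightarrow> h (x - y) = h x - h y"
  using hom_on_add[of L h x "- y"] hom_on_uminus[of L h y] subfld_uminus[of L y] by simp

lemma hom_on_inverse:
  assumes "hom_on L h" "subfld L" "x \<in> L" shows "h (inverse x) = inverse (h x)"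
proof (cases "x = 0")
  case False
  then have "h x * h (inverse x) = 1"
    using hom_on_mult[of L h x "inverse x"] assms subfld_inverse hom_on_1 by fastforce
  then show ?thesis by (metis inverse_unique)
qed (simp add: hom_on_0[OF assms(1,2)])

lemma hom_on_divide:
  assumes "hom_on L h" "subfld L" "x \<in> L" "y \<in> L" shows "h (x / y) = h x / h y"
  using assms by (simp add: divide_inverse hom_on_mult hom_on_inverse subfld_inverse)

lemma hom_on_power: "hom_on L h \<Longrightarrow> subfld L \<Longrightarrow> x \<in> L \<Longrightarrow> h (x ^ n) = h x ^ n"
  by (induction n) (auto simp: hom_on_1 hom_on_mult subfld_power)

lemma hom_on_sum:
  "hom_on L h \<Longrightarrow> subfld L \<Longrightarrow> (\<And>i. i \<in> A \<Longrightarrow> f i \<in> L) \<Longrightarrow> h (sum f A) = (\<Sum>i\<in>A. h (f i))"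
  by (induction A rule: infinite_finite_induct) (auto simp: hom_on_0 hom_on_add subfld_sum)

lemma hom_on_compose:
  assumes "hom_on L h" "hom_on L' h'" "h ` L \<subseteq> L'" shows "hom_on L (\<lambda>x. h' (h x))"
  using assms by (auto simp: hom_on_def image_subset_iff)

lemma coeff_map_poly_hom:
  "hom_on L h \<Longrightarrow> subfld L \<Longrightarrow> Polynomial.coeff (map_poly h p) i = h (Polynomial.coeff p i)"
  by (simp add: coeff_map_poly hom_on_0)

lemma map_poly_polys: "hom_on L h \<Longrightarrow> subfld L \<Longrightarrow> h ` L \<subseteq> M \<Longrightarrow> p \<in> polys L \<Longrightarrow> map_poly h p \<in> polys M"
  by (auto simp: polys_def coeff_map_poly_hom)

lemma map_poly_hom_add:
  "hom_on L h \<Longrightarrow> subfld L \<Longrightarrow> p \<in> polys L \<Longrightarrow> q \<in> polys L \<Longrightarrow> map_poly h (p + q) = map_poly h p + map_poly h q"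
  by (intro poly_eqI) (simp add: coeff_map_poly_hom hom_on_add polys_coeff)

lemma map_poly_hom_diff:
  "hom_on L h \<Longrightarrow> subfld L \<Longrightarrow> p \<in> polys L \<Longrightarrow> q \<in> polys L \<Longrightarrow> map_poly h (p - q) = map_poly h p - map_poly h q"
  by (intro poly_eqI) (simp add: coeff_map_poly_hom hom_on_diff polys_coeff)

lemma map_poly_hom_mult:
  "hom_on L h \<Longrightarrow> subfld L \<Longrightarrow> p \<in> polys L \<Longrightarrow> q \<in> polys L \<Longrightarrow> map_poly h (p * q) = map_poly h p * map_poly h q"
  by (intro poly_eqI)
    (simp add: coeff_map_poly_hom coeff_mult hom_on_sum hom_on_mult polys_coeff subfld_mult)

lemma map_poly_pCons_hom:
  "hom_on L h \<Longrightarrow> subfld L \<Longrightarrow> map_poly h (pCons a p) = pCons (h a) (map_poly h p)"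
  by (intro poly_eqI) (simp add: coeff_map_poly_hom coeff_pCons split: nat.split)

lemma hom_on_poly:
  assumes "hom_on L h" "subfld L" "x \<in> L"
  shows "p \<in> polys L \<Longrightarrow> h (poly p x) = poly (map_poly h p) (h x)"
proof (induction p)
  case (pCons a p)
  have a: "a \<in> L" using polys_coeff[OF pCons.prems(1), of 0] by simp
  have p: "p \<in> polys L"
    unfolding polys_def using polys_coeff[OF pCons.prems(1), of "Suc _"] by auto
  have px: "poly p x \<in> L" by (rule poly_in_subfld) (use assms p in auto)
  show ?case
    using a p px pCons.IH assms
    by (simp add: map_poly_pCons_hom[OF assms(1,2)] hom_on_add[OF assms(1)] hom_on_mult[OF assms(1)]
        subfld_mult)
qed (use assms hom_on_0 in auto)

definition adjoin :: "'a::field set \<Rightarrow> 'a \<Rightarrow> 'a set" where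
  "adjoin L \<theta> = {poly P \<theta> / poly Q \<theta> |P Q. P \<in> polys L \<and> Q \<in> polys L \<and> poly Q \<theta> \<noteq> 0}"

lemma adjoinI: "P \<in> polys L \<Longrightarrow> Q \<in> polys L \<Longrightarrow> poly Q \<theta> \<noteq> 0 \<Longrightarrow> poly P \<theta> / poly Q \<theta> \<in> adjoin L \<theta>"
  by (auto simp: adjoin_def)

lemma adjoinE:
  assumes "x \<in> adjoin L \<theta>"
  obtains P Q where "P \<in> polys L" "Q \<in> polys L" "poly Q \<theta> \<noteq> 0" "x = poly P \<theta> / poly Q \<theta>"
  using assms by (auto simp: adjoin_def)

lemma adjoin_base: assumes "subfld L" "x \<in> L" shows "x \<in> adjoin L \<theta>"
proof -
  have "poly [:x:] \<theta> / poly 1 \<theta> \<in> adjoin L \<theta>"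
    by (rule adjoinI) (use assms in \<open>auto intro: polys_pCons polys_0 polys_1\<close>)
  then show ?thesis by simp
qed

lemma adjoin_self: assumes "subfld L" shows "\<theta> \<in> adjoin L \<theta>"
proof -
  have "poly [:0, 1:] \<theta> / poly 1 \<theta> \<in> adjoin L \<theta>"
    by (rule adjoinI) (use assms in \<open>auto intro!: polys_pCons polys_0 polys_1 subfld_0 subfld_1\<close>)
  then show ?thesis by simp
qed

lemma subfld_adjoin:
  assumes L: "subfld L" shows "subfld (adjoin L \<theta>)"
  unfolding subfld_def
proof (intro conjI ballI)
  show "0 \<in> adjoin L \<theta>" "1 \<in> adjoin L \<theta>"
    using adjoin_base[OF L] subfld_0[OF L] subfld_1[OF L] by auto
  fix x assume "x \<in> adjoin L \<theta>"
  then obtain P Q where P: "P \<in> polys L" "Q \<in> polys L" "poly Q \<theta> \<noteq> 0" "x = poly P \<theta> / poly Q \<theta>"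
    by (rule adjoinE)
  have "poly (0 - P) \<theta> / poly Q \<theta> \<in> adjoin L \<theta>"
    by (rule adjoinI) (use P L in \<open>auto intro!: polys_diff[of L 0 P, simplified] polys_0\<close>)
  then show "- x \<in> adjoin L \<theta>" using P by simp
  show "inverse x \<in> adjoin L \<theta>"
  proof (cases "poly P \<theta> = 0")
    case True
    then show ?thesis using P adjoin_base[OF L subfld_0[OF L]] by simp
  next
    case False
    then have "poly Q \<theta> / poly P \<theta> \<in> adjoin L \<theta>" using P by (intro adjoinI)
    then show ?thesis using P by simp
  qed
  fix y assume "y \<in> adjoin L \<theta>"
  then obtain P' Q' where P': "P' \<in> polys L" "Q' \<in> polys L" "poly Q' \<theta> \<noteq> 0" "y = poly P' \<theta> / poly Q' \<theta>"
    by (rule adjoinE)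
  have "poly (P * Q' + P' * Q) \<theta> / poly (Q * Q') \<theta> \<in> adjoin L \<theta>"
    by (rule adjoinI) (use P P' L in \<open>auto intro!: polys_add polys_mult\<close>)
  moreover have "x + y = poly (P * Q' + P' * Q) \<theta> / poly (Q * Q') \<theta>"
    unfolding P(4) P'(4) using P(3) P'(3) by (simp add: add_frac_eq)
  ultimately show "x + y \<in> adjoin L \<theta>" by simp
  have "poly (P * P') \<theta> / poly (Q * Q') \<theta> \<in> adjoin L \<theta>"
    by (rule adjoinI) (use P P' L in \<open>auto intro!: polys_add polys_mult\<close>)
  moreover have "x * y = poly (P * P') \<theta> / poly (Q * Q') \<theta>"
    unfolding P(4) P'(4) by simp
  ultimately show "x * y \<in> adjoin L \<theta>" by simp
qed

lemma adjoin_least: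
  assumes M: "subfld M" and "L \<subseteq> M" "\<theta> \<in> M" shows "adjoin L \<theta> \<subseteq> M"
proof
  fix x assume "x \<in> adjoin L \<theta>"
  then obtain P Q where P: "P \<in> polys L" "Q \<in> polys L" "x = poly P \<theta> / poly Q \<theta>"
    by (auto elim: adjoinE)
  moreover have "P \<in> polys M" "Q \<in> polys M" using P assms(2) by (auto simp: polys_def)
  ultimately show "x \<in> M" using M assms(3) by (auto intro!: subfld_divide poly_in_subfld)
qed

lemma hom_on_adjoin_unique:
  assumes L: "subfld L" and h: "hom_on (adjoin L \<theta>) h" and h': "hom_on (adjoin L \<theta>) h'"
    and eq: "\<And>x. x \<in> L \<Longrightarrow> h x = h' x" "h \<theta> = h' \<theta>" and x: "x \<in> adjoin L \<theta>"
  shows "h x = h' x"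
proof -
  note A = subfld_adjoin[OF L, of \<theta>]
  have *: "h (poly P \<theta>) = h' (poly P \<theta>)" if P: "P \<in> polys L" for P
  proof -
    have P': "P \<in> polys (adjoin L \<theta>)" using P adjoin_base[OF L] by (auto simp: polys_def)
    have "map_poly h P = map_poly h' P"
      using P eq by (intro poly_eqI) (simp add: coeff_map_poly_hom[OF h A] coeff_map_poly_hom[OF h' A] polys_coeff)
    then show ?thesis
      using hom_on_poly[OF h A adjoin_self[OF L] P'] hom_on_poly[OF h' A adjoin_self[OF L] P'] eq(2) by simp
  qed
  from x obtain P Q where P: "P \<in> polys L" "Q \<in> polys L" "x = poly P \<theta> / poly Q \<theta>"
    by (auto elim: adjoinE)
  have in_A: "poly P \<theta> \<in> adjoin L \<theta>" if "P \<in> polys L" for P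
    by (rule poly_in_subfld[OF A]) (use that adjoin_base[OF L] adjoin_self[OF L] in \<open>auto simp: polys_def\<close>)
  show ?thesis
    using P * by (simp add: hom_on_divide[OF h A] hom_on_divide[OF h' A] in_A)
qed

text \<open>
  The element \<open>\<theta>\<close> may be sent to \<open>\<theta>'\<close> if the two satisfy corresponding polynomial equations. The
  equivalence in the hypothesis serves both to make the values on fractions well defined and to keep the
  denominators nonzero.
\<close>

lemma hom_on_adjoin_exists:
  assumes L: "subfld L" and h: "hom_on L h"
    and compat: "\<And>P. P \<in> polys L \<Longrightarrow> poly P \<theta> = 0 \<longleftrightarrow> poly (map_poly h P) \<theta>' = 0"
  shows "\<exists>h'. hom_on (adjoin L \<theta>) h' \<and> (\<forall>x\<in>L. h' x = h x) \<and> h' \<theta> = \<theta>'"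
proof -
  note add = map_poly_hom_add[OF h L] and mult = map_poly_hom_mult[OF h L] and diff = map_poly_hom_diff[OF h L]
  define rep where "rep x y \<longleftrightarrow> (\<exists>P Q. P \<in> polys L \<and> Q \<in> polys L \<and> poly Q \<theta> \<noteq> 0 \<and> x = poly P \<theta> / poly Q \<theta> \<and>
      y = poly (map_poly h P) \<theta>' / poly (map_poly h Q) \<theta>')" for x y
  have rep_unique: "y = y'" if "rep x y" "rep x y'" for x y y'
  proof -
    from that obtain P Q P' Q' where P: "P \<in> polys L" "Q \<in> polys L" "poly Q \<theta> \<noteq> 0"
        "x = poly P \<theta> / poly Q \<theta>" "y = poly (map_poly h P) \<theta>' / poly (map_poly h Q) \<theta>'"
      and P': "P' \<in> polys L" "Q' \<in> polys L" "poly Q' \<theta> \<noteq> 0"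
        "x = poly P' \<theta> / poly Q' \<theta>" "y' = poly (map_poly h P') \<theta>' / poly (map_poly h Q') \<theta>'"
      unfolding rep_def by blast
    have "poly (P * Q' - P' * Q) \<theta> = 0" using P P' by (simp add: field_simps)
    then have "poly (map_poly h (P * Q' - P' * Q)) \<theta>' = 0"
      using compat[of "P * Q' - P' * Q"] P P' by (auto intro!: polys_diff polys_mult L)
    then have "poly (map_poly h P) \<theta>' * poly (map_poly h Q') \<theta>' =
        poly (map_poly h P') \<theta>' * poly (map_poly h Q) \<theta>'"
      using P P' by (simp add: diff mult polys_mult L)
    moreover have "poly (map_poly h Q) \<theta>' \<noteq> 0" "poly (map_poly h Q') \<theta>' \<noteq> 0"
      using compat P P' by auto
    ultimately show ?thesis unfolding P(5) P'(5) by (simp add: frac_eq_eq)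
  qed
  define h' where "h' x = (SOME y. rep x y)" for x
  have h': "h' x = y" if "rep x y" for x y
    unfolding h'_def by (rule some_equality) (use that rep_unique in auto)
  have rep: "rep (poly P \<theta> / poly Q \<theta>) (poly (map_poly h P) \<theta>' / poly (map_poly h Q) \<theta>')"
    if "P \<in> polys L" "Q \<in> polys L" "poly Q \<theta> \<noteq> 0" for P Q
    using that unfolding rep_def by blast
  have map1: "map_poly h 1 = 1"
    by (intro poly_eqI) (simp add: coeff_map_poly_hom[OF h L] hom_on_1[OF h] hom_on_0[OF h L])
  have const: "h' x = h x" if "x \<in> L" for x
    using h'[OF rep[of "[:x:]" 1]] that L polys_1[OF L]
    by (simp add: polys_pCons polys_0 map_poly_pCons_hom[OF h L] map1)
  have gen: "h' \<theta> = \<theta>'"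
    using h'[OF rep[of "[:0, 1:]" 1]] L polys_1[OF L]
    by (simp add: polys_pCons polys_0 map_poly_pCons_hom[OF h L] map1 hom_on_1[OF h] hom_on_0[OF h L]
        subfld_0 subfld_1)
  have "hom_on (adjoin L \<theta>) h'"
    unfolding hom_on_def
  proof (intro conjI ballI)
    show "h' 1 = 1" using const[OF subfld_1[OF L]] hom_on_1[OF h] by simp
    fix x y assume "x \<in> adjoin L \<theta>" "y \<in> adjoin L \<theta>"
    then obtain P Q P' Q' where P: "P \<in> polys L" "Q \<in> polys L" "poly Q \<theta> \<noteq> 0" "x = poly P \<theta> / poly Q \<theta>"
      and P': "P' \<in> polys L" "Q' \<in> polys L" "poly Q' \<theta> \<noteq> 0" "y = poly P' \<theta> / poly Q' \<theta>"
      by (metis adjoinE)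
    have Q0: "poly (map_poly h Q) \<theta>' \<noteq> 0" "poly (map_poly h Q') \<theta>' \<noteq> 0"
      using compat P P' by auto
    have hx: "h' x = poly (map_poly h P) \<theta>' / poly (map_poly h Q) \<theta>'"
      and hy: "h' y = poly (map_poly h P') \<theta>' / poly (map_poly h Q') \<theta>'"
      using h'[OF rep] P P' by auto
    have 1: "x + y = poly (P * Q' + P' * Q) \<theta> / poly (Q * Q') \<theta>"
      and 2: "x * y = poly (P * P') \<theta> / poly (Q * Q') \<theta>"
      unfolding P(4) P'(4) using P(3) P'(3) by (simp_all add: add_frac_eq)
    show "h' (x + y) = h' x + h' y"
      unfolding 1 using P P' Q0
      by (subst h'[OF rep]) (auto simp: hx hy add mult polys_add polys_mult L field_simps)
    show "h' (x * y) = h' x * h' y"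
      unfolding 2 using P P' Q0
      by (subst h'[OF rep]) (auto simp: hx hy add mult polys_add polys_mult L field_simps)
  qed
  then show ?thesis using const gen by blast
qed

section \<open>Kummer theory\<close>

lemma dvd_prod_linear:
  fixes P :: "'a::field poly"
  assumes "P dvd (\<Prod>z\<in>#A. [:- z, 1:])"
  shows "\<exists>B c. B \<subseteq># A \<and> P = smult c (\<Prod>z\<in>#B. [:- z, 1:])"
  using assms
proof (induction A arbitrary: P)
  case empty
  then have "P dvd 1" by simp
  then obtain c where "P = [:c:]" by (metis is_unit_polyE)
  then show ?case by (intro exI[of _ "{#}"] exI[of _ c]) auto
next
  case (add r A)
  show ?case
  proof (cases "poly P r = 0")
    case True
    then obtain P' where P': "P = [:- r, 1:] * P'" by (metis poly_eq_0_iff_dvd dvdE)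
    have nz: "[:- r, 1:] \<noteq> 0" by simp
    have "[:- r, 1:] * P' dvd [:- r, 1:] * (\<Prod>z\<in>#A. [:- z, 1:])"
      using add.prems unfolding P' by (simp only: image_mset_add_mset prod_mset.add_mset)
    then have "P' dvd (\<Prod>z\<in>#A. [:- z, 1:])"
      using nz by (simp only: dvd_mult_cancel_left) simp
    from add.IH[OF this] obtain B c where "B \<subseteq># A" "P' = smult c (\<Prod>z\<in>#B. [:- z, 1:])" by blast
    then show ?thesis using P'
      by (intro exI[of _ "add_mset r B"] exI[of _ c]) auto
  next
    case False
    have nz: "[:- r, 1:] \<noteq> 0" by simp
    have "P dvd [:- r, 1:] * (\<Prod>z\<in>#A. [:- z, 1:])"
      using add.prems by (simp only: image_mset_add_mset prod_mset.add_mset)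
    then obtain Q where Q: "[:- r, 1:] * (\<Prod>z\<in>#A. [:- z, 1:]) = P * Q" by (rule dvdE)
    have "poly P r * poly Q r = 0" unfolding poly_mult[symmetric] Q[symmetric] by simp
    then have "poly Q r = 0" using False by simp
    then obtain Q' where "Q = [:- r, 1:] * Q'" by (metis poly_eq_0_iff_dvd dvdE)
    then have "[:- r, 1:] * (\<Prod>z\<in>#A. [:- z, 1:]) = [:- r, 1:] * (P * Q')" using Q by (simp only: ac_simps)
    then have "(\<Prod>z\<in>#A. [:- z, 1:]) = P * Q'" using nz by (simp only: mult_cancel_left) simp
    then have "P dvd (\<Prod>z\<in>#A. [:- z, 1:])" by simp
    from add.IH[OF this] obtain B c where "B \<subseteq># A" "P = smult c (\<Prod>z\<in>#B. [:- z, 1:])" by blast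
    then show ?thesis by (intro exI[of _ B] exI[of _ c]) (auto intro: subset_mset.order_trans)
  qed
qed

lemma lead_coeff_prod_linear:
    "lead_coeff (\<Prod>z\<in>#B. [:- f z, 1 :: 'a::field:]) = 1"
proof (induction B)
  case (add x B)
  then show ?case by (simp only: image_mset_add_mset prod_mset.add_mset lead_coeff_mult) simp
qed simp

lemma degree_prod_linear: "Polynomial.degree (\<Prod>z\<in>#B. [:- f z, 1 :: 'a::field:]) = size B"
proof (induction B)
  case (add x B)
  have "(\<Prod>z\<in>#B. [:- f z, 1:]) \<noteq> 0"
    using lead_coeff_prod_linear[of f B] by (metis leading_coeff_0_iff zero_neq_one)
  then have "Polynomial.degree ([:- f x, 1:] * (\<Prod>z\<in>#B. [:- f z, 1:])) = Suc (size B)"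
    using add by (subst degree_mult_eq) auto
  then show ?case by (simp only: image_mset_add_mset prod_mset.add_mset size_add_mset)
qed simp

text \<open>
  The argument of Kummer theory. Let \<open>d\<close> be the least positive exponent with \<open>\<alpha>\<^sup>d\<close> in
  \<open>L\<close>. A polynomial \<open>p\<close> of least degree \<open>e\<close> that vanishes at \<open>\<alpha>\<close> divides
  \<open>x\<^sup>d - \<alpha>\<^sup>d\<close>, which is a product of factors \<open>x - z \<alpha>\<close> with \<open>z\<close> in \<open>L\<close>. So the
  constant term of \<open>p\<close> is \<open>\<alpha>\<^sup>e\<close> up to a factor from \<open>L\<close>, and \<open>\<alpha>\<^sup>e\<close> is in \<open>L\<close>.
\<close>

lemma radical_degree_minimal:
  fixes L :: "'a::field set"
  assumes L: "subfld L" and d: "0 < d" "\<alpha> ^ d \<in> L" "\<And>e. 0 < e \<Longrightarrow> e < d \<Longrightarrow> \<alpha> ^ e \<notin> L"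
    and split: "Polynomial.monom 1 d - [:\<alpha> ^ d:] = (\<Prod>z\<in>#A. [:- (z * \<alpha>), 1:])"
    and A: "set_mset A \<subseteq> L - {0}"
    and P: "P \<in> polys L" "P \<noteq> 0" "poly P \<alpha> = 0"
  shows "d \<le> Polynomial.degree P"
proof (rule ccontr)
  assume less: "\<not> d \<le> Polynomial.degree P"
  define Q where "Q p \<longleftrightarrow> p \<in> polys L \<and> p \<noteq> 0 \<and> poly p \<alpha> = 0" for p
  obtain p where p: "Q p" and min: "\<And>q. Q q \<Longrightarrow> Polynomial.degree p \<le> Polynomial.degree q"
    using ex_has_least_nat[of Q P Polynomial.degree] P unfolding Q_def by blast
  have e_less: "Polynomial.degree p < d" using min[of P] P less by (simp add: Q_def)
  let ?M = "Polynomial.monom 1 d - [:\<alpha> ^ d:]"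
  have M: "?M \<in> polys L"
    by (intro polys_diff polys_monom polys_pCons polys_0 L d subfld_1)
  obtain q r where qr: "q \<in> polys L" "r \<in> polys L" "?M = q * p + r" "r = 0 \<or> Polynomial.degree r < Polynomial.degree p"
    using polys_division[OF L _ _ M, of p] p unfolding Q_def by blast
  have "poly ?M \<alpha> = 0" by (simp add: poly_monom)
  then have "poly r \<alpha> = 0" using qr(3) p by (simp add: Q_def)
  then have "r = 0" using qr min[of r] unfolding Q_def by fastforce
  then have "p dvd ?M" using qr by simp
  then have "p dvd (\<Prod>z\<in>#image_mset (\<lambda>z. z * \<alpha>) A. [:- z, 1:])"
    unfolding split by (simp add: image_mset.compositionality comp_def)
  then obtain B c where B: "B \<subseteq># image_mset (\<lambda>z. z * \<alpha>) A" "p = smult c (\<Prod>z\<in>#B. [:- z, 1:])"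
    using dvd_prod_linear by blast
  from B(1) obtain B' where B': "B' \<subseteq># A" "B = image_mset (\<lambda>z. z * \<alpha>) B'"
  proof -
    obtain C where "image_mset (\<lambda>z. z * \<alpha>) A = B + C" using B(1) by (auto simp: mset_subset_eq_exists_conv)
    then obtain B' C' where "A = B' + C'" "B = image_mset (\<lambda>z. z * \<alpha>) B'"
      by (blast dest: image_mset_eq_plusD)
    then show ?thesis using that[of B'] by simp
  qed
  define e where "e = size B'"
  have c0: "c \<noteq> 0" using p B by (auto simp: Q_def)
  have B2: "p = smult c (\<Prod>z\<in>#B'. [:- (z * \<alpha>), 1:])"
    using B(2) B'(2) by (simp add: image_mset.compositionality comp_def)
  have deg: "Polynomial.degree p = e" and lc: "lead_coeff p = c"
    unfolding B2 lead_coeff_smult lead_coeff_prod_linear using c0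
    by (simp_all only: degree_smult_eq degree_prod_linear e_def) simp_all
  have "e \<noteq> 0"
  proof
    assume "e = 0"
    then have "B' = {#}" by (simp add: e_def)
    then have "p = [:c:]" using B B' by simp
    then show False using p c0 by (simp add: Q_def)
  qed
  have cL: "c \<in> L" using polys_coeff[of p L] p lc unfolding Q_def by metis
  have "set_mset B' \<subseteq> L - {0}" using A set_mset_mono[OF B'(1)] by blast
  then have prodL: "(\<Prod>z\<in>#B'. - z) \<in> L - {0}"
    by (induction B') (auto simp: L subfld_uminus subfld_mult subfld_1)
  have "poly p 0 = c * ((\<Prod>z\<in>#B'. - z) * \<alpha> ^ e)"
    unfolding B2 e_def by (induction B') (auto simp: algebra_simps)
  then have "\<alpha> ^ e = poly p 0 / (c * (\<Prod>z\<in>#B'. - z))"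
    using c0 prodL by (auto simp: field_simps)
  moreover have "poly p 0 \<in> L" using p by (auto simp: Q_def L poly_in_subfld subfld_0)
  ultimately have "\<alpha> ^ e \<in> L" using prodL cL by (simp add: L subfld_divide subfld_mult)
  then show False using d(3)[of e] \<open>e \<noteq> 0\<close> e_less deg by simp
qed

section \<open>The icosahedral group\<close>

text \<open>
  Klein's invariants of the binary icosahedral group: \<open>ico_f\<close> is the form of degree 12 that vanishes at the
  vertices, \<open>ico_H\<close> is up to a factor its Hessian, the form of degree 20 that vanishes at the centres of the
  faces. Their quotient \<open>ico_J\<close> is invariant under the icosahedral group of Moebius transformations.
\<close>

definition ico_f :: "'a::field \<Rightarrow> 'a \<Rightarrow> 'a" where
  "ico_f a b = a * b * ((a ^ 10 - b ^ 10) + 11 * (a ^ 5 * b ^ 5))"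

definition ico_H :: "'a::field \<Rightarrow> 'a \<Rightarrow> 'a" where
  "ico_H a b = (a ^ 10 - b ^ 10) ^ 2 - 228 * (a ^ 10 - b ^ 10) * (a ^ 5 * b ^ 5) + 496 * (a ^ 5 * b ^ 5) ^ 2"

definition ico_J :: "'a::field \<Rightarrow> 'a" where
  "ico_J u = ico_H u 1 ^ 3 / ico_f u 1 ^ 5"

\<comment> \<open>An involution of the icosahedral group is \<open>u \<mapsto> (g - u) / (1 + g u)\<close> with \<open>g\<close> the golden section. The
  auxiliary forms \<open>M\<close> and \<open>K\<close> are the transforms of \<open>a\<^sup>1\<^sup>0 - b\<^sup>1\<^sup>0\<close> and of
  \<open>a\<^sup>5 b\<^sup>5\<close> without the common factor \<open>3 - 5 g\<close>; they have integer coefficients, and this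
  keeps the polynomial identities small.\<close>
context
  fixes a b g A B M K :: "'a::field"
  assumes g: "g * g = 1 - g"
    and A: "A = g * b - a" and B: "B = b + g * a"
    and M: "M = - 11 * a ^ 10 + 70 * a ^ 9 * b - 180 * a ^ 8 * b ^ 2 + 360 * a ^ 7 * b ^ 3 - 210 * a ^ 6 * b ^ 4 + 504 * a ^ 5 * b ^ 5 + 210 * a ^ 4 * b ^ 6 + 360 * a ^ 3 * b ^ 7 + 180 * a ^ 2 * b ^ 8 + 70 * a * b ^ 9 + 11 * b ^ 10"
    and K: "K = a ^ 10 + 5 * a ^ 9 * b + 5 * a ^ 8 * b ^ 2 - 10 * a ^ 7 * b ^ 3 - 15 * a ^ 6 * b ^ 4 + 11 * a ^ 5 * b ^ 5 + 15 * a ^ 4 * b ^ 6 - 10 * a ^ 3 * b ^ 7 - 5 * a ^ 2 * b ^ 8 + 5 * a * b ^ 9 - b ^ 10"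
begin

lemma ico_fifth_powers:
  "A ^ 5 = - (a ^ 5) + 5 * g * a ^ 4 * b - (10 - 10 * g) * a ^ 3 * b ^ 2 - (10 - 20 * g) * a ^ 2 * b ^ 3 - (10 - 15 * g) * a * b ^ 4 - (3 - 5 * g) * b ^ 5"
  "B ^ 5 = - (3 - 5 * g) * a ^ 5 + (10 - 15 * g) * a ^ 4 * b - (10 - 20 * g) * a ^ 3 * b ^ 2 + (10 - 10 * g) * a ^ 2 * b ^ 3 + 5 * g * a * b ^ 4 + b ^ 5"
  unfolding A B using g by Groebner_Basis.algebra+

lemma ico_tenth_powers: "A ^ 10 - B ^ 10 = (3 - 5 * g) * M" "A ^ 5 * B ^ 5 = (3 - 5 * g) * K"
proof -
  have "(A ^ 5) ^ 2 - (B ^ 5) ^ 2 = (3 - 5 * g) * M"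
    unfolding ico_fifth_powers M using g by Groebner_Basis.algebra
  then show "A ^ 10 - B ^ 10 = (3 - 5 * g) * M" by (simp flip: power_mult)
  show "A ^ 5 * B ^ 5 = (3 - 5 * g) * K"
    unfolding ico_fifth_powers K using g by Groebner_Basis.algebra
qed

lemma ico_f_transform: "ico_f A B = - (125 * g * (3 - 5 * g)) * ico_f a b"
proof -
  have "A * B = - g * (a ^ 2 + a * b - b ^ 2)" unfolding A B using g by Groebner_Basis.algebra
  moreover have "(a ^ 2 + a * b - b ^ 2) * (M + 11 * K) = 125 * (a * b * ((a ^ 10 - b ^ 10) + 11 * (a ^ 5 * b ^ 5)))"
    unfolding M K by Groebner_Basis.algebra
  ultimately show ?thesis
    unfolding ico_f_def ico_tenth_powers by Groebner_Basis.algebra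
qed

lemma ico_H_transform: "ico_H A B = 3125 * (3 - 5 * g) ^ 2 * ico_H a b"
proof -
  have "M ^ 2 - 228 * M * K + 496 * K ^ 2 = 3125 * ((a ^ 10 - b ^ 10) ^ 2 - 228 * (a ^ 10 - b ^ 10) * (a ^ 5 * b ^ 5) + 496 * (a ^ 5 * b ^ 5) ^ 2)"
    unfolding M K by Groebner_Basis.algebra
  then show ?thesis
    unfolding ico_H_def ico_tenth_powers by Groebner_Basis.algebra
qed

end

text \<open>
  The multipliers of the two forms cancel in \<open>H\<^sup>3 / f\<^sup>5\<close> because \<open>g\<^sup>5 = 5 g - 3\<close>.
\<close>

lemma ico_form_invariant:
  fixes a b g :: "'a::field"
  assumes g: "g * g = 1 - g"
  shows "ico_H (g * b - a) (b + g * a) ^ 3 * ico_f a b ^ 5 = ico_H a b ^ 3 * ico_f (g * b - a) (b + g * a) ^ 5"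
proof -
  have g5: "g ^ 5 = 5 * g - 3" using g by Groebner_Basis.algebra
  have "(125 :: 'a) ^ 5 = 3125 ^ 3" by simp
  then have "(3125 * (3 - 5 * g) ^ 2) ^ 3 = (- (125 * g * (3 - 5 * g))) ^ 5"
    using g5 by Groebner_Basis.algebra
  then show ?thesis
    unfolding ico_f_transform[OF g refl refl refl refl] ico_H_transform[OF g refl refl refl refl]
    by (simp add: power_mult_distrib ac_simps)
qed

lemma ico_form_scale: 
  fixes c :: "'a::field"
  shows "ico_f (c * a) (c * b) = c ^ 12 * ico_f a b" "ico_H (c * a) (c * b) = c ^ 20 * ico_H a b"
  unfolding ico_f_def ico_H_def by Groebner_Basis.algebra+

lemma ico_J_rotate:
  fixes z :: "'a::field"
  assumes z: "z ^ 5 = 1"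
  shows "ico_J (z * u) = ico_J u"
proof -
  have z10: "z ^ 10 = 1" using z by Groebner_Basis.algebra
  have "ico_H (z * u) 1 = ico_H u 1"
    unfolding ico_H_def using z z10 by (simp add: power_mult_distrib)
  moreover have "ico_f (z * u) 1 = z * ico_f u 1"
    unfolding ico_f_def using z z10 by (simp add: power_mult_distrib algebra_simps)
  ultimately show ?thesis unfolding ico_J_def by (simp add: power_mult_distrib z)
qed

lemma ico_J_flip:
  fixes g :: "'a::field"
  assumes g: "g * g = 1 - g" and u: "1 + g * u \<noteq> 0"
    and f: "ico_f u 1 \<noteq> 0" "ico_f ((g - u) / (1 + g * u)) 1 \<noteq> 0"
  shows "ico_J ((g - u) / (1 + g * u)) = ico_J u"
proof -
  define c where "c = 1 + g * u"
  define v where "v = (g - u) / c"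
  have c0: "c \<noteq> 0" using u by (simp add: c_def)
  have f': "ico_f (g - u) c = c ^ 12 * ico_f v 1" and H': "ico_H (g - u) c = c ^ 20 * ico_H v 1"
    using ico_form_scale[of c v 1] c0 by (simp_all add: v_def)
  have "c ^ 60 * (ico_H v 1 ^ 3 * ico_f u 1 ^ 5) = c ^ 60 * (ico_H u 1 ^ 3 * ico_f v 1 ^ 5)"
    using ico_form_invariant[OF g, of 1 u]
    unfolding c_def[symmetric] mult_1_right f' H' by (simp add: power_mult_distrib ac_simps flip: power_mult)
  then have "ico_H v 1 ^ 3 * ico_f u 1 ^ 5 = ico_H u 1 ^ 3 * ico_f v 1 ^ 5" using c0 by simp
  then show ?thesis
    using f unfolding ico_J_def c_def[symmetric] v_def[symmetric] by (simp add: frac_eq_eq)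
qed

section \<open>Radical extensions cannot break the icosahedral symmetry\<close>

abbreviation cst :: "complex \<Rightarrow> complex fls" where "cst \<equiv> fls_const"

lemma hom_on_cst: "hom_on UNIV cst"
  by (simp add: hom_on_def fls_plus_const)

lemma subfld_UNIV: "subfld UNIV"
  by (simp add: subfld_def)

lemma subfld_range_cst: "subfld (range cst)"
proof -
  have "inverse (cst c) \<in> range cst" "- cst c \<in> range cst" for c
    using hom_on_inverse[OF hom_on_cst subfld_UNIV, of c] hom_on_uminus[OF hom_on_cst subfld_UNIV, of c]
    by (metis UNIV_I rangeI)+
  moreover have "0 = cst 0" "1 = cst 1" by simp_all
  ultimately show ?thesis unfolding subfld_def by (auto simp: fls_plus_const simp del: fls_const_uminus)
qed

lemma polys_UNIV [simp]: "p \<in> polys UNIV"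
  by (simp add: polys_def)

lemmas map_cst_mult = map_poly_hom_mult[OF hom_on_cst subfld_UNIV polys_UNIV polys_UNIV]
lemmas map_cst_pCons = map_poly_pCons_hom[OF hom_on_cst subfld_UNIV]

lemma map_cst_prod_linear: "map_poly cst (\<Prod>z\<in>#A. [:- z, 1:]) = (\<Prod>z\<in>#A. [:- cst z, 1:])"
proof (induction A)
  case empty
  have "map_poly cst [:1:] = [:1:]" by (simp only: map_cst_pCons) simp
  then show ?case by (simp add: one_pCons)
next
  case (add x A)
  then show ?case by (simp only: image_mset_add_mset prod_mset.add_mset map_cst_mult) (simp add: map_cst_pCons)
qed

lemma polys_range_cst: "P \<in> polys (range cst) \<Longrightarrow> \<exists>p. P = map_poly cst p"
proof -
  assume P: "P \<in> polys (range cst)"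
  define p where "p = map_poly (\<lambda>x. fls_nth x 0) P"
  have "Polynomial.coeff P i = cst (fls_nth (Polynomial.coeff P i) 0)" for i
    using polys_coeff[OF P, of i] by auto
  then have "P = map_poly cst p" by (intro poly_eqI) (simp add: p_def coeff_map_poly)
  then show ?thesis by blast
qed

text \<open>
  A polynomial with constant coefficients splits into linear factors \<open>x - c\<close>, none of which vanishes at \<open>u\<close>.
\<close>

lemma transcendental_over_constants:
  assumes u: "u \<notin> range cst" and P: "P \<in> polys (range cst)" "poly P u = 0"
  shows "P = 0"
proof (rule ccontr)
  assume "P \<noteq> 0"
  obtain p where p: "P = map_poly cst p" using polys_range_cst P by blast
  then have "p \<noteq> 0" using \<open>P \<noteq> 0\<close> by auto
  then obtain A where A: "p = smult (lead_coeff p) (\<Prod>x\<in>#A. [:-x, 1:])"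
    using alg_closed_imp_factorization by blast
  have "P = map_poly cst ([:lead_coeff p:] * (\<Prod>x\<in>#A. [:-x, 1:]))" using A p by simp
  also have "\<dots> = [:cst (lead_coeff p):] * (\<Prod>x\<in>#A. [:-cst x, 1:])"
    by (simp only: map_cst_mult map_cst_prod_linear map_cst_pCons) simp
  finally have "poly P u = cst (lead_coeff p) * (\<Prod>x\<in>#A. u - cst x)"
    by (simp add: poly_prod_mset image_mset.compositionality comp_def)
  moreover have "(\<Prod>x\<in>#A. u - cst x) \<noteq> 0" using u by auto
  ultimately show False using \<open>p \<noteq> 0\<close> P(2) by simp
qed

lemma binomial_splits:
  assumes n: "0 < n"
  obtains A where "\<And>\<alpha>. Polynomial.monom 1 n - [:\<alpha> ^ n:] = (\<Prod>z\<in>#A. [:- (cst z * \<alpha>), 1:])"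
    "\<And>z. z \<in># A \<Longrightarrow> z ^ n = 1"
proof -
  let ?p = "Polynomial.monom 1 n - [:1 :: complex:]"
  have deg: "Polynomial.degree ?p = n" and lc: "lead_coeff ?p = 1"
  proof -
    have "Polynomial.degree (Polynomial.monom 1 n + [:-1 :: complex:]) = n"
      using n by (subst degree_add_eq_left) (auto simp: Polynomial.degree_monom_eq)
    moreover have "?p = Polynomial.monom 1 n + [:-1:]"
      by (simp add: poly_eq_iff coeff_pCons split: nat.split)
    ultimately show *: "Polynomial.degree ?p = n" by (simp only:)
    show "lead_coeff ?p = 1" unfolding * using n by (cases n) auto
  qed
  then have "?p \<noteq> 0" by auto
  then obtain A where A: "size A = n" "?p = (\<Prod>x\<in>#A. [:-x, 1:])"
    using alg_closed_imp_factorization[of ?p] deg lc by auto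
  have "z ^ n = 1" if "z \<in># A" for z
  proof -
    have "poly ?p z = (\<Prod>x\<in>#A. z - x)"
      by (simp only: A(2) poly_prod_mset) (simp add: image_mset.compositionality comp_def)
    also have "\<dots> = 0" using that by (auto simp: image_iff)
    finally show ?thesis by (simp add: poly_monom)
  qed
  moreover have "Polynomial.monom 1 n - [:\<alpha> ^ n:] = (\<Prod>z\<in>#A. [:- (cst z * \<alpha>), 1:])" for \<alpha>
  proof -
    have "map_poly cst ?p = Polynomial.monom 1 n - [:1:]"
      by (intro poly_eqI) (simp add: coeff_map_poly coeff_pCons split: nat.split)
    then have "Polynomial.monom 1 n - [:1:] = (\<Prod>z\<in>#A. [:- cst z, 1:])"
      unfolding A(2) map_cst_prod_linear by simp
    then have "poly (Polynomial.monom 1 n - [:1:]) y = poly (\<Prod>z\<in>#A. [:- cst z, 1:]) y" for y by simp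
    then have 1: "y ^ n - 1 = (\<Prod>z\<in>#A. y - cst z)" for y
      by (simp add: poly_monom poly_prod_mset image_mset.compositionality comp_def)
    have scale: "(\<Prod>z\<in>#B. \<alpha> * f z) = \<alpha> ^ size B * (\<Prod>z\<in>#B. f z)" for B and f :: "complex \<Rightarrow> complex fls"
      by (induction B) auto
    have "x ^ n - \<alpha> ^ n = (\<Prod>z\<in>#A. x - cst z * \<alpha>)" for x
    proof (cases "\<alpha> = 0")
      case True
      then show ?thesis using n A(1) by simp
    next
      case False
      have "x ^ n - \<alpha> ^ n = \<alpha> ^ n * ((x / \<alpha>) ^ n - 1)" using False by (simp add: field_simps)
      also have "\<dots> = (\<Prod>z\<in>#A. \<alpha> * (x / \<alpha> - cst z))" unfolding 1 scale A(1) ..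
      also have "(\<lambda>z. \<alpha> * (x / \<alpha> - cst z)) = (\<lambda>z. x - cst z * \<alpha>)"
        using False by (auto simp: field_simps)
      finally show ?thesis .
    qed
    then show ?thesis
      by (intro poly_eqI2 poly_eq_poly_eq_iff[THEN iffD1] ext)
        (simp add: poly_monom poly_prod_mset image_mset.compositionality comp_def)
  qed
  ultimately show ?thesis using that by blast
qed

lemma root_of_unity_constant:
  assumes "0 < n" "x ^ n = (1 :: complex fls)" obtains c where "x = cst c" "c ^ n = 1"
proof -
  obtain A where A: "\<And>\<alpha>. Polynomial.monom 1 n - [:\<alpha> ^ n:] = (\<Prod>z\<in>#A. [:- (cst z * \<alpha>), 1:])"
    "\<And>z. z \<in># A \<Longrightarrow> z ^ n = 1" using binomial_splits[OF assms(1)] by blast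
  have "poly (Polynomial.monom 1 n - [:1 ^ n:]) x = 0" using assms(2) by (simp add: poly_monom)
  then have "(\<Prod>z\<in>#A. x - cst z) = 0"
    unfolding A(1) by (simp add: poly_prod_mset image_mset.compositionality comp_def)
  then obtain z where "z \<in># A" "x = cst z" by auto
  then show ?thesis using that A(2) by blast
qed

text \<open>
  An action of the icosahedral group, which is generated by \<open>S\<close> and \<open>T\<close> with relations
  \<open>S\<^sup>5 = T\<^sup>2 = (S T)\<^sup>3 = 1\<close>, on the field \<open>L\<close> by automorphisms over the constants. It is described by the
  generators only, since an extension of the action has to be checked on them only.
\<close>

definition ico_action :: "complex fls set \<Rightarrow> (complex fls \<Rightarrow> complex fls) \<Rightarrow> (complex fls \<Rightarrow> complex fls) \<Rightarrow> bool" where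
  "ico_action L S T \<longleftrightarrow> subfld L \<and> range cst \<subseteq> L \<and> hom_on L S \<and> hom_on L T \<and> S ` L \<subseteq> L \<and> T ` L \<subseteq> L \<and>
     (\<forall>c. S (cst c) = cst c \<and> T (cst c) = cst c) \<and>
     (\<forall>x\<in>L. S (S (S (S (S x)))) = x \<and> T (T x) = x \<and> S (T (S (T (S (T x))))) = x)"

definition ico_fixed :: "complex fls set \<Rightarrow> (complex fls \<Rightarrow> complex fls) \<Rightarrow> (complex fls \<Rightarrow> complex fls) \<Rightarrow> complex fls set" where
  "ico_fixed L S T = {x \<in> L. S x = x \<and> T x = x}"

lemma subfld_ico_fixed:
  assumes "ico_action L S T" shows "subfld (ico_fixed L S T)" "range cst \<subseteq> ico_fixed L S T"
proof -
  have L: "subfld L" and S: "hom_on L S" and T: "hom_on L T" using assms by (auto simp: ico_action_def)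
  show "subfld (ico_fixed L S T)"
    unfolding subfld_def ico_fixed_def
    by (auto simp: L S T subfld_intros hom_on_0[OF S L] hom_on_0[OF T L] hom_on_1[OF S] hom_on_1[OF T]
        hom_on_add[OF S] hom_on_add[OF T] hom_on_mult[OF S] hom_on_mult[OF T]
        hom_on_uminus[OF S L] hom_on_uminus[OF T L] hom_on_inverse[OF S L] hom_on_inverse[OF T L])
  show "range cst \<subseteq> ico_fixed L S T" using assms by (auto simp: ico_fixed_def ico_action_def)
qed

text \<open>
  The group is perfect. \<open>S\<close> and \<open>T\<close> multiply \<open>\<alpha>\<close> by roots of unity \<open>c\<close>, \<open>d\<close>, which are
  constants, so the relations give \<open>c\<^sup>5 = d\<^sup>2 = (c d)\<^sup>3 = 1\<close>, and this forces \<open>c = d = 1\<close>.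
\<close>

lemma ico_fixed_radical_in:
  assumes act: "ico_action L S T" and \<alpha>: "\<alpha> \<in> L" and n: "0 < n" "\<alpha> ^ n \<in> ico_fixed L S T"
  shows "\<alpha> \<in> ico_fixed L S T"
proof (cases "\<alpha> = 0")
  case True
  then show ?thesis using subfld_0[OF subfld_ico_fixed(1)[OF act]] by simp
next
  case False
  have L: "subfld L" and S: "hom_on L S" and T: "hom_on L T" and const: "\<And>c. cst c \<in> L"
    and Sc: "\<And>c. S (cst c) = cst c" and Tc: "\<And>c. T (cst c) = cst c"
    using act by (auto simp: ico_action_def)
  have unit: "(h \<alpha> / \<alpha>) ^ n = 1" if h: "hom_on L h" "h (\<alpha> ^ n) = \<alpha> ^ n" for h
  proof -
    have "h \<alpha> ^ n = \<alpha> ^ n" using hom_on_power[OF h(1) L \<alpha>, of n] h(2) by simp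
    then show ?thesis using False unfolding power_divide by simp
  qed
  obtain c where c: "S \<alpha> / \<alpha> = cst c"
    using root_of_unity_constant[OF n(1) unit[OF S]] n(2) by (auto simp: ico_fixed_def)
  obtain d where d: "T \<alpha> / \<alpha> = cst d"
    using root_of_unity_constant[OF n(1) unit[OF T]] n(2) by (auto simp: ico_fixed_def)
  have S\<alpha>: "S \<alpha> = cst c * \<alpha>" and T\<alpha>: "T \<alpha> = cst d * \<alpha>" using c d False by (auto simp: field_simps)
  have Sm: "S (cst e * \<alpha>) = cst (e * c) * \<alpha>" for e
    using hom_on_mult[OF S const \<alpha>] Sc S\<alpha> by (simp flip: fls_const_mult_const)
  have Tm: "T (cst e * \<alpha>) = cst (e * d) * \<alpha>" for e
    using hom_on_mult[OF T const \<alpha>] Tc T\<alpha> by (simp flip: fls_const_mult_const)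
  have "S (S (S (S (S \<alpha>)))) = \<alpha>" "T (T \<alpha>) = \<alpha>" "S (T (S (T (S (T \<alpha>))))) = \<alpha>"
    using act \<alpha> by (auto simp: ico_action_def)
  then have "cst (c * c * c * c * c) * \<alpha> = cst 1 * \<alpha>" "cst (d * d) * \<alpha> = cst 1 * \<alpha>"
      "cst (d * c * d * c * d * c) * \<alpha> = cst 1 * \<alpha>"
    unfolding S\<alpha> T\<alpha> Sm Tm by simp_all
  then have "cst (c * c * c * c * c) = cst 1" "cst (d * d) = cst 1" "cst (d * c * d * c * d * c) = cst 1"
    using False by (simp_all only: mult_cancel_right) auto
  then have "c * c * c * c * c = 1" "d * d = 1" "d * c * d * c * d * c = 1"
    by (metis fls_const_eq_1_iff fls_const_1)+
  then have "c = 1 \<and> d = 1" by Groebner_Basis.algebra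
  then show ?thesis using S\<alpha> T\<alpha> \<alpha> by (simp add: ico_fixed_def)
qed

text \<open>
  By Kummer theory \<open>x\<^sup>d - \<alpha>\<^sup>d\<close> is the minimal polynomial of \<open>\<alpha>\<close>, so it divides \<open>P\<close>, and
  \<open>h\<close> fixes its coefficients.
\<close>

lemma binomial_hom_compat:
  assumes L: "subfld L" and h: "hom_on L h" "h ` L \<subseteq> L" and cL: "range cst \<subseteq> L"
    and d: "0 < d" "\<alpha> ^ d \<in> L" "h (\<alpha> ^ d) = \<alpha> ^ d" "\<And>e. 0 < e \<Longrightarrow> e < d \<Longrightarrow> \<alpha> ^ e \<notin> L"
    and P: "P \<in> polys L" "poly P \<alpha> = 0"
  shows "poly (map_poly h P) \<alpha> = 0"
proof -
  let ?M = "Polynomial.monom 1 d - [:\<alpha> ^ d:]"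
  have M: "?M \<in> polys L"
    by (intro polys_diff polys_monom polys_pCons polys_0 L d subfld_1)
  have deg: "Polynomial.degree ?M \<le> d"
    by (rule degree_diff_le) (auto simp: Polynomial.degree_monom_le)
  have lcM: "Polynomial.coeff ?M d = 1" using d(1) by (cases d) auto
  then have M0: "?M \<noteq> 0" by (metis coeff_0 zero_neq_one)
  obtain A where A: "\<And>\<beta>. Polynomial.monom 1 d - [:\<beta> ^ d:] = (\<Prod>z\<in>#A. [:- (cst z * \<beta>), 1:])"
    "\<And>z. z \<in># A \<Longrightarrow> z ^ d = 1" using binomial_splits[OF d(1)] by blast
  have split: "?M = (\<Prod>z\<in>#image_mset cst A. [:- (z * \<alpha>), 1:])"
    unfolding A(1) by (simp add: image_mset.compositionality comp_def)
  have A0: "set_mset (image_mset cst A) \<subseteq> L - {0}"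
  proof -
    have "z \<noteq> 0" if "z \<in># A" for z
      using A(2)[OF that] d(1) by (cases "z = 0") (auto simp: power_0_left)
    then show ?thesis using cL by (auto simp: image_subset_iff)
  qed
  obtain q r where qr: "q \<in> polys L" "r \<in> polys L" "P = q * ?M + r"
      "r = 0 \<or> Polynomial.degree r < Polynomial.degree ?M"
    using polys_division[OF L M M0 P(1)] by blast
  have "poly r \<alpha> = 0" using qr(3) P(2) by (simp add: poly_monom)
  then have "r = 0"
    using radical_degree_minimal[OF L d(1,2,4) split A0 qr(2)] qr(4) deg by fastforce
  moreover have "map_poly h ?M = ?M"
    using d(3) by (intro poly_eqI)
      (auto simp: coeff_map_poly_hom[OF h(1) L] coeff_pCons hom_on_1[OF h(1)] hom_on_0[OF h(1) L]
        hom_on_diff[OF h(1) L] hom_on_uminus[OF h(1) L] d(2) L subfld_1 split: nat.split)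
  ultimately have "map_poly h P = map_poly h q * ?M"
    using qr map_poly_hom_mult[OF h(1) L qr(1) M] by simp
  then show ?thesis by (simp add: poly_monom)
qed

lemma image_adjoin_subset:
  assumes L: "subfld L" and M: "subfld M" and h: "hom_on (adjoin L \<theta>) h" "h ` L \<subseteq> M" "h \<theta> \<in> M"
  shows "h ` adjoin L \<theta> \<subseteq> M"
proof (rule image_subsetI)
  fix x assume "x \<in> adjoin L \<theta>"
  then obtain P Q where P: "P \<in> polys L" "Q \<in> polys L" "x = poly P \<theta> / poly Q \<theta>" by (auto elim: adjoinE)
  note A = subfld_adjoin[OF L, of \<theta>]
  have *: "poly R \<theta> \<in> adjoin L \<theta> \<and> h (poly R \<theta>) \<in> M" if "R \<in> polys L" for R
  proof -
    have R: "R \<in> polys (adjoin L \<theta>)" using that adjoin_base[OF L] by (auto simp: polys_def)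
    have "map_poly h R \<in> polys M"
      using that h(2) by (auto simp: polys_def coeff_map_poly_hom[OF h(1) A])
    then show ?thesis
      using poly_in_subfld[OF A R adjoin_self[OF L]] hom_on_poly[OF h(1) A adjoin_self[OF L] R]
        poly_in_subfld[OF M _ h(3)] by simp
  qed
  show "h x \<in> M" using * P by (simp add: hom_on_divide[OF h(1) A] subfld_divide[OF M])
qed

lemma ico_action_adjoinI:
  assumes act: "subfld L" "range cst \<subseteq> L"
    and S: "hom_on (adjoin L \<theta>) S" "S ` L \<subseteq> L" "S \<theta> \<in> adjoin L \<theta>"
    and T: "hom_on (adjoin L \<theta>) T" "T ` L \<subseteq> L" "T \<theta> \<in> adjoin L \<theta>"
    and const: "\<And>c. S (cst c) = cst c \<and> T (cst c) = cst c"
    and rel: "\<And>x. x \<in> insert \<theta> L \<Longrightarrow> S (S (S (S (S x)))) = x \<and> T (T x) = x \<and> S (T (S (T (S (T x))))) = x"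
  shows "ico_action (adjoin L \<theta>) S T"
proof -
  let ?A = "adjoin L \<theta>"
  note A = subfld_adjoin[OF act(1), of \<theta>]
  have LA: "L \<subseteq> ?A" using adjoin_base[OF act(1)] by auto
  have SA: "S ` ?A \<subseteq> ?A" and TA: "T ` ?A \<subseteq> ?A"
    using image_adjoin_subset[OF act(1) A S(1) _ S(3)] image_adjoin_subset[OF act(1) A T(1) _ T(3)] S(2) T(2) LA by auto
  have id: "hom_on ?A (\<lambda>x. x)" by (simp add: hom_on_def)
  have T2: "hom_on ?A (\<lambda>x. T (T x))" by (rule hom_on_compose[OF T(1) T(1) TA])
  have S2: "hom_on ?A (\<lambda>x. S (S x))" by (rule hom_on_compose[OF S(1) S(1) SA])
  have S4: "hom_on ?A (\<lambda>x. S (S (S (S x))))" by (rule hom_on_compose[OF S2 S2]) (use SA in blast)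
  have S5: "hom_on ?A (\<lambda>x. S (S (S (S (S x)))))" by (rule hom_on_compose[OF S4 S(1)]) (use SA in blast)
  have U: "hom_on ?A (\<lambda>x. S (T x))" by (rule hom_on_compose[OF T(1) S(1) TA])
  have U2: "hom_on ?A (\<lambda>x. S (T (S (T x))))" by (rule hom_on_compose[OF U U]) (use SA TA in blast)
  have U3: "hom_on ?A (\<lambda>x. S (T (S (T (S (T x))))))" by (rule hom_on_compose[OF U2 U]) (use SA TA in blast)
  note un = hom_on_adjoin_unique[OF act(1) _ id]
  show ?thesis
    unfolding ico_action_def
    using A S(1) T(1) SA TA const rel act(2) LA un[OF S5] un[OF T2] un[OF U3] by auto
qed

text \<open>
  The first power of \<open>\<alpha>\<close> that lies in \<open>L\<close> is fixed, since a power of it is and the group is perfect. Hence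
  the action extends to the field generated by \<open>\<alpha>\<close> with \<open>\<alpha>\<close> fixed. The relations are inherited, as they
  hold on \<open>L\<close> and at \<open>\<alpha>\<close>.
\<close>

lemma ico_action_extend:
  assumes act: "ico_action L S T" and n: "0 < n" "\<alpha> ^ n \<in> ico_fixed L S T"
  shows "\<exists>L' S' T'. ico_action L' S' T' \<and> L \<subseteq> L' \<and> (\<forall>x\<in>L. S' x = S x \<and> T' x = T x) \<and> \<alpha> \<in> ico_fixed L' S' T'"
proof -
  have L: "subfld L" and S: "hom_on L S" and T: "hom_on L T" and SL: "S ` L \<subseteq> L" and TL: "T ` L \<subseteq> L"
    and cL: "range cst \<subseteq> L" and const: "\<And>c. S (cst c) = cst c \<and> T (cst c) = cst c"
    and rel: "\<And>x. x \<in> L \<Longrightarrow> S (S (S (S (S x)))) = x \<and> T (T x) = x \<and> S (T (S (T (S (T x))))) = x"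
    using act by (auto simp: ico_action_def)
  define d where "d = (LEAST d. 0 < d \<and> \<alpha> ^ d \<in> L)"
  have "0 < n \<and> \<alpha> ^ n \<in> L" using n by (auto simp: ico_fixed_def)
  then have d: "0 < d" "\<alpha> ^ d \<in> L" and min: "\<And>e. 0 < e \<Longrightarrow> e < d \<Longrightarrow> \<alpha> ^ e \<notin> L"
    using LeastI[of "\<lambda>d. 0 < d \<and> \<alpha> ^ d \<in> L" n] not_less_Least[of _ "\<lambda>d. 0 < d \<and> \<alpha> ^ d \<in> L"]
    unfolding d_def by auto
  have "(\<alpha> ^ d) ^ n \<in> ico_fixed L S T"
    using subfld_power[OF subfld_ico_fixed(1)[OF act] n(2), of d] by (simp flip: power_mult add: mult.commute)
  then have fx: "S (\<alpha> ^ d) = \<alpha> ^ d" "T (\<alpha> ^ d) = \<alpha> ^ d"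
    using ico_fixed_radical_in[OF act d(2) n(1)] by (auto simp: ico_fixed_def)
  \<comment> \<open>The converse implication uses the inverse automorphism \<open>k\<close>, which is \<open>S\<^sup>4\<close> for \<open>S\<close> and
    \<open>T\<close> for \<open>T\<close>.\<close>
  have compat: "poly P \<alpha> = 0 \<longleftrightarrow> poly (map_poly h P) \<alpha> = 0"
    if h: "hom_on L h" "h ` L \<subseteq> L" "h (\<alpha> ^ d) = \<alpha> ^ d"
      and k: "hom_on L k" "k ` L \<subseteq> L" "k (\<alpha> ^ d) = \<alpha> ^ d" "\<And>x. x \<in> L \<Longrightarrow> k (h x) = x"
      and P: "P \<in> polys L" for h k P
  proof
    show "poly P \<alpha> = 0 \<Longrightarrow> poly (map_poly h P) \<alpha> = 0"
      using binomial_hom_compat[OF L h(1,2) cL d h(3) min P] by simp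
    assume "poly (map_poly h P) \<alpha> = 0"
    then have "poly (map_poly k (map_poly h P)) \<alpha> = 0"
      using binomial_hom_compat[OF L k(1,2) cL d k(3) min map_poly_polys[OF h(1) L h(2) P]] by simp
    moreover have "map_poly k (map_poly h P) = P"
      using P by (intro poly_eqI) (simp add: coeff_map_poly_hom[OF h(1) L] coeff_map_poly_hom[OF k(1) L] k(4) polys_coeff)
    ultimately show "poly P \<alpha> = 0" by simp
  qed
  have S2: "hom_on L (\<lambda>x. S (S x))" by (rule hom_on_compose[OF S S SL])
  have S4: "hom_on L (\<lambda>x. S (S (S (S x))))" by (rule hom_on_compose[OF S2 S2]) (use SL in blast)
  obtain S' where S': "hom_on (adjoin L \<alpha>) S'" "\<forall>x\<in>L. S' x = S x" "S' \<alpha> = \<alpha>"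
    using hom_on_adjoin_exists[OF L S compat[OF S SL fx(1) S4]] SL fx rel by (auto simp: image_subset_iff)
  obtain T' where T': "hom_on (adjoin L \<alpha>) T'" "\<forall>x\<in>L. T' x = T x" "T' \<alpha> = \<alpha>"
    using hom_on_adjoin_exists[OF L T compat[OF T TL fx(2) T]] TL fx rel by (auto simp: image_subset_iff)
  have SLx: "S x \<in> L" and TLx: "T x \<in> L" if "x \<in> L" for x using that SL TL by auto
  have "ico_action (adjoin L \<alpha>) S' T'"
  proof (rule ico_action_adjoinI[OF L cL])
    show "S' ` L \<subseteq> L" "T' ` L \<subseteq> L" using S' T' SL TL by auto
    show "S' (cst c) = cst c \<and> T' (cst c) = cst c" for c
    proof -
      have "cst c \<in> L" using cL by auto
      then show ?thesis using S'(2) T'(2) const by auto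
    qed
    show "S' (S' (S' (S' (S' x)))) = x \<and> T' (T' x) = x \<and> S' (T' (S' (T' (S' (T' x))))) = x"
      if "x \<in> insert \<alpha> L" for x
      using that S' T' rel SLx TLx by auto
  qed (use S' T' adjoin_self[OF L, of \<alpha>] in auto)
  moreover have "\<alpha> \<in> ico_fixed (adjoin L \<alpha>) S' T'"
    using S' T' adjoin_self[OF L, of \<alpha>] by (simp add: ico_fixed_def)
  moreover have "L \<subseteq> adjoin L \<alpha>" using adjoin_base[OF L] by auto
  ultimately show ?thesis using S' T' by blast
qed

subsection \<open>The action on rational functions\<close>

lemma hom_on_of_nat: "hom_on L h \<Longrightarrow> subfld L \<Longrightarrow> h (of_nat n) = of_nat n"
  by (induction n) (auto simp: hom_on_0 hom_on_1 hom_on_add subfld_1 subfld_of_nat)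

lemma hom_on_numeral: "hom_on L h \<Longrightarrow> subfld L \<Longrightarrow> h (numeral n) = numeral n"
  by (metis hom_on_of_nat of_nat_numeral)

lemma ico_f_in_subfld: "subfld L \<Longrightarrow> u \<in> L \<Longrightarrow> ico_f u 1 \<in> L"
  and ico_H_in_subfld: "subfld L \<Longrightarrow> u \<in> L \<Longrightarrow> ico_H u 1 \<in> L"
  unfolding ico_f_def ico_H_def by (intro subfld_intros; assumption)+

lemma hom_on_ico_J:
  assumes h: "hom_on L h" "subfld L" "u \<in> L"
  shows "h (ico_J u) = ico_J (h u)"
proof -
  note L = subfld_intros[OF h(2)]
  have "h (ico_f u 1) = ico_f (h u) 1" "h (ico_H u 1) = ico_H (h u) 1"
    unfolding ico_f_def ico_H_def
    by (simp_all add: L h(3) hom_on_add[OF h(1)] hom_on_diff[OF h(1,2)] hom_on_mult[OF h(1)]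
        hom_on_power[OF h(1,2)] hom_on_numeral[OF h(1,2)] hom_on_1[OF h(1)])
  then show ?thesis
    unfolding ico_J_def
    by (simp add: hom_on_divide[OF h(1,2)] hom_on_power[OF h(1,2)] L ico_f_in_subfld ico_H_in_subfld h)
qed

lemma ico_f_nonzero:
  assumes u: "u \<notin> range cst" shows "ico_f u 1 \<noteq> 0"
proof
  let ?P = "[:0, -1, 0, 0, 0, 0, 11, 0, 0, 0, 0, 1:] :: complex fls poly"
  assume "ico_f u 1 = 0"
  then have "poly ?P u = 0" by (simp add: ico_f_def algebra_simps power_numeral_reduce)
  moreover have "?P \<in> polys (range cst)"
    by (intro polys_pCons polys_0 subfld_intros subfld_range_cst)
  ultimately have "?P = 0" using transcendental_over_constants[OF u] by blast
  then show False by simp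
qed

text \<open>
  The action on C(u) is determined by the image of \<open>u\<close>. Moebius transformations with explicit coefficients
  reduce the relations between \<open>S\<close> and \<open>T\<close> to products of 2 by 2 matrices.
\<close>

definition mob :: "'a::field \<Rightarrow> 'a \<Rightarrow> 'a \<Rightarrow> 'a \<Rightarrow> 'a \<Rightarrow> 'a" where
  "mob A B C D x = (A * x + B) / (C * x + D)"

lemma hom_on_mob:
  assumes "hom_on L h" "subfld L" "A \<in> L" "B \<in> L" "C \<in> L" "D \<in> L" "x \<in> L"
  shows "h (mob A B C D x) = mob (h A) (h B) (h C) (h D) (h x)"
  using assms unfolding mob_def
  by (simp add: hom_on_divide[of L h] hom_on_add[of L h] hom_on_mult[of L h] subfld_intros[OF assms(2)])

lemma mob_rotate: "mob A B C D (z * x) = mob (A * z) B (C * z) D x"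
  by (simp add: mob_def ac_simps)

lemma mob_flip:
  assumes "1 + g * x \<noteq> 0"
  shows "mob A B C D ((g - x) / (1 + g * x)) = mob (B * g - A) (A * g + B) (D * g - C) (C * g + D) x"
proof -
  have *: "P * ((g - x) / (1 + g * x)) + Q = ((Q * g - P) * x + (P * g + Q)) / (1 + g * x)" for P Q
    using assms by (simp add: divide_simps) (simp add: algebra_simps)
  show ?thesis unfolding mob_def * using assms by simp
qed

text \<open>
  A primitive fifth root of unity \<open>z\<close> and the golden section \<open>g = z + 1/z = (\<surd>5 - 1) / 2\<close>.
\<close>

lemma icosahedral_constants:
  obtains z g :: complex where "g * g = 1 - g" "z * z = g * z - 1" "z ^ 5 = 1" "z \<noteq> 1" "1 + g * g \<noteq> 0"
    "g * g * z + 1 \<noteq> 0"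
proof -
  define g where "g = (csqrt 5 - 1) / 2"
  define z where "z = (g + csqrt (g ^ 2 - 4)) / 2"
  have "csqrt 5 * csqrt 5 = 5" by (metis power2_csqrt power2_eq_square)
  then have g: "g * g = 1 - g" unfolding g_def by (simp add: field_simps)
  have "csqrt (g ^ 2 - 4) ^ 2 = g ^ 2 - 4" by (rule power2_csqrt)
  moreover have "csqrt (g ^ 2 - 4) = 2 * z - g" unfolding z_def by (simp add: field_simps)
  ultimately have "(2 * z - g) ^ 2 = g ^ 2 - 4" by simp
  then have z: "z * z = g * z - 1" by Groebner_Basis.algebra
  have "z ^ 5 = 1" using g z by Groebner_Basis.algebra
  moreover have "z \<noteq> 1"
  proof
    assume "z = 1"
    then have "g = 2" using z by simp
    then show False using g by simp
  qed
  moreover have "1 + g * g \<noteq> 0"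
  proof
    assume "1 + g * g = 0"
    then have "g = 2" using g by (simp add: algebra_simps)
    then show False using g by simp
  qed
  moreover have "g * g * z + 1 \<noteq> 0"
  proof
    assume "g * g * z + 1 = 0"
    then have "g = 2" using g z by Groebner_Basis.algebra
    then show False using g by simp
  qed
  ultimately show ?thesis using that g z by blast
qed

text \<open>
  \<open>S\<close> is the rotation \<open>u \<mapsto> z u\<close> and \<open>T\<close> the involution \<open>u \<mapsto> (g - u) / (1 + g u)\<close>.
  A nonconstant \<open>u\<close> is transcendental over the constants, so it may be sent to any other nonconstant element.
\<close>

lemma ico_action_rational_functions:
  assumes u: "u \<notin> range cst"
  shows "\<exists>L S T. ico_action L S T \<and> u \<in> L \<and> S u \<noteq> u \<and> ico_J u \<in> ico_fixed L S T"
proof -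
  obtain z0 g0 :: complex where z0: "g0 * g0 = 1 - g0" "z0 * z0 = g0 * z0 - 1" "z0 ^ 5 = 1" "z0 \<noteq> 1"
    "1 + g0 * g0 \<noteq> 0" "g0 * g0 * z0 + 1 \<noteq> 0" by (rule icosahedral_constants)
  define z where "z = cst z0"
  define g where "g = cst g0"
  note hc = hom_on_cst
  have g: "g * g = 1 - g" and z: "z * z = g * z - 1" and z5: "z ^ 5 = 1" and z1: "z \<noteq> 1"
    and gg: "1 + g * g \<noteq> 0" and gz: "g * g * z + 1 \<noteq> 0"
  proof -
    have "cst (g0 * g0) = cst (1 - g0)" "cst (z0 * z0) = cst (g0 * z0 - 1)" "cst (z0 ^ 5) = cst 1"
      using z0 by simp_all
    then show "g * g = 1 - g" "z * z = g * z - 1" "z ^ 5 = 1"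
      unfolding g_def z_def by (simp_all flip: fls_minus_const add: fls_const_power)
    have "cst (1 + g0 * g0) \<noteq> 0" "cst (g0 * g0 * z0 + 1) \<noteq> 0" "cst z0 \<noteq> 1" using z0 by auto
    then show "1 + g * g \<noteq> 0" "g * g * z + 1 \<noteq> 0" "z \<noteq> 1"
      unfolding g_def z_def by (simp_all flip: fls_plus_const)
  qed
  note F = subfld_range_cst
  have zF: "z \<in> range cst" and gF: "g \<in> range cst" by (auto simp: z_def g_def)
  have mob_trans: "A * u + B \<noteq> 0" if "A \<in> range cst" "B \<in> range cst" "A \<noteq> 0 \<or> B \<noteq> 0" for A B
  proof
    assume *: "A * u + B = 0"
    show False
    proof (cases "A = 0")
      case False
      then have "u = - B / A" using * by (simp add: field_simps eq_neg_iff_add_eq_0)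
      then show False using that(1,2) u by (metis F subfld_divide subfld_uminus)
    qed (use * that in simp)
  qed
  have u0: "u \<noteq> 0" using u subfld_0[OF F] by auto
  have den: "1 + g * u \<noteq> 0" using mob_trans[OF gF subfld_1[OF F]] by (simp add: add.commute)
  define s where "s = z * u"
  define t where "t = (g - u) / (1 + g * u)"
  have s: "s \<notin> range cst"
  proof
    assume "s \<in> range cst"
    then have "s / z \<in> range cst" using zF F subfld_divide by blast
    moreover have "s / z = u" using z5 by (auto simp: s_def)
    ultimately show False using u by simp
  qed
  have t: "t \<notin> range cst"
  proof
    assume *: "t \<in> range cst"
    have "(1 + t * g) * u + (t - g) = 0" using den unfolding t_def by (simp add: field_simps)
    moreover have "1 + t * g \<in> range cst" "t - g \<in> range cst" using * gF F by (auto intro!: subfld_intros)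
    ultimately have "1 + t * g = 0" "t - g = 0" using mob_trans by blast+
    then show False using gg by simp
  qed
  let ?L = "adjoin (range cst) u"
  note L = subfld_adjoin[OF F, of u]
  have cL: "cst c \<in> ?L" for c by (rule adjoin_base[OF F]) simp
  have uL: "u \<in> ?L" by (rule adjoin_self[OF F])
  have zL: "z \<in> ?L" and gL: "g \<in> ?L" using cL by (auto simp: z_def g_def)
  have ex: "\<exists>h. hom_on ?L h \<and> (\<forall>x\<in>range cst. h x = x) \<and> h u = v" if v: "v \<notin> range cst" for v
  proof (rule hom_on_adjoin_exists[OF F])
    show "hom_on (range cst) (\<lambda>x. x)" by (simp add: hom_on_def)
    show "poly P u = 0 \<longleftrightarrow> poly (map_poly (\<lambda>x. x) P) v = 0" if "P \<in> polys (range cst)" for P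
      using transcendental_over_constants[OF u that] transcendental_over_constants[OF v that] by auto
  qed
  obtain S where S: "hom_on ?L S" "\<And>c. S (cst c) = cst c" "S u = s" using ex[OF s] by blast
  obtain T where T: "hom_on ?L T" "\<And>c. T (cst c) = cst c" "T u = t" using ex[OF t] by blast
  have Sc: "S c = c" and Tc: "T c = c" if "c \<in> range cst" for c using S T that by auto
  have Smob: "S (mob A B C D u) = mob (A * z) B (C * z) D u"
    and Tmob: "T (mob A B C D u) = mob (B * g - A) (A * g + B) (D * g - C) (C * g + D) u"
    if "A \<in> range cst" "B \<in> range cst" "C \<in> range cst" "D \<in> range cst" for A B C D
  proof -
    have ABCD: "A \<in> ?L" "B \<in> ?L" "C \<in> ?L" "D \<in> ?L" using that adjoin_base[OF F] by auto
    show "S (mob A B C D u) = mob (A * z) B (C * z) D u"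
      unfolding hom_on_mob[OF S(1) L ABCD uL] S(3) s_def using that by (simp add: Sc mob_rotate)
    show "T (mob A B C D u) = mob (B * g - A) (A * g + B) (D * g - C) (C * g + D) u"
      unfolding hom_on_mob[OF T(1) L ABCD uL] T(3) t_def using that by (simp add: Tc mob_flip[OF den])
  qed
  have um: "u = mob 1 0 0 1 u" by (simp add: mob_def)
  note I = subfld_intros[OF F] zF gF
  have "S (S (S (S (S u)))) = mob (z * z * z * z * z) 0 0 1 u"
    by (subst um) (simp add: Smob I)
  moreover have "z * z * z * z * z = 1" using z5 by (simp add: eval_nat_numeral mult.assoc)
  ultimately have S5: "S (S (S (S (S u)))) = u" by (simp add: mob_def)
  have "T (T u) = mob (1 + g * g) 0 0 (1 + g * g) u"
    by (subst um) (simp add: Tmob I algebra_simps)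
  then have T2: "T (T u) = u" using gg by (simp add: mob_def flip: distrib_left)
  have U3: "S (T (S (T (S (T u))))) = u"
  proof -
    define A1 where "A1 = g * g + z"
    define B1 where "B1 = g - z * g"
    define C1 where "C1 = g - g * z"
    define D1 where "D1 = g * z * g + 1"
    have "S (T u) = mob (- z) g (g * z) 1 u"
      by (subst um) (simp add: Tmob Smob I)
    then have "T (S (T u)) = mob A1 B1 C1 D1 u"
      by (simp add: Tmob I A1_def B1_def C1_def D1_def)
    moreover have 1: "A1 \<in> range cst" "B1 \<in> range cst" "C1 \<in> range cst" "D1 \<in> range cst"
      unfolding A1_def B1_def C1_def D1_def by (intro I)+
    ultimately have "S (T (S (T (S (T u))))) =
        mob ((B1 * g - A1 * z) * z) (A1 * z * g + B1) ((D1 * g - C1 * z) * z) (C1 * z * g + D1) u"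
      using 1 by (simp add: Smob Tmob I)
    moreover define d where "d = (1 + g * g) * (g * g * z + 1)"
    have "(B1 * g - A1 * z) * z = d" "A1 * z * g + B1 = 0" "(D1 * g - C1 * z) * z = 0" "C1 * z * g + D1 = d"
      unfolding A1_def B1_def C1_def D1_def d_def using g z by Groebner_Basis.algebra+
    moreover have "d \<noteq> 0" using gg gz by (simp add: d_def)
    ultimately show ?thesis by (simp add: mob_def)
  qed
  have act: "ico_action ?L S T"
  proof (rule ico_action_adjoinI[OF F order_refl S(1) _ _ T(1)])
    show "S u \<in> ?L" "T u \<in> ?L"
      using S(3) T(3) subfld_intros[OF L] uL zL gL by (auto simp: s_def t_def)
    show "S (S (S (S (S x)))) = x \<and> T (T x) = x \<and> S (T (S (T (S (T x))))) = x"
      if "x \<in> insert u (range cst)" for x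
    proof (cases "x = u")
      case True
      then show ?thesis using S5 T2 U3 by simp
    next
      case False
      then obtain c where "x = cst c" using \<open>x \<in> insert u (range cst)\<close> by auto
      then show ?thesis by (simp add: S(2) T(2))
    qed
  qed (use S T in auto)
  have J: "ico_J u \<in> ?L"
    unfolding ico_J_def by (intro subfld_divide subfld_power L ico_f_in_subfld ico_H_in_subfld uL)
  have "S (ico_J u) = ico_J u"
    using hom_on_ico_J[OF S(1) L uL] ico_J_rotate[OF z5, of u] by (simp add: S s_def)
  moreover have "T (ico_J u) = ico_J u"
    using hom_on_ico_J[OF T(1) L uL] ico_J_flip[OF g den] ico_f_nonzero[OF u] ico_f_nonzero[OF t]
    by (simp add: T t_def)
  moreover have "S u \<noteq> u" using S(3) z1 u0 by (simp add: s_def)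
  ultimately show ?thesis using act uL J by (auto simp: ico_fixed_def)
qed

section \<open>Germs of holomorphic functions\<close>

text \<open>
  Germs of holomorphic functions are embedded into the field of Laurent series by the Taylor expansion, so
  that quotients of germs are available without discussing poles.
\<close>

definition germ :: "complex \<Rightarrow> (complex \<Rightarrow> complex) \<Rightarrow> complex fls" where
  "germ a f = fps_to_fls (fps_expansion f a)"

lemma germ_eqI: "(\<lambda>x. f (a + x)) has_fps_expansion F \<Longrightarrow> germ a f = fps_to_fls F"
proof -
  assume F: "(\<lambda>x. f (a + x)) has_fps_expansion F"
  have "f analytic_on {a}" using F by (rule has_fps_expansion_imp_analytic)
  then have "(\<lambda>x. f (a + x)) has_fps_expansion fps_expansion f a"
    by (rule analytic_at_imp_has_fps_expansion)
  then show ?thesis using F by (simp add: germ_def fps_expansion_unique_complex)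
qed

lemma germ_expansion: "f analytic_on {a} \<Longrightarrow> \<exists>F. (\<lambda>x. f (a + x)) has_fps_expansion F \<and> germ a f = fps_to_fls F"
  using analytic_at_imp_has_fps_expansion[of f a] by (auto simp: germ_def)

lemma germ_const: "germ a (\<lambda>z. c) = cst c"
  by (subst germ_eqI[OF has_fps_expansion_const]) simp

lemma germ_add:
  assumes "f analytic_on {a}" "g analytic_on {a}"
  shows "germ a (\<lambda>z. f z + g z) = germ a f + germ a g"
proof -
  obtain F G where "(\<lambda>x. f (a + x)) has_fps_expansion F" "germ a f = fps_to_fls F"
    "(\<lambda>x. g (a + x)) has_fps_expansion G" "germ a g = fps_to_fls G"
    using germ_expansion[OF assms(1)] germ_expansion[OF assms(2)] by blast
  then show ?thesis using germ_eqI[of "\<lambda>z. f z + g z" a, OF has_fps_expansion_add] by auto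
qed

lemma germ_diff:
  assumes "f analytic_on {a}" "g analytic_on {a}"
  shows "germ a (\<lambda>z. f z - g z) = germ a f - germ a g"
proof -
  obtain F G where "(\<lambda>x. f (a + x)) has_fps_expansion F" "germ a f = fps_to_fls F"
    "(\<lambda>x. g (a + x)) has_fps_expansion G" "germ a g = fps_to_fls G"
    using germ_expansion[OF assms(1)] germ_expansion[OF assms(2)] by blast
  then show ?thesis using germ_eqI[of "\<lambda>z. f z - g z" a, OF has_fps_expansion_diff] by auto
qed

lemma germ_mult:
  assumes "f analytic_on {a}" "g analytic_on {a}"
  shows "germ a (\<lambda>z. f z * g z) = germ a f * germ a g"
proof -
  obtain F G where "(\<lambda>x. f (a + x)) has_fps_expansion F" "germ a f = fps_to_fls F"
    "(\<lambda>x. g (a + x)) has_fps_expansion G" "germ a g = fps_to_fls G"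
    using germ_expansion[OF assms(1)] germ_expansion[OF assms(2)] by blast
  then show ?thesis using germ_eqI[of "\<lambda>z. f z * g z" a, OF has_fps_expansion_mult] by (auto simp: fls_times_fps_to_fls)
qed

lemma germ_power:
  assumes "f analytic_on {a}" shows "germ a (\<lambda>z. f z ^ n) = germ a f ^ n"
proof (induction n)
  case (Suc n)
  have "germ a (\<lambda>z. f z * f z ^ n) = germ a f * germ a (\<lambda>z. f z ^ n)"
    using assms by (intro germ_mult analytic_intros) auto
  then show ?case using Suc by simp
qed (use germ_const[of a 1] in simp)

lemma germ_eq_iff:
  assumes "f analytic_on {a}" "g analytic_on {a}"
  shows "germ a f = germ a g \<longleftrightarrow> (\<forall>\<^sub>F z in nhds a. f z = g z)"
proof -
  obtain F where F: "(\<lambda>x. f (a + x) - g (a + x)) has_fps_expansion F" "germ a (\<lambda>z. f z - g z) = fps_to_fls F"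
    using germ_expansion[of "\<lambda>z. f z - g z" a] assms by (auto intro: analytic_intros)
  have "germ a f = germ a g \<longleftrightarrow> F = 0" using F(2) germ_diff[OF assms] by auto
  also have "\<dots> \<longleftrightarrow> (\<lambda>x. f (a + x) - g (a + x)) has_fps_expansion 0"
    using F(1) fps_expansion_unique_complex by blast
  also have "\<dots> \<longleftrightarrow> (\<forall>\<^sub>F x in nhds 0. f (a + x) = g (a + x))" by (simp add: has_fps_expansion_0_iff)
  also have "\<dots> \<longleftrightarrow> (\<forall>\<^sub>F z in nhds a. f z = g z)"
  proof -
    have nh: "nhds a = filtermap (\<lambda>x. x + a) (nhds 0)" using filtermap_nhds_shift[of "- a" 0] by simp
    show ?thesis by (simp only: nh eventually_filtermap add.commute)
  qed
  finally show ?thesis .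
qed

lemma germ_divide:
  assumes "f analytic_on {a}" "g analytic_on {a}" "g a \<noteq> 0"
  shows "germ a (\<lambda>z. f z / g z) = germ a f / germ a g" "germ a g \<noteq> 0"
proof -
  have q: "(\<lambda>z. f z / g z) analytic_on {a}" using assms by (intro analytic_intros) auto
  have "isCont g a" using assms(2) analytic_at_imp_isCont by blast
  then have "(g \<longlongrightarrow> g a) (nhds a)" by (simp add: isCont_def tendsto_at_iff_tendsto_nhds)
  then have "\<forall>\<^sub>F z in nhds a. g z \<noteq> 0"
    using assms(3) by (rule tendsto_imp_eventually_ne)
  then have "\<forall>\<^sub>F z in nhds a. f z / g z * g z = f z" by eventually_elim simp
  then have "germ a (\<lambda>z. f z / g z) * germ a g = germ a f"
    using germ_mult[OF q assms(2)] germ_eq_iff[OF analytic_on_mult[OF q assms(2)] assms(1)] by simp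
  moreover show g0: "germ a g \<noteq> 0"
  proof
    assume "germ a g = 0"
    then have "\<forall>\<^sub>F z in nhds a. g z = 0"
      using germ_eq_iff[OF assms(2) analytic_on_const[of 0]] by (simp add: germ_const)
    then show False using assms(3) eventually_nhds_x_imp_x[of "\<lambda>z. g z = 0" a] by simp
  qed
  ultimately show "germ a (\<lambda>z. f z / g z) = germ a f / germ a g" by (simp add: field_simps)
qed

lemma analytic_on_poly_comp: "f analytic_on A \<Longrightarrow> (\<lambda>z. poly p (f z)) analytic_on A"
  by (induction p) (auto intro!: analytic_intros)

lemma germ_poly:
  assumes "f analytic_on {a}" shows "germ a (\<lambda>z. poly p (f z)) = poly (map_poly cst p) (germ a f)"
proof (induction p)
  case (pCons c p)
  have "germ a (\<lambda>z. c + f z * poly p (f z)) = cst c + germ a f * germ a (\<lambda>z. poly p (f z))"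
    using assms analytic_on_poly_comp[OF assms]
    by (subst germ_add, (auto intro!: analytic_intros)[2])
      (subst germ_mult, auto intro!: analytic_intros simp: germ_const)
  then show ?case using pCons.IH by (simp add: map_cst_pCons)
qed (use germ_const[of a 0] in simp)

section \<open>Functions in radicals\<close>

lemma radical_on_holomorphic: "radical_on U f \<Longrightarrow> f holomorphic_on U"
  by (induction rule: radical_on.induct) (auto intro!: holomorphic_intros)

lemma radical_on_cong:
  assumes "radical_on U f" "\<And>z. z \<in> U \<Longrightarrow> g z = f z" shows "radical_on U g"
proof (rule radical_on.root[OF assms(1), of 1])
  show "g holomorphic_on U"
    using radical_on_holomorphic[OF assms(1)] assms(2) by (simp cong: holomorphic_cong)
qed (use assms(2) in auto)

lemma radical_on_const: "radical_on U (\<lambda>z. c)"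
  using radical_on.rational[of U 1 "[:c:]"] by simp

lemma radical_on_ident: "radical_on U (\<lambda>z. z)"
  using radical_on.rational[of U 1 "[:0, 1:]"] by simp

lemma radical_on_power: "radical_on U f \<Longrightarrow> radical_on U (\<lambda>z. f z ^ n)"
  by (induction n) (auto intro: radical_on_const radical_on.mult)

lemma radical_on_uminus: "radical_on U f \<Longrightarrow> radical_on U (\<lambda>z. - f z)"
  using radical_on.diff[OF radical_on_const[of U 0], of f] by simp

lemmas radical_intros = radical_on_const radical_on_ident radical_on_power radical_on_uminus
  radical_on.add radical_on.diff radical_on.mult radical_on.divide

lemma radical_on_poly: "radical_on U g \<Longrightarrow> radical_on U (\<lambda>z. poly p (g z))"
  by (induction p) (auto intro: radical_intros)

lemma radical_on_subset: "radical_on U f \<Longrightarrow> V \<subseteq> U \<Longrightarrow> radical_on V f"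
proof (induction rule: radical_on.induct)
  case (root f n g)
  then show ?case
    using holomorphic_on_subset by (intro radical_on.root[of V f n g]) auto
qed (auto intro: radical_on.intros)

lemma radical_on_compose:
  assumes g: "radical_on U g" "g ` U \<subseteq> V"
  shows "radical_on V f \<Longrightarrow> radical_on U (\<lambda>z. f (g z))"
proof (induction rule: radical_on.induct)
  case (rational q p)
  then show ?case using g by (intro radical_on.divide radical_on_poly) auto
next
  case (root f n h)
  have "(h \<circ> g) holomorphic_on U"
    using radical_on_holomorphic[OF g(1)] root g(2) by (blast intro: holomorphic_on_compose holomorphic_on_subset)
  then show ?case using root g(2) by (intro radical_on.root[OF root.IH root.hyps(2)]) (auto simp: o_def)
qed (use g(2) in \<open>auto intro!: radical_intros\<close>)

subsection \<open>Germs of radical functions are fixed by an extended action\<close>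

definition ico_extends where
  "ico_extends L S T L' S' T' \<longleftrightarrow>
     ico_action L' S' T' \<and> L \<subseteq> L' \<and> (\<forall>x\<in>L. S' x = S x \<and> T' x = T x)"

lemma ico_extends_trans:
  "ico_extends L S T L' S' T' \<Longrightarrow> ico_extends L' S' T' L'' S'' T'' \<Longrightarrow> ico_extends L S T L'' S'' T''"
  by (auto simp: ico_extends_def)

lemma ico_extends_fixed: "ico_extends L S T L' S' T' \<Longrightarrow> ico_fixed L S T \<subseteq> ico_fixed L' S' T'"
  by (auto simp: ico_extends_def ico_fixed_def)

text \<open>
  Induction on the construction of a radical expression. Each root extends the action once more, and
  since extensions keep fixed elements fixed, the actions that the two operands of a field operation need can be
  chosen one after the other. This is why the statement is about an arbitrary action.
\<close>

lemma radical_germ_fixed: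
  assumes U: "open U" "a \<in> U"
  shows "radical_on U f \<Longrightarrow> ico_action L S T \<Longrightarrow> germ a (\<lambda>z. z) \<in> ico_fixed L S T \<Longrightarrow>
    \<exists>L' S' T'. ico_extends L S T L' S' T' \<and> germ a f \<in> ico_fixed L' S' T'"
proof (induction arbitrary: L S T rule: radical_on.induct)
  have an: "f analytic_on {a}" if "radical_on U f" for f
    using radical_on_holomorphic[OF that] U analytic_at by blast
  {
    case (rational q p)
    note F = subfld_ico_fixed[OF rational.prems(1)]
    have poly: "germ a (\<lambda>z. poly r z) \<in> ico_fixed L S T" for r
    proof -
      have "map_poly cst r \<in> polys (ico_fixed L S T)"
        using F(2) by (auto simp: polys_def coeff_map_poly)
      then show ?thesis
        using germ_poly[of "\<lambda>z. z" a r] poly_in_subfld[OF F(1) _ rational.prems(2)] by (simp add: analytic_on_ident)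
    qed
    have "germ a (\<lambda>z. poly p z / poly q z) = germ a (\<lambda>z. poly p z) / germ a (\<lambda>z. poly q z)"
      using rational.hyps U by (intro germ_divide analytic_on_poly_comp analytic_on_ident) auto
    then have "germ a (\<lambda>z. poly p z / poly q z) \<in> ico_fixed L S T"
      using poly subfld_divide[OF F(1)] by simp
    then show ?case using rational.prems(1) by (auto simp: ico_extends_def)
  next
    case (root f n g)
    obtain L1 S1 T1 where 1: "ico_extends L S T L1 S1 T1" "germ a f \<in> ico_fixed L1 S1 T1"
      using root.IH[OF root.prems] by blast
    have g: "g analytic_on {a}" using root.hyps U analytic_at by blast
    have "\<forall>\<^sub>F z in nhds a. g z ^ n = f z"
      using root.hyps(4) U eventually_nhds by blast
    then have "germ a g ^ n = germ a f"
      using germ_eq_iff[of "\<lambda>z. g z ^ n" a f] germ_power[OF g] g an[OF root.hyps(1)]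
      by (simp add: analytic_on_power)
    then have "germ a g ^ n \<in> ico_fixed L1 S1 T1" using 1(2) by simp
    then show ?case
    proof -
      have "ico_action L1 S1 T1" using 1(1) by (simp add: ico_extends_def)
      then obtain L2 S2 T2 where "ico_extends L1 S1 T1 L2 S2 T2" "germ a g \<in> ico_fixed L2 S2 T2"
        using ico_action_extend[OF _ root.hyps(2) \<open>germ a g ^ n \<in> _\<close>] unfolding ico_extends_def by blast
      then show ?thesis using ico_extends_trans[OF 1(1)] by blast
    qed
  }
  have combine: "\<exists>L' S' T'. ico_extends L S T L' S' T' \<and> k \<in> ico_fixed L' S' T'"
    if f: "\<And>L S T. ico_action L S T \<Longrightarrow> germ a (\<lambda>z. z) \<in> ico_fixed L S T \<Longrightarrow>
         \<exists>L' S' T'. ico_extends L S T L' S' T' \<and> germ a f \<in> ico_fixed L' S' T'"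
      and g: "\<And>L S T. ico_action L S T \<Longrightarrow> germ a (\<lambda>z. z) \<in> ico_fixed L S T \<Longrightarrow>
         \<exists>L' S' T'. ico_extends L S T L' S' T' \<and> germ a g \<in> ico_fixed L' S' T'"
      and p: "ico_action L S T" "germ a (\<lambda>z. z) \<in> ico_fixed L S T"
      and k: "\<And>K. subfld K \<Longrightarrow> germ a f \<in> K \<Longrightarrow> germ a g \<in> K \<Longrightarrow> k \<in> K" for f g L S T k
  proof -
    obtain L1 S1 T1 where 1: "ico_extends L S T L1 S1 T1" "germ a f \<in> ico_fixed L1 S1 T1"
      using f[OF p] by blast
    have 11: "ico_action L1 S1 T1" "germ a (\<lambda>z. z) \<in> ico_fixed L1 S1 T1"
      using 1 ico_extends_fixed[OF 1(1)] p by (auto simp: ico_extends_def)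
    obtain L2 S2 T2 where 2: "ico_extends L1 S1 T1 L2 S2 T2" "germ a g \<in> ico_fixed L2 S2 T2"
      using g[OF 11] by blast
    have "subfld (ico_fixed L2 S2 T2)" using 2(1) subfld_ico_fixed(1) by (simp add: ico_extends_def)
    then have "k \<in> ico_fixed L2 S2 T2"
      using k ico_extends_fixed[OF 2(1)] 1(2) 2(2) by blast
    then show ?thesis using ico_extends_trans[OF 1(1) 2(1)] by blast
  qed
  {
    case (add f g)
    show ?case
      unfolding germ_add[OF an an, OF add.hyps]
      by (rule combine[OF add.IH add.prems subfld_add])
  next
    case (diff f g)
    show ?case
      unfolding germ_diff[OF an an, OF diff.hyps]
      by (rule combine[OF diff.IH diff.prems subfld_diff])
  next
    case (mult f g)
    show ?case
      unfolding germ_mult[OF an an, OF mult.hyps]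
      by (rule combine[OF mult.IH mult.prems subfld_mult])
  next
    case (divide f g)
    show ?case
      unfolding germ_divide(1)[OF an an, OF divide.hyps(1,2) divide.hyps(3)[OF U(2)]]
      by (rule combine[OF divide.IH divide.prems subfld_divide])
  }
qed

text \<open>
  Let \<open>v\<close> be the germ of \<open>u\<close>. The icosahedral group acts on C(v) and fixes \<open>J(v)\<close>, so it fixes
  \<open>z + 1/z\<close>. The germ \<open>z\<close> is obtained from this by a square root, so the action extends to one that fixes
  \<open>z\<close>, and again to one that fixes every given radical function. But \<open>v\<close> is moved.
  
  The relation for \<open>J\<close> is used without denominators, and \<open>z + 1/z\<close> is twice the real part on the circle.
\<close>

theorem icosahedral_inverse_not_radical:
  assumes U: "open U" "a \<in> U" "0 \<notin> U" and u: "u analytic_on {a}" "germ a u \<notin> range cst"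
    and \<delta>: "\<delta> \<noteq> 0"
    and J: "\<forall>\<^sub>F z in nhds a. (c + \<delta> * (z + 1 / z)) * ico_f (u z) 1 ^ 5 = ico_H (u z) 1 ^ 3"
    and f: "radical_on U f"
  shows "\<not> (\<forall>\<^sub>F z in nhds a. f z = u z)"
proof
  assume eq: "\<forall>\<^sub>F z in nhds a. f z = u z"
  define Z where "Z = germ a (\<lambda>z. z)"
  define v where "v = germ a u"
  have a0: "a \<noteq> 0" using U by auto
  have an: "f analytic_on {a}" using radical_on_holomorphic[OF f] U analytic_at by blast
  have fv: "germ a f = v" using germ_eq_iff[OF an u(1)] eq by (simp add: v_def)
  have sum: "germ a (\<lambda>z. z + 1 / z) = Z + 1 / Z" and Z0: "Z \<noteq> 0"
  proof -
    have "germ a (\<lambda>z. 1 / z) = germ a (\<lambda>z. 1) / Z" "Z \<noteq> 0"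
      using germ_divide[of "\<lambda>z. 1" a "\<lambda>z. z"] a0 by (simp_all add: Z_def analytic_on_ident)
    then show "germ a (\<lambda>z. z + 1 / z) = Z + 1 / Z" "Z \<noteq> 0"
    proof -
      assume 1: "germ a (\<lambda>z. 1 / z) = germ a (\<lambda>z. 1) / Z" and 2: "Z \<noteq> 0"
      have "(\<lambda>z. 1 / z) analytic_on {a}" using a0 by (intro analytic_on_divide analytic_on_const analytic_on_ident) auto
      then show "germ a (\<lambda>z. z + 1 / z) = Z + 1 / Z"
        using germ_add[of "\<lambda>z. z" a "\<lambda>z. 1 / z"] 1 by (simp add: germ_const Z_def analytic_on_ident)
    qed
  qed
  have gf: "germ a (\<lambda>z. ico_f (u z) 1) = ico_f v 1" and gH: "germ a (\<lambda>z. ico_H (u z) 1) = ico_H v 1"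
    and af: "(\<lambda>z. ico_f (u z) 1) analytic_on {a}" and aH: "(\<lambda>z. ico_H (u z) 1) analytic_on {a}"
  proof -
    show "(\<lambda>z. ico_f (u z) 1) analytic_on {a}" "(\<lambda>z. ico_H (u z) 1) analytic_on {a}"
      unfolding ico_f_def ico_H_def using u(1) by (auto intro!: analytic_intros)
    let ?P = "[:0, -1, 0, 0, 0, 0, 11, 0, 0, 0, 0, 1:] :: complex poly"
    have "ico_f x 1 = poly ?P x" for x by (simp add: ico_f_def algebra_simps power_numeral_reduce)
    moreover have "ico_f y 1 = poly (map_poly cst ?P) y" for y
      by (simp add: ico_f_def algebra_simps power_numeral_reduce map_cst_pCons)
    ultimately show "germ a (\<lambda>z. ico_f (u z) 1) = ico_f v 1" using germ_poly[OF u(1), of ?P] by (simp add: v_def)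
    let ?Q = "[:1, 0, 0, 0, 0, 228, 0, 0, 0, 0, 494, 0, 0, 0, 0, -228, 0, 0, 0, 0, 1:] :: complex poly"
    have "ico_H x 1 = poly ?Q x" for x by (simp add: ico_H_def algebra_simps power_numeral_reduce power2_eq_square)
    moreover have "ico_H y 1 = poly (map_poly cst ?Q) y" for y
      by (simp add: ico_H_def algebra_simps power_numeral_reduce map_cst_pCons power2_eq_square)
    ultimately show "germ a (\<lambda>z. ico_H (u z) 1) = ico_H v 1" using germ_poly[OF u(1), of ?Q] by (simp add: v_def)
  qed
  have s: "(\<lambda>z. z + 1 / z) analytic_on {a}" using a0 by (auto intro!: analytic_intros)
  have cs: "(\<lambda>z. \<delta> * (z + 1 / z)) analytic_on {a}" "(\<lambda>z. c + \<delta> * (z + 1 / z)) analytic_on {a}"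
    using s by (auto intro!: analytic_on_mult analytic_on_add analytic_on_const)
  have "germ a (\<lambda>z. c + \<delta> * (z + 1 / z)) = cst c + cst \<delta> * (Z + 1 / Z)"
    using germ_add[OF analytic_on_const cs(1)] germ_mult[OF analytic_on_const s] sum
    by (simp add: germ_const)
  moreover have "germ a (\<lambda>z. (c + \<delta> * (z + 1 / z)) * ico_f (u z) 1 ^ 5) = germ a (\<lambda>z. ico_H (u z) 1 ^ 3)"
    using J by (subst germ_eq_iff) (intro analytic_on_mult analytic_on_power cs af aH)+
  ultimately have "(cst c + cst \<delta> * (Z + 1 / Z)) * ico_f v 1 ^ 5 = ico_H v 1 ^ 3"
    using germ_mult[OF cs(2) analytic_on_power[OF af]] germ_power[OF af] germ_power[OF aH] gf gH by simp
  then have Jv: "ico_J v = cst c + cst \<delta> * (Z + 1 / Z)"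
    using ico_f_nonzero[of v] u(2) unfolding ico_J_def v_def by (simp add: field_simps)
  obtain L S T where act: "ico_action L S T" "v \<in> L" "S v \<noteq> v" "ico_J v \<in> ico_fixed L S T"
    using ico_action_rational_functions[of v] u(2) by (auto simp: v_def)
  \<comment> \<open>Half of \<open>z + 1/z\<close>, so that \<open>(z - h)\<^sup>2 = h\<^sup>2 - 1\<close> completes the square.\<close>
  define h where "h = (ico_J v - cst c) / cst \<delta> / 2"
  note Fx = subfld_ico_fixed[OF act(1)]
  have h: "h \<in> ico_fixed L S T"
    unfolding h_def using Fx act(4) by (intro subfld_divide subfld_diff subfld_numeral) auto
  have hZ: "2 * h = Z + 1 / Z" unfolding h_def Jv using \<delta> by simp
  have "(Z - h) ^ 2 = h ^ 2 - 1"
  proof -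
    have "Z * (2 * h) = Z ^ 2 + 1" unfolding hZ using Z0 by (simp add: field_simps power2_eq_square)
    then show ?thesis by Groebner_Basis.algebra
  qed
  then have "(Z - h) ^ 2 \<in> ico_fixed L S T" using h Fx by (auto intro!: subfld_diff subfld_power subfld_1)
  then obtain L1 S1 T1 where 1: "ico_extends L S T L1 S1 T1" "Z - h \<in> ico_fixed L1 S1 T1"
    using ico_action_extend[OF act(1), of 2 "Z - h"] unfolding ico_extends_def by auto
  have "ico_action L1 S1 T1" using 1 by (simp add: ico_extends_def)
  moreover have "Z \<in> ico_fixed L1 S1 T1"
    using subfld_add[OF subfld_ico_fixed(1)[OF \<open>ico_action L1 S1 T1\<close>] 1(2), of h] h ico_extends_fixed[OF 1(1)] by auto
  ultimately obtain L2 S2 T2 where 2: "ico_extends L1 S1 T1 L2 S2 T2" "v \<in> ico_fixed L2 S2 T2"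
    using radical_germ_fixed[OF U(1,2) f] fv unfolding Z_def by metis
  have "S2 v = S v" using ico_extends_trans[OF 1(1) 2(1)] act(2) by (auto simp: ico_extends_def)
  then show False using 2(2) act(3) by (simp add: ico_fixed_def)
qed

section \<open>The group of radical diffeomorphisms\<close>

lemma radical_map_cong:
  assumes "\<And>z. z \<in> unit_circle \<Longrightarrow> \<sigma> z = \<tau> z" "radical_map \<sigma>" shows "radical_map \<tau>"
proof -
  have "algebraic_map \<tau>" using assms algebraic_map_cong by (metis radical_map_def)
  moreover obtain E where "finite E" "\<And>a. a \<in> unit_circle - E \<Longrightarrow>
      \<exists>r>0. \<exists>f. radical_on (ball a r) f \<and> (\<forall>z\<in>unit_circle \<inter> ball a r. \<sigma> z = f z)"
    using assms(2) unfolding radical_map_def by blast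
  ultimately show ?thesis unfolding radical_map_def using assms(1) by (metis IntD1)
qed

lemma radical_map_id: "radical_map (\<lambda>z. z)"
  unfolding radical_map_def
  by (intro conjI algebraic_map_id exI[of _ "{}"]) (auto intro!: exI[of _ 1] exI[of _ "\<lambda>z. z"] radical_on_ident)

lemma radical_map_compose:
  assumes \<tau>: "\<tau> \<in> Bij unit_circle" and rad: "radical_map \<sigma>" "radical_map \<tau>"
  shows "radical_map (\<lambda>z. \<sigma> (\<tau> z))"
  unfolding radical_map_def
proof (intro conjI)
  show "algebraic_map (\<lambda>z. \<sigma> (\<tau> z))"
    using algebraic_map_compose[OF \<tau>] rad by (simp add: radical_map_def)
  obtain E where E: "finite E" "\<And>a. a \<in> unit_circle - E \<Longrightarrow>
      \<exists>r>0. \<exists>f. radical_on (ball a r) f \<and> (\<forall>z\<in>unit_circle \<inter> ball a r. \<sigma> z = f z)"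
    using rad(1) unfolding radical_map_def by blast
  obtain E' where E': "finite E'" "\<And>a. a \<in> unit_circle - E' \<Longrightarrow>
      \<exists>r>0. \<exists>f. radical_on (ball a r) f \<and> (\<forall>z\<in>unit_circle \<inter> ball a r. \<tau> z = f z)"
    using rad(2) unfolding radical_map_def by blast
  define B where "B = {z\<in>unit_circle. \<tau> z \<in> E}"
  have "inj_on \<tau> B" using \<tau> by (auto simp: Bij_def bij_betw_def B_def intro: inj_on_subset)
  moreover have "finite (\<tau> ` B)" by (rule finite_subset[OF _ E(1)]) (auto simp: B_def)
  ultimately have B: "finite B" by (rule finite_imageD[rotated])
  show "\<exists>E. finite E \<and> (\<forall>a\<in>unit_circle - E. \<exists>r>0. \<exists>f. radical_on (ball a r) f \<and>
      (\<forall>z\<in>unit_circle \<inter> ball a r. \<sigma> (\<tau> z) = f z))"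
  proof (intro exI[of _ "E' \<union> B"] conjI ballI)
    fix a assume a: "a \<in> unit_circle - (E' \<union> B)"
    then obtain r g where g: "r > 0" "radical_on (ball a r) g" "\<And>z. z \<in> unit_circle \<inter> ball a r \<Longrightarrow> \<tau> z = g z"
      using E'(2) by blast
    have ga: "\<tau> a = g a" using g a by simp
    have "\<tau> a \<in> unit_circle - E" using a Bij_unit_circle(1)[OF \<tau>] by (simp add: B_def)
    then obtain r' f where f: "r' > 0" "radical_on (ball (\<tau> a) r') f" "\<And>z. z \<in> unit_circle \<inter> ball (\<tau> a) r' \<Longrightarrow> \<sigma> z = f z"
      using E(2) by blast
    have "continuous_on (ball a r) g" using radical_on_holomorphic[OF g(2)] holomorphic_on_imp_continuous_on by blast
    then have "open (ball a r \<inter> g -` ball (\<tau> a) r')" by (rule continuous_open_preimage) auto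
    moreover have "a \<in> ball a r \<inter> g -` ball (\<tau> a) r'" using g f ga by simp
    ultimately obtain e where e: "e > 0" "ball a e \<subseteq> ball a r \<inter> g -` ball (\<tau> a) r'" using open_contains_ball by blast
    show "\<exists>r>0. \<exists>f. radical_on (ball a r) f \<and> (\<forall>z\<in>unit_circle \<inter> ball a r. \<sigma> (\<tau> z) = f z)"
    proof (intro exI[of _ e] exI[of _ "\<lambda>z. f (g z)"] conjI ballI e(1))
      show "radical_on (ball a e) (\<lambda>z. f (g z))"
        by (rule radical_on_compose[OF radical_on_subset[OF g(2)] _ f(2)]) (use e in auto)
      fix z assume z: "z \<in> unit_circle \<inter> ball a e"
      then have "z \<in> ball a r" "g z \<in> ball (\<tau> a) r'" using e(2) by blast+
      then show "\<sigma> (\<tau> z) = f (g z)" using g(3)[of z] f(3)[of "g z"] z Bij_unit_circle(1)[OF \<tau>, of z] by auto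
    qed
  qed (use E' B in auto)
qed

theorem subgroup_radical_diffeos: "subgroup radical_diffeos (BijGroup unit_circle)"
  unfolding radical_diffeos_def
proof (rule subgroup_two_sided[where P = radical_map, OF _ subgroup_circle_diffeos radical_map_id])
  show "radical_map (\<lambda>z. \<sigma> (\<tau> z))"
    if "\<sigma> \<in> circle_diffeos" "\<tau> \<in> circle_diffeos" "radical_map \<sigma>" "radical_map \<tau>" for \<sigma> \<tau>
    using that radical_map_compose[of \<tau> \<sigma>] circle_homeos_Bij by (auto simp: circle_diffeos_def)
qed (rule radical_map_cong)

lemma radical_on_Phi:
  assumes n: "0 < n" and V: "V \<subseteq> Phi_domain n w"
  shows "radical_on V (Phi n w)"
proof -
  note D = Phi_domainD[OF subsetD[OF V]]
  have A: "radical_on V (\<lambda>z. (1 + cnj w * inverse (z ^ n)) powr (1 / of_nat n))"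
  proof (rule radical_on.root[of V "\<lambda>z. 1 + cnj w * (1 / z ^ n)" n])
    show "radical_on V (\<lambda>z. 1 + cnj w * (1 / z ^ n))"
      using D(1) by (intro radical_intros) auto
    show "(\<lambda>z. (1 + cnj w * inverse (z ^ n)) powr (1 / of_nat n)) holomorphic_on V"
      by (intro holomorphic_intros) (simp_all add: D)
    show "((1 + cnj w * inverse (z ^ n)) powr (1 / of_nat n)) ^ n = 1 + cnj w * (1 / z ^ n)" if "z \<in> V" for z
      unfolding powr_root[OF n D(4)[OF that]] by (simp add: inverse_eq_divide)
  qed (rule n)
  have B: "radical_on V (\<lambda>z. (1 + w * z ^ n) powr (1 / of_nat n))"
  proof (rule radical_on.root[of V "\<lambda>z. 1 + w * z ^ n" n])
    show "radical_on V (\<lambda>z. 1 + w * z ^ n)" by (intro radical_intros)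
    show "(\<lambda>z. (1 + w * z ^ n) powr (1 / of_nat n)) holomorphic_on V"
      by (intro holomorphic_intros) (simp_all add: D)
    show "((1 + w * z ^ n) powr (1 / of_nat n)) ^ n = 1 + w * z ^ n" if "z \<in> V" for z
      by (rule powr_root[OF n D(5)[OF that]])
  qed (rule n)
  show ?thesis unfolding Phi_def[abs_def]
    by (rule radical_on.divide[OF radical_on.mult[OF radical_on_ident A] B]) (use D(5) in auto)
qed

lemma phi_algebraic:
  assumes n: "0 < n" and w: "norm w < 1" shows "algebraic_map (phi n w)"
proof (rule algebraic_mapI)
  show "bipoly (\<lambda>z v. v ^ n * (1 + w * z ^ n) - (z ^ n + cnj w))" by (intro bipoly_intros)
  have "norm (cnj w) < norm ((2 :: complex) ^ n)"
  proof -
    have "norm ((2 :: complex) ^ n) = 2 ^ n" by (simp add: norm_power)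
    moreover have "norm (cnj w) = norm w" by simp
    ultimately show ?thesis using w one_le_power[of "2 :: real" n] by linarith
  qed
  then have "(2 :: complex) ^ n \<noteq> cnj w" by (metis less_irrefl)
  then show "2 ^ n * (1 + w * 0 ^ n) - (0 ^ n + cnj w) \<noteq> 0" using n by (simp add: power_0_left)
  show "phi n w z ^ n * (1 + w * z ^ n) - (z ^ n + cnj w) = 0" if z: "z \<in> unit_circle" for z
    using Phi_power[OF n unit_circle_Phi_domain[OF w z]] Phi_domainD(5)[OF unit_circle_Phi_domain[OF w z, of n]]
    by (simp add: phi_eq_Phi[OF z])
qed

lemma phi_radical_map:
  assumes n: "0 < n" and w: "norm w < 1" shows "radical_map (phi n w)"
  unfolding radical_map_def
proof (intro conjI phi_algebraic assms exI[of _ "{}"] ballI)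
  fix a assume "a \<in> unit_circle - {}"
  then have "a \<in> Phi_domain n w" using unit_circle_Phi_domain[OF w] by simp
  then obtain r where "r > 0" "ball a r \<subseteq> Phi_domain n w" using open_Phi_domain open_contains_ball by blast
  then show "\<exists>r>0. \<exists>f. radical_on (ball a r) f \<and> (\<forall>z\<in>unit_circle \<inter> ball a r. phi n w z = f z)"
    using radical_on_Phi[OF n] phi_eq_Phi by blast
qed simp

theorem finite_type_subset_radical: "finite_type_diffeos \<subseteq> radical_diffeos"
  unfolding finite_type_diffeos_def
proof (rule group.generate_subgroup_incl[OF group_BijGroup _ subgroup_radical_diffeos])
  show "{phi n w |n w. 1 \<le> n \<and> norm w < 1} \<subseteq> radical_diffeos"
  proof
  fix \<sigma> assume "\<sigma> \<in> {phi n w |n w. 1 \<le> n \<and> norm w < 1}"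
  then obtain n w where \<sigma>: "\<sigma> = phi n w" and n: "1 \<le> n" and w: "norm (w :: complex) < 1" by blast
  then have n0: "0 < n" and w': "norm (- w) < 1" by simp_all
  have "radical_map (inv_into unit_circle (phi n w))"
    by (rule radical_map_cong[OF _ phi_radical_map[OF n0 w']]) (simp add: phi_Bij(2)[OF n0 w])
  then show "\<sigma> \<in> radical_diffeos"
    using phi_diffeo[OF n0 w] phi_radical_map[OF n0 w] by (simp add: radical_diffeos_def \<sigma>)
  qed
qed

theorem radical_subset_AlgDiff: "radical_diffeos \<subseteq> AlgDiff"
  by (auto simp: radical_diffeos_def AlgDiff_def radical_map_def)

section \<open>Cubic equations are solvable in radicals\<close>

text \<open>
  The cube of the Lagrange resolvent of three numbers is a polynomial in the symmetric functions and
  in the product of the differences.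
\<close>

lemma lagrange_resolvents:
  fixes x y z \<omega> :: "'a::field"
  assumes \<omega>: "\<omega> * \<omega> + \<omega> + 1 = 0"
  shows "2 * (x + \<omega> * y + \<omega> * \<omega> * z) ^ 3 =
      2 * (x + y + z) ^ 3 - 9 * (x + y + z) * (x * y + y * z + z * x) + 27 * (x * y * z)
      + 3 * (2 * \<omega> + 1) * ((x - y) * (x - z) * (y - z))"
  using \<omega> by Groebner_Basis.algebra

text \<open>
  Given one holomorphic root \<open>g\<close>, the other two are \<open>g2\<close> and \<open>g3\<close>, the roots of a quadratic polynomial
  with discriminant \<open>\<Delta>\<close>; the square root \<open>s\<close> of \<open>\<Delta>\<close> is holomorphic because the ball is
  contractible and \<open>\<Delta>\<close> divides the nonvanishing discriminant \<open>D\<close> of the cubic. The product of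
  the differences of the roots is \<open>s q\<close>, a square root of \<open>D\<close>, where \<open>q\<close> is the derivative of the cubic at
  \<open>g\<close>. So the cubes of both resolvents are radical functions, and \<open>g\<close> is a third of the sum
  of the resolvents and of \<open>- p2\<close>.
\<close>

lemma radical_on_cubic:
  assumes U: "U = ball a r"
    and p: "radical_on U p0" "radical_on U p1" "radical_on U p2"
    and g: "g holomorphic_on U" "\<And>z. z \<in> U \<Longrightarrow> g z ^ 3 + p2 z * g z ^ 2 + p1 z * g z + p0 z = 0"
    and disc: "\<And>z. z \<in> U \<Longrightarrow> p2 z ^ 2 * p1 z ^ 2 - 4 * p1 z ^ 3 - 4 * p2 z ^ 3 * p0 z + 18 * p2 z * p1 z * p0 z - 27 * p0 z ^ 2 \<noteq> 0"
  shows "radical_on U g"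
proof -
  define \<Delta> where "\<Delta> z = (p2 z + g z) ^ 2 - 4 * (g z ^ 2 + p2 z * g z + p1 z)" for z
  define q where "q z = 3 * g z ^ 2 + 2 * p2 z * g z + p1 z" for z
  define D where "D z = p2 z ^ 2 * p1 z ^ 2 - 4 * p1 z ^ 3 - 4 * p2 z ^ 3 * p0 z + 18 * p2 z * p1 z * p0 z - 27 * p0 z ^ 2" for z
  have Dq: "D z = \<Delta> z * q z ^ 2" if "z \<in> U" for z
    unfolding D_def \<Delta>_def q_def using g(2)[OF that] by Groebner_Basis.algebra
  have hol: "p0 holomorphic_on U" "p1 holomorphic_on U" "p2 holomorphic_on U"
    using p radical_on_holomorphic by blast+
  have \<Delta>: "\<Delta> holomorphic_on U" unfolding \<Delta>_def by (intro holomorphic_intros hol g(1))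
  have \<Delta>0: "\<Delta> z \<noteq> 0" if "z \<in> U" for z using Dq[OF that] disc[OF that] unfolding D_def[symmetric] by auto
  obtain s where s: "s holomorphic_on U" "\<And>z. z \<in> U \<Longrightarrow> \<Delta> z = s z ^ 2"
  proof (rule contractible_imp_holomorphic_sqrt[OF \<Delta> _ \<Delta>0])
    show "contractible U" unfolding U by (rule convex_imp_contractible[OF convex_ball])
  qed (assumption, rule that)
  have RD: "radical_on U D" unfolding D_def by (intro radical_intros p)
  have "radical_on U (\<lambda>z. s z * q z)"
  proof (rule radical_on.root[OF RD, of 2])
    show "(\<lambda>z. s z * q z) holomorphic_on U" unfolding q_def by (intro holomorphic_intros hol g(1) s(1))
    show "(s z * q z) ^ 2 = D z" if "z \<in> U" for z using Dq[OF that] s(2)[OF that] by (simp add: power_mult_distrib)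
  qed simp
  note \<delta> = this
  define g2 where "g2 z = (- (p2 z + g z) + s z) / 2" for z
  define g3 where "g3 z = (- (p2 z + g z) - s z) / 2" for z
  have hg: "g2 holomorphic_on U" "g3 holomorphic_on U"
    unfolding g2_def g3_def by (intro holomorphic_intros hol g(1) s(1); simp)+
  have sums: "g z + g2 z + g3 z = - p2 z" "g2 z - g3 z = s z" for z
    unfolding g2_def g3_def by (simp_all add: field_simps)
  have vieta: "g z * g2 z + g2 z * g3 z + g3 z * g z = p1 z" "g z * g2 z * g3 z = - p0 z"
    and q23: "(g z - g2 z) * (g z - g3 z) = q z" if z: "z \<in> U" for z
  proof -
    have 1: "g2 z + g3 z = - (p2 z + g z)" unfolding g2_def g3_def by (simp add: field_simps)
    have "4 * (g2 z * g3 z) = (p2 z + g z) ^ 2 - s z ^ 2" unfolding g2_def g3_def by (simp add: field_simps power2_eq_square)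
    then have "4 * (g2 z * g3 z) = 4 * (g z ^ 2 + p2 z * g z + p1 z)" unfolding s(2)[OF z, symmetric] \<Delta>_def by simp
    then have 2: "g2 z * g3 z = g z ^ 2 + p2 z * g z + p1 z" unfolding mult_cancel_left by simp
    show "g z * g2 z + g2 z * g3 z + g3 z * g z = p1 z" using 1 2 by Groebner_Basis.algebra
    show "g z * g2 z * g3 z = - p0 z" using 2 g(2)[OF z] by Groebner_Basis.algebra
    show "(g z - g2 z) * (g z - g3 z) = q z" unfolding q_def using 1 2 by Groebner_Basis.algebra
  qed
  define \<omega> where "\<omega> = (csqrt (- 3) - 1) / 2"
  have "csqrt (- 3) ^ 2 = - 3" by (rule power2_csqrt)
  moreover have "csqrt (- 3) = 2 * \<omega> + 1" by (simp add: \<omega>_def field_simps)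
  ultimately have w1: "\<omega> * \<omega> + \<omega> + 1 = 0" by Groebner_Basis.algebra
  define \<omega>' where "\<omega>' = - \<omega> - 1"
  have w2: "\<omega>' * \<omega>' + \<omega>' + 1 = 0" and ww: "\<omega>' = \<omega> * \<omega>" using w1 unfolding \<omega>'_def by Groebner_Basis.algebra+
  have res: "radical_on U (\<lambda>z. g z + \<zeta> * g2 z + \<zeta> * \<zeta> * g3 z)" if \<zeta>: "\<zeta> * \<zeta> + \<zeta> + 1 = 0" for \<zeta>
  proof (rule radical_on.root[of U "\<lambda>z. (2 * (- p2 z) ^ 3 - 9 * (- p2 z) * p1 z + 27 * (- p0 z) + 3 * (2 * \<zeta> + 1) * (s z * q z)) / 2" 3])
    show "radical_on U (\<lambda>z. (2 * (- p2 z) ^ 3 - 9 * (- p2 z) * p1 z + 27 * (- p0 z) + 3 * (2 * \<zeta> + 1) * (s z * q z)) / 2)"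
      by (intro radical_intros p \<delta>) simp
    show "(\<lambda>z. g z + \<zeta> * g2 z + \<zeta> * \<zeta> * g3 z) holomorphic_on U" by (intro holomorphic_intros hg g(1))
    fix z assume z: "z \<in> U"
    have "(g z - g2 z) * (g z - g3 z) * (g2 z - g3 z) = s z * q z" using q23[OF z] sums(2)[of z] by simp
    then show "(g z + \<zeta> * g2 z + \<zeta> * \<zeta> * g3 z) ^ 3 = (2 * (- p2 z) ^ 3 - 9 * (- p2 z) * p1 z + 27 * (- p0 z) + 3 * (2 * \<zeta> + 1) * (s z * q z)) / 2"
      using lagrange_resolvents[OF \<zeta>, of "g z" "g2 z" "g3 z"] unfolding sums(1) vieta(1)[OF z] vieta(2)[OF z]
      by (simp add: field_simps)
  qed simp
  have "radical_on U (\<lambda>z. (- p2 z + (g z + \<omega> * g2 z + \<omega> * \<omega> * g3 z) + (g z + \<omega>' * g2 z + \<omega>' * \<omega>' * g3 z)) / 3)"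
    by (intro radical_on.divide radical_on.add radical_on_uminus p radical_on_const res w1 w2) simp
  then show ?thesis
  proof (rule radical_on_cong)
    fix z
    have "3 * g z = - p2 z + (g z + \<omega> * g2 z + \<omega> * \<omega> * g3 z) + (g z + \<omega>' * g2 z + \<omega>' * \<omega>' * g3 z)"
      using sums(1)[of z] w1 w2 ww by Groebner_Basis.algebra
    then show "g z = (- p2 z + (g z + \<omega> * g2 z + \<omega> * \<omega> * g3 z) + (g z + \<omega>' * g2 z + \<omega>' * \<omega>' * g3 z)) / 3" by simp
  qed
qed

section \<open>Algebraic homeomorphisms that are not smooth\<close>

lemma twist_relation:
  assumes "z \<in> unit_circle"
  shows "twist h z - z = \<i> * of_real (h z) * (twist h z + z)" "twist h z + z \<noteq> 0"
proof -
  have nz: "1 - \<i> * of_real (h z) \<noteq> 0" by (rule one_minus_i_real_nonzero)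
  have t: "twist h z * (1 - \<i> * of_real (h z)) = z * (1 + \<i> * of_real (h z))"
    using assms nz by (simp add: twist_def)
  then show "twist h z - z = \<i> * of_real (h z) * (twist h z + z)" by (simp add: algebra_simps)
  have "(twist h z + z) * (1 - \<i> * of_real (h z)) = 2 * z" using t by (simp add: algebra_simps)
  moreover have "z \<noteq> 0" using assms by auto
  ultimately show "twist h z + z \<noteq> 0" by auto
qed

lemma unit_circle_Re_Im:
  assumes "z \<in> unit_circle"
  shows "2 * z * of_real (Re z) = z ^ 2 + 1" "2 * \<i> * z * of_real (Im z) = z ^ 2 - 1"
proof -
  have z: "z * cnj z = 1" using assms complex_norm_square[of z] by simp
  have "2 * of_real (Re z) = z + cnj z" "2 * \<i> * of_real (Im z) = z - cnj z" by (simp_all add: complex_eq_iff)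
  then show "2 * z * of_real (Re z) = z ^ 2 + 1" "2 * \<i> * z * of_real (Im z) = z ^ 2 - 1"
    using z by Groebner_Basis.algebra+
qed

lemma real_lipschitz_from_deriv:
  fixes f :: "real \<Rightarrow> real"
  assumes d: "\<And>x. (f has_real_derivative f' x) (at x)" "\<And>x. \<bar>f' x\<bar> \<le> 1"
  shows "\<bar>f x - f y\<bar> \<le> \<bar>x - y\<bar>"
proof -
  have "norm (f x - f y) \<le> 1 * norm (x - y)"
    by (rule field_differentiable_bound[of UNIV f f']) (use d in auto)
  then show ?thesis by simp
qed

lemma sin_lipschitz: "\<bar>sin x - sin y\<bar> \<le> \<bar>x - y :: real\<bar>"
  by (rule real_lipschitz_from_deriv[of sin cos]) (auto intro!: derivative_eq_intros)

lemma arctan_lipschitz: "\<bar>arctan x - arctan y\<bar> \<le> \<bar>x - y\<bar>"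
proof (rule real_lipschitz_from_deriv)
  show "(arctan has_real_derivative inverse (1 + x\<^sup>2)) (at x)" for x by (rule DERIV_arctan)
  show "\<bar>inverse (1 + x\<^sup>2)\<bar> \<le> 1" for x :: real
    by (simp add: inverse_le_1_iff)
qed

definition kink :: "complex \<Rightarrow> real" where "kink z = \<bar>Im z\<bar> / 4"

lemma kink_homeo: "twist kink \<in> circle_homeos"
proof (rule twist_homeo)
  show "continuous_on unit_circle kink" unfolding kink_def by (intro continuous_intros) auto
  show "strict_mono (\<lambda>t. t + 2 * arctan (kink (cis t)))"
  proof (rule strict_monoI)
    fix a b :: real assume ab: "a < b"
    have "\<bar>arctan (\<bar>sin a\<bar> / 4) - arctan (\<bar>sin b\<bar> / 4)\<bar> \<le> \<bar>\<bar>sin a\<bar> / 4 - \<bar>sin b\<bar> / 4\<bar>" by (rule arctan_lipschitz)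
    also have "\<dots> \<le> \<bar>sin a - sin b\<bar> / 4"
      using abs_triangle_ineq3[of "sin a" "sin b"] by (simp add: diff_divide_distrib[symmetric])
    also have "\<dots> \<le> \<bar>a - b\<bar> / 4" using sin_lipschitz[of a b] by simp
    finally have "\<bar>arctan (\<bar>sin a\<bar> / 4) - arctan (\<bar>sin b\<bar> / 4)\<bar> \<le> \<bar>a - b\<bar> / 4" .
    then have "a + 2 * arctan (\<bar>sin a\<bar> / 4) < b + 2 * arctan (\<bar>sin b\<bar> / 4)" using ab by argo
    then show "a + 2 * arctan (kink (cis a)) < b + 2 * arctan (kink (cis b))" by (simp add: kink_def)
  qed
qed

text \<open>
  Squaring removes the absolute value.
\<close>

lemma kink_algebraic: "algebraic_map (twist kink)"
proof (rule algebraic_mapI)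
  show "bipoly (\<lambda>z w. (z ^ 2 - 1) ^ 2 * (w + z) ^ 2 - 64 * z ^ 2 * (w - z) ^ 2)" by (intro bipoly_intros)
  show "(0 ^ 2 - 1) ^ 2 * (1 + 0) ^ 2 - 64 * 0 ^ 2 * (1 - 0) ^ 2 \<noteq> (0 :: complex)" by simp
  fix z :: complex assume z: "z \<in> unit_circle"
  define k where "k = complex_of_real (kink z)"
  define y where "y = complex_of_real (Im z)"
  have "16 * kink z ^ 2 = Im z ^ 2" by (simp add: kink_def power_divide)
  then have "16 * k ^ 2 = y ^ 2" unfolding k_def y_def by (metis of_real_mult of_real_numeral of_real_power)
  moreover have "2 * \<i> * z * y = z ^ 2 - 1" using unit_circle_Re_Im(2)[OF z] by (simp add: y_def)
  moreover have "twist kink z - z = \<i> * k * (twist kink z + z)" using twist_relation(1)[OF z] by (simp add: k_def)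
  moreover have "\<i> * \<i> = -1" by simp
  ultimately show "(z ^ 2 - 1) ^ 2 * (twist kink z + z) ^ 2 - 64 * z ^ 2 * (twist kink z - z) ^ 2 = 0"
    by Groebner_Basis.algebra
qed

text \<open>
  A derivative of \<open>|sin|\<close> at \<open>0\<close> would be both \<open>1\<close> and \<open>- 1\<close>, as \<open>|sin| - sin\<close> and
  \<open>|sin| + sin\<close> have minima there.
\<close>

lemma kink_not_smooth: "\<not> circle_smooth (twist kink)"
proof
  assume sm: "circle_smooth (twist kink)"
  define F where "F t = t + 2 * arctan (kink (cis t))" for t
  have "continuous_on UNIV F" unfolding F_def kink_def by (intro continuous_intros) auto
  then have "smooth F" using circle_smooth_lift[of F "twist kink"] sm twist_cis by (simp add: F_def)
  then obtain F' where F': "\<And>t. (F has_vector_derivative F' t) (at t)" by (rule smoothD) (rule that)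
  have dF: "(F has_real_derivative F' 0) (at 0)" using F' by (simp add: has_real_derivative_iff_has_vector_derivative)
  \<comment> \<open>The kink is recovered from the lift by a smooth operation.\<close>
  have G: "\<bar>sin t\<bar> = 4 * tan ((F t - t) / 2)" for t by (simp add: F_def kink_def tan_arctan)
  have "((\<lambda>t. 4 * tan ((F t - t) / 2)) has_real_derivative 2 * (F' 0 - 1)) (at 0)"
    by (rule derivative_eq_intros dF refl | simp add: F_def kink_def)+
  then have d: "((\<lambda>t. \<bar>sin t :: real\<bar>) has_real_derivative 2 * (F' 0 - 1)) (at 0)" unfolding G .
  have 1: "((\<lambda>t. \<bar>sin t :: real\<bar> - sin t) has_real_derivative 2 * (F' 0 - 1) - 1) (at 0)"
    by (rule derivative_eq_intros d refl | simp)+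
  have 2: "((\<lambda>t. \<bar>sin t :: real\<bar> + sin t) has_real_derivative 2 * (F' 0 - 1) + 1) (at 0)"
    by (rule derivative_eq_intros d refl | simp)+
  have "2 * (F' 0 - 1) - 1 = 0" by (rule DERIV_local_min[OF 1 zero_less_one]) auto
  moreover have "2 * (F' 0 - 1) + 1 = 0"
    by (rule DERIV_local_min[OF 2 zero_less_one]) (auto simp: abs_if)
  ultimately show False by simp
qed

theorem AlgDiff_psubset_AlgHomeo: "AlgDiff \<subset> AlgHomeo"
proof
  show "AlgDiff \<subseteq> AlgHomeo" by (auto simp: AlgDiff_def AlgHomeo_def circle_diffeos_def)
  have "twist kink \<in> AlgHomeo" using kink_homeo kink_algebraic by (simp add: AlgHomeo_def)
  moreover have "twist kink \<notin> AlgDiff" using kink_not_smooth by (simp add: AlgDiff_def circle_diffeos_def)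
  ultimately show "AlgDiff \<noteq> AlgHomeo" by blast
qed

section \<open>An algebraic diffeomorphism that is not radical\<close>

lemma unit_circle_islimpt:
  assumes "a \<in> unit_circle" "open U" "a \<in> U" shows "a islimpt (unit_circle \<inter> U)"
proof (rule islimpt_Int_eventually)
  show "a islimpt unit_circle"
  proof (rule connected_imp_perfect[OF connected_sphere assms(1)])
    show "unit_circle \<noteq> {x}" for x
    proof
      assume "unit_circle = {x}"
      moreover have "(1 :: complex) \<in> unit_circle" "- 1 \<in> unit_circle" by simp_all
      ultimately show False by (metis one_neq_neg_one singletonD)
    qed
  qed simp
  show "\<forall>\<^sub>F y in at a. y \<in> U" using assms(2,3) eventually_at_topological by blast
qed

lemma ico_of_real:
  "complex_of_real (ico_f x 1) = ico_f (of_real x) 1" "complex_of_real (ico_H x 1) = ico_H (of_real x) 1"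
  "complex_of_real (ico_J x) = ico_J (of_real x)"
  by (simp_all add: ico_f_def ico_H_def ico_J_def)

lemma ico_J_holomorphic: "ico_J holomorphic_on {u. ico_f u 1 \<noteq> 0}"
  unfolding ico_J_def ico_H_def ico_f_def by (intro holomorphic_intros) auto

lemma ico_J_deriv_nonzero: "deriv ico_J (1 :: complex) \<noteq> 0"
proof -
  let ?P = "[:0, -1, 0, 0, 0, 0, 11, 0, 0, 0, 0, 1:] :: complex poly"
  let ?Q = "[:1, 0, 0, 0, 0, 228, 0, 0, 0, 0, 494, 0, 0, 0, 0, -228, 0, 0, 0, 0, 1:] :: complex poly"
  have f: "ico_f x 1 = poly ?P x" for x by (simp add: ico_f_def algebra_simps power_numeral_reduce)
  have H: "ico_H x 1 = poly ?Q x" for x by (simp add: ico_H_def algebra_simps power_numeral_reduce power2_eq_square)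
  have "((\<lambda>x. poly ?Q x ^ 3 / poly ?P x ^ 5) has_field_derivative
      (3 * (poly (pderiv ?Q) 1 * poly ?Q 1 ^ 2) * poly ?P 1 ^ 5 - poly ?Q 1 ^ 3 * (5 * (poly (pderiv ?P) 1 * poly ?P 1 ^ 4))) /
      (poly ?P 1 ^ 5 * poly ?P 1 ^ 5)) (at 1)"
    by (rule derivative_eq_intros poly_DERIV refl | simp)+
  then have "deriv (\<lambda>x. poly ?Q x ^ 3 / poly ?P x ^ 5) 1 =
      (3 * (poly (pderiv ?Q) 1 * poly ?Q 1 ^ 2) * poly ?P 1 ^ 5 - poly ?Q 1 ^ 3 * (5 * (poly (pderiv ?P) 1 * poly ?P 1 ^ 4))) /
      (poly ?P 1 ^ 5 * poly ?P 1 ^ 5)" by (rule DERIV_imp_deriv)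
  moreover have "ico_J = (\<lambda>x. poly ?Q x ^ 3 / poly ?P x ^ 5)" by (rule ext) (simp only: ico_J_def f H)
  ultimately show ?thesis by (simp add: pderiv_pCons)
qed

text \<open>
  The point \<open>1\<close> is neither a pole nor a critical point of \<open>J\<close>. The local inverse is real on the real
  line because \<open>J\<close> maps a real interval around \<open>1\<close> onto a real interval around \<open>J(1)\<close>.
\<close>

lemma ico_J_local_inverse:
  obtains g t0 \<delta> where "\<delta> > 0" "g holomorphic_on ball (complex_of_real t0) (2 * \<delta>)"
    "\<And>t. t \<in> ball (of_real t0) (2 * \<delta>) \<Longrightarrow> ico_f (g t) 1 \<noteq> 0 \<and> ico_J (g t) = t"
    "\<And>t. \<bar>t - t0\<bar> \<le> \<delta> \<Longrightarrow> g (complex_of_real t) \<in> \<real>"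
proof -
  let ?S = "{u :: complex. ico_f u 1 \<noteq> 0}"
  have "open ?S" unfolding ico_f_def by (intro open_Collect_neq continuous_intros)
  moreover have "1 \<in> ?S" by (simp add: ico_f_def)
  ultimately obtain \<rho> where \<rho>: "\<rho> > 0" "ball 1 \<rho> \<subseteq> ?S" "open (ico_J ` ball (1 :: complex) \<rho>)" "inj_on ico_J (ball (1 :: complex) \<rho>)"
    using has_complex_derivative_locally_invertible[OF ico_J_holomorphic _ _ ico_J_deriv_nonzero] by metis
  let ?B = "ball (1 :: complex) \<rho>"
  have hol: "ico_J holomorphic_on ?B" by (rule holomorphic_on_subset[OF ico_J_holomorphic \<rho>(2)])
  obtain g where g: "g holomorphic_on ico_J ` ?B" "\<And>z. z \<in> ?B \<Longrightarrow> g (ico_J z) = z"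
    using holomorphic_has_inverse[OF hol open_ball \<rho>(4)] by metis
  define t0 where "t0 = ico_J (1 :: real)"
  define a b where "a = 1 - \<rho> / 2" and "b = 1 + \<rho> / 2"
  have ab: "a < 1" "1 < b" using \<rho>(1) by (simp_all add: a_def b_def)
  have inB: "complex_of_real x \<in> ?B" if "x \<in> {a..b}" for x
  proof -
    have "dist 1 (complex_of_real x) = \<bar>1 - x\<bar>" by (metis dist_norm norm_of_real of_real_1 of_real_diff)
    then show ?thesis using that \<rho>(1) by (simp add: a_def b_def abs_if)
  qed
  have f0: "ico_f x 1 \<noteq> 0" if "x \<in> {a..b}" for x :: real
    using \<rho>(2) inB[OF that] ico_of_real(1)[of x] by auto
  have cont: "continuous_on {a..b} (ico_J :: real \<Rightarrow> real)"
    unfolding ico_J_def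
  proof (rule continuous_on_divide)
    show "continuous_on {a..b} (\<lambda>x. ico_H x 1 ^ 3)" unfolding ico_H_def by (intro continuous_intros)
    show "continuous_on {a..b} (\<lambda>x. ico_f x 1 ^ 5)" unfolding ico_f_def by (intro continuous_intros)
  qed (use f0 in simp)
  have inj: "inj_on (ico_J :: real \<Rightarrow> real) {a..b}"
  proof (rule inj_onI)
    fix x y assume "x \<in> {a..b}" "y \<in> {a..b}" "ico_J x = ico_J y"
    then have "complex_of_real x = complex_of_real y"
      using inj_onD[OF \<rho>(4) _ inB inB] ico_of_real(3) by metis
    then show "x = y" by simp
  qed
  have "ico_J a < t0 \<and> t0 < ico_J b \<or> ico_J b < t0 \<and> t0 < ico_J a"
    unfolding t0_def by (rule continuous_inj_imp_mono[OF ab cont inj])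
  then have lohi: "min (ico_J a) (ico_J b) < t0" "t0 < max (ico_J a) (ico_J b)" by auto
  have onto: "\<exists>x\<in>{a..b}. ico_J x = t" if "min (ico_J a) (ico_J b) \<le> t" "t \<le> max (ico_J a) (ico_J b)" for t
  proof (cases "ico_J a \<le> ico_J b")
    case True
    then show ?thesis using IVT'[of ico_J a t b] cont that ab by auto
  next
    case False
    then show ?thesis using IVT2'[of ico_J b t a] cont that ab by auto
  qed
  have "of_real t0 = ico_J (complex_of_real 1)" unfolding t0_def by (rule ico_of_real(3))
  then have "of_real t0 \<in> ico_J ` ?B" using \<rho>(1) by auto
  then obtain e where e: "e > 0" "ball (of_real t0) e \<subseteq> ico_J ` ?B" using \<rho>(3) open_contains_ball by blast
  define \<delta> where "\<delta> = min (e / 2) (min (t0 - min (ico_J a) (ico_J b)) (max (ico_J a) (ico_J b) - t0))"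
  have \<delta>: "\<delta> > 0" using e(1) lohi by (simp add: \<delta>_def)
  have "\<delta> \<le> e / 2" unfolding \<delta>_def by (rule min.cobounded1)
  then have "2 * \<delta> \<le> e" by simp
  then have sub: "ball (of_real t0) (2 * \<delta>) \<subseteq> ico_J ` ?B" using e(2) subset_ball by blast
  show ?thesis
  proof (rule that[OF \<delta>])
    show "g holomorphic_on ball (of_real t0) (2 * \<delta>)" by (rule holomorphic_on_subset[OF g(1) sub])
    fix t assume "t \<in> ball (complex_of_real t0) (2 * \<delta>)"
    then obtain z where "z \<in> ?B" "t = ico_J z" using sub by blast
    then show "ico_f (g t) 1 \<noteq> 0 \<and> ico_J (g t) = t" using g(2) \<rho>(2) by auto
  next
    fix t assume "\<bar>t - t0\<bar> \<le> \<delta>"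
    then have "min (ico_J a) (ico_J b) \<le> t" "t \<le> max (ico_J a) (ico_J b)" by (auto simp: \<delta>_def)
    then obtain x where "x \<in> {a..b}" "ico_J x = t" using onto by blast
    then have "g (of_real t) = of_real x" using g(2)[OF inB] ico_of_real(3)[of x] by simp
    then show "g (of_real t) \<in> \<real>" by simp
  qed
qed

text \<open>
  If \<open>v\<close> were constant, then \<open>z + 1/z\<close> would be constant near \<open>a\<close>, which leaves at most two values for \<open>z\<close>.
\<close>

lemma germ_not_constant:
  assumes v: "v analytic_on {a}" and \<delta>: "\<delta> \<noteq> 0" "a \<noteq> 0"
    and J: "\<forall>\<^sub>F z in nhds a. J (v z) = c + \<delta> * (z + 1 / z)"
  shows "germ a v \<notin> range cst"
proof
  assume "germ a v \<in> range cst"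
  then obtain k where "germ a v = cst k" by blast
  then have "germ a v = germ a (\<lambda>z. k)" by (simp add: germ_const)
  then have k: "\<forall>\<^sub>F z in nhds a. v z = k" using germ_eq_iff[OF v analytic_on_const] by simp
  have "\<forall>\<^sub>F z in nhds a. z \<noteq> 0" using \<delta>(2) by (intro t1_space_nhds) auto
  with k J have "\<forall>\<^sub>F z in nhds a. z ^ 2 - ((J k - c) / \<delta>) * z + 1 = 0"
  proof eventually_elim
    case (elim z)
    then have "(J k - c) / \<delta> = z + 1 / z" using \<delta> by (simp add: field_simps)
    then show ?case using elim(3) by (simp add: field_simps power2_eq_square)
  qed
  then obtain e where e: "e > 0" "\<And>z. dist z a < e \<Longrightarrow> poly [:1, - ((J k - c) / \<delta>), 1:] z = 0"
    unfolding eventually_nhds_metric by (auto simp: algebra_simps power2_eq_square)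
  have "finite {z. poly [:1, - ((J k - c) / \<delta>), 1:] z = 0}" by (rule poly_roots_finite) simp
  moreover have "ball a e \<subseteq> {z. poly [:1, - ((J k - c) / \<delta>), 1:] z = 0}" using e(2) by (auto simp: dist_commute)
  moreover have "infinite (ball a e)" using e(1) by (simp add: uncountable_ball uncountable_infinite)
  ultimately show False using finite_subset by blast
qed

text \<open>
  The twist by \<open>h(z) = \<epsilon> g(t\<^sub>0 + \<delta> Re z)\<close>. On the circle \<open>2 Re z = z + 1/z\<close>, and \<open>g(t\<^sub>0 + \<delta> Re z)\<close>
  is \<open>(\<sigma> z - z) / (k (\<sigma> z + z))\<close> with \<open>k = \<i> \<epsilon>\<close>. So the equation \<open>J(g(t)) = t\<close> is an
  algebraic relation between \<open>z\<close> and \<open>\<sigma> z\<close>, and a radical expression for \<open>\<sigma>\<close> would give one for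
  \<open>g(t\<^sub>0 + \<delta>/2 (z + 1/z))\<close>.
\<close>

theorem exists_nonradical_AlgDiff: "\<exists>\<sigma>\<in>AlgDiff. \<not> radical_map \<sigma>"
proof -
  obtain g t0 \<delta> where \<delta>: "\<delta> > 0" and g: "g holomorphic_on ball (complex_of_real t0) (2 * \<delta>)"
    and J: "\<And>t. t \<in> ball (of_real t0) (2 * \<delta>) \<Longrightarrow> ico_f (g t) 1 \<noteq> 0 \<and> ico_J (g t) = t"
    and re: "\<And>t. \<bar>t - t0\<bar> \<le> \<delta> \<Longrightarrow> g (complex_of_real t) \<in> \<real>"
    by (rule ico_J_local_inverse) (rule that)
  let ?W = "ball (complex_of_real t0) (2 * \<delta>)"
  define \<tau> where "\<tau> x = complex_of_real (t0 + \<delta> * x)" for x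
  have \<tau>W: "\<tau> x \<in> ?W" and \<tau>R: "g (\<tau> x) \<in> \<real>" and \<tau>C: "\<tau> x \<in> cball (of_real t0) \<delta>" if "\<bar>x\<bar> \<le> 1" for x
  proof -
    have "\<bar>\<delta> * x\<bar> \<le> \<delta>" using that \<delta> by (simp add: abs_mult mult_left_le)
    moreover have "dist (of_real t0) (\<tau> x) = \<bar>\<delta> * x\<bar>"
      unfolding \<tau>_def dist_norm by (metis abs_minus_commute add_diff_cancel_left' norm_of_real of_real_diff)
    ultimately show "\<tau> x \<in> ?W" "\<tau> x \<in> cball (of_real t0) \<delta>" using \<delta> by simp_all
    show "g (\<tau> x) \<in> \<real>" unfolding \<tau>_def by (rule re) (use \<open>\<bar>\<delta> * x\<bar> \<le> \<delta>\<close> in simp)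
  qed
  define c where "c t = \<tau> (cos t)" for t
  have cW: "c t \<in> ?W" and cR: "g (c t) \<in> \<real>" and cC: "c t \<in> cball (of_real t0) \<delta>" for t
    unfolding c_def using \<tau>W \<tau>R \<tau>C abs_cos_le_one by blast+
  have dg: "(g has_field_derivative deriv g t) (at t)" if "t \<in> ?W" for t
    by (rule holomorphic_derivI[OF g open_ball that])
  have dc: "(c has_vector_derivative of_real (- (\<delta> * sin t))) (at t)" for t
  proof -
    have "((\<lambda>t. t0 + \<delta> * cos t) has_real_derivative - (\<delta> * sin t)) (at t)"
      by (auto intro!: derivative_eq_intros)
    then show ?thesis unfolding c_def[abs_def] \<tau>_def by (rule has_vector_derivative_of_real)
  qed
  have "continuous_on (cball (of_real t0) \<delta>) (deriv g)"
    by (rule continuous_on_subset[OF holomorphic_on_imp_continuous_on[OF holomorphic_deriv[OF g open_ball]]])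
      (use \<delta> in \<open>auto simp: subset_eq\<close>)
  then have "bounded (deriv g ` cball (of_real t0) \<delta>)"
    by (intro compact_imp_bounded compact_continuous_image compact_cball)
  then obtain M where M: "M > 0" "\<And>t. t \<in> cball (of_real t0) \<delta> \<Longrightarrow> norm (deriv g t) \<le> M"
    unfolding bounded_pos by blast
  \<comment> \<open>With this \<open>\<epsilon>\<close> the derivative of \<open>h\<close> in the angle is at most \<open>\<epsilon> \<delta> M = 1/4\<close>.\<close>
  define \<epsilon> where "\<epsilon> = 1 / (4 * (M * \<delta>))"
  have \<epsilon>: "\<epsilon> > 0" using M \<delta> by (simp add: \<epsilon>_def)
  define h where "h z = \<epsilon> * Re (g (\<tau> (Re z)))" for z
  have hc: "h (cis t) = \<epsilon> * Re (g (c t))" for t by (simp add: h_def c_def)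
  have dgc: "((\<lambda>t. g (c t)) has_vector_derivative of_real (- (\<delta> * sin t)) * deriv g (c t)) (at t)" for t
    using field_vector_diff_chain_at[OF dc dg[OF cW]] by (simp only: o_def)
  have dh: "((\<lambda>t. h (cis t)) has_real_derivative \<epsilon> * Re (of_real (- (\<delta> * sin t)) * deriv g (c t))) (at t)" for t
    unfolding hc has_real_derivative_iff_has_vector_derivative
    using bounded_linear.has_vector_derivative[OF bounded_linear_mult_right bounded_linear.has_vector_derivative[OF bounded_linear_Re dgc]] .
  have small: "\<bar>\<epsilon> * Re (of_real (- (\<delta> * sin t)) * deriv g (c t))\<bar> < 1 / 2" for t
  proof -
    have "\<bar>Re (of_real (- (\<delta> * sin t)) * deriv g (c t))\<bar> \<le> norm (of_real (- (\<delta> * sin t)) * deriv g (c t))"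
      by (rule abs_Re_le_cmod)
    also have "\<dots> = \<delta> * \<bar>sin t\<bar> * norm (deriv g (c t))" using \<delta> by (simp add: norm_mult abs_mult)
    also have "\<dots> \<le> \<delta> * 1 * M" using \<delta> M(1) M(2)[OF cC] by (intro mult_mono) auto
    finally have "\<epsilon> * \<bar>Re (of_real (- (\<delta> * sin t)) * deriv g (c t))\<bar> \<le> \<epsilon> * (M * \<delta>)"
      using \<epsilon> by (simp add: mult.commute)
    also have "\<dots> = 1 / 4" using M \<delta> by (simp add: \<epsilon>_def)
    finally show ?thesis using \<epsilon> by (simp add: abs_mult)
  qed
  have cont: "continuous_on unit_circle h"
  proof -
    have "continuous_on unit_circle (\<lambda>z. g (\<tau> (Re z)))"
    proof (rule continuous_on_compose2[OF holomorphic_on_imp_continuous_on[OF g]])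
      show "continuous_on unit_circle (\<lambda>z. \<tau> (Re z))" unfolding \<tau>_def by (intro continuous_intros)
      show "(\<lambda>z. \<tau> (Re z)) ` unit_circle \<subseteq> ?W"
      proof (rule image_subsetI)
        fix z :: complex assume "z \<in> unit_circle"
        then have "\<bar>Re z\<bar> \<le> 1" using abs_Re_le_cmod[of z] by simp
        then show "\<tau> (Re z) \<in> ?W" by (rule \<tau>W)
      qed
    qed
    then show ?thesis unfolding h_def by (intro continuous_intros)
  qed
  have sm: "smooth (\<lambda>t. h (cis t))"
  proof -
    have "smooth (\<lambda>t. Re (cis t))" by (rule smooth_bounded_linear[OF bounded_linear_Re smooth_cis])
    then have "smooth (\<lambda>t. t0 + \<delta> * cos t)"
      using smooth_add[OF smooth_const smooth_mult[OF smooth_const]] by simp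
    then have "smooth c" unfolding c_def[abs_def] \<tau>_def by (rule smooth_of_real)
    then have "smooth (\<lambda>t. g (c t))" by (rule smooth_holomorphic[OF open_ball cW g])
    then show ?thesis unfolding hc
      by (intro smooth_mult[OF smooth_const] smooth_bounded_linear[OF bounded_linear_Re])
  qed
  define \<sigma> where "\<sigma> = twist h"
  have diff: "\<sigma> \<in> circle_diffeos" unfolding \<sigma>_def by (rule twist_diffeo[OF cont sm dh small])
  define k where "k = \<i> * complex_of_real \<epsilon>"
  have k0: "k \<noteq> 0" using \<epsilon> by (simp add: k_def)
  have rel: "\<sigma> z + z \<noteq> 0" "g (\<tau> (Re z)) = (\<sigma> z - z) / (k * (\<sigma> z + z))" "\<tau> (Re z) \<in> ?W"
    "\<tau> (Re z) = of_real t0 + of_real \<delta> / 2 * (z + 1 / z)" if z: "z \<in> unit_circle" for z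
  proof -
    have "\<bar>Re z\<bar> \<le> 1" using z abs_Re_le_cmod[of z] by simp
    note R = \<tau>W[OF this] \<tau>R[OF this]
    show "\<tau> (Re z) \<in> ?W" by (rule R)
    show s: "\<sigma> z + z \<noteq> 0" using twist_relation(2)[OF z] by (simp add: \<sigma>_def)
    have "complex_of_real (h z) = of_real \<epsilon> * g (\<tau> (Re z))" using R(2) by (simp add: h_def of_real_Re)
    then have "\<sigma> z - z = k * g (\<tau> (Re z)) * (\<sigma> z + z)"
      using twist_relation(1)[OF z, of h] by (simp add: \<sigma>_def k_def)
    then show "g (\<tau> (Re z)) = (\<sigma> z - z) / (k * (\<sigma> z + z))" using s k0 by simp
    have z0: "z \<noteq> 0" using z by auto
    have "2 * of_real (Re z) = z + 1 / z" using unit_circle_Re_Im(1)[OF z] z0 by (simp add: field_simps power2_eq_square)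
    then show "\<tau> (Re z) = of_real t0 + of_real \<delta> / 2 * (z + 1 / z)" by (simp add: \<tau>_def flip: \<open>_ = z + 1 / z\<close>)
  qed
  have alg: "algebraic_map \<sigma>"
  proof (rule algebraic_mapI)
    show "bipoly (\<lambda>z w. 2 * z * ico_H (w - z) (k * (w + z)) ^ 3 -
        (2 * z * of_real t0 + of_real \<delta> * (z ^ 2 + 1)) * ico_f (w - z) (k * (w + z)) ^ 5)"
      unfolding ico_H_def ico_f_def by (intro bipoly_intros)
    \<comment> \<open>At \<open>z = w = 1\<close> only the term with \<open>ico_H 0 (2 k) = (2 k)\<^sup>2\<^sup>0\<close> survives.\<close>
    show "2 * 1 * ico_H (1 - 1) (k * (1 + 1)) ^ 3 -
        (2 * 1 * of_real t0 + of_real \<delta> * (1 ^ 2 + 1)) * ico_f (1 - 1) (k * (1 + 1)) ^ 5 \<noteq> 0"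
      using k0 by (simp add: ico_H_def ico_f_def)
    fix z :: complex assume z: "z \<in> unit_circle"
    define A where "A = \<sigma> z - z"
    define B where "B = k * (\<sigma> z + z)"
    define v where "v = g (\<tau> (Re z))"
    have B0: "B \<noteq> 0" using rel(1)[OF z] k0 by (simp add: B_def)
    have v: "v = A / B" using rel(2)[OF z] by (simp add: v_def A_def B_def)
    have z0: "z \<noteq> 0" using z by auto
    have "ico_f v 1 \<noteq> 0" "ico_J v = \<tau> (Re z)" using J[OF rel(3)[OF z]] by (simp_all add: v_def)
    then have "ico_H v 1 ^ 3 = \<tau> (Re z) * ico_f v 1 ^ 5" by (simp add: ico_J_def field_simps)
    moreover have "ico_f A B = B ^ 12 * ico_f v 1" "ico_H A B = B ^ 20 * ico_H v 1"
      using ico_form_scale[of B v 1] B0 by (simp_all add: v)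
    ultimately have 1: "ico_H A B ^ 3 = \<tau> (Re z) * ico_f A B ^ 5"
      by (simp add: power_mult_distrib flip: power_mult)
    have "2 * z * \<tau> (Re z) = 2 * z * of_real t0 + of_real \<delta> * (z ^ 2 + 1)"
      unfolding rel(4)[OF z] using z0 by (simp add: field_simps power2_eq_square)
    then show "2 * z * ico_H (\<sigma> z - z) (k * (\<sigma> z + z)) ^ 3 -
        (2 * z * of_real t0 + of_real \<delta> * (z ^ 2 + 1)) * ico_f (\<sigma> z - z) (k * (\<sigma> z + z)) ^ 5 = 0"
      using 1 unfolding A_def[symmetric] B_def[symmetric] by (metis mult.assoc right_minus_eq)
  qed
  have "\<not> radical_map \<sigma>"
  proof
    assume "radical_map \<sigma>"
    then obtain E where E: "finite E" "\<And>a. a \<in> unit_circle - E \<Longrightarrow>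
        \<exists>r>0. \<exists>f. radical_on (ball a r) f \<and> (\<forall>z\<in>unit_circle \<inter> ball a r. \<sigma> z = f z)"
      unfolding radical_map_def by blast
    have "infinite unit_circle"
      using unit_circle_islimpt[of 1 UNIV] islimpt_finite by auto
    then obtain a where a: "a \<in> unit_circle - E" using E(1) by (metis Diff_eq_empty_iff ex_in_conv finite_subset)
    then obtain r f where f: "r > 0" "radical_on (ball a r) f" "\<And>z. z \<in> unit_circle \<inter> ball a r \<Longrightarrow> \<sigma> z = f z"
      using E(2) by blast
    have a0: "a \<noteq> 0" and aC: "a \<in> unit_circle" using a by auto
    define s where "s z = of_real t0 + of_real \<delta> / 2 * (z + 1 / z)" for z :: complex
    have s_hol: "s holomorphic_on - {0}" unfolding s_def by (intro holomorphic_intros) auto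
    have f_hol: "f holomorphic_on ball a r" by (rule radical_on_holomorphic[OF f(2)])
    have "open (ball a r \<inter> (\<lambda>z. f z + z) -` (- {0}))"
      by (rule continuous_open_preimage[OF holomorphic_on_imp_continuous_on[OF holomorphic_on_add[OF f_hol holomorphic_on_ident]]]) auto
    moreover have "open (- {0} \<inter> s -` ?W)"
      by (rule continuous_open_preimage) (auto intro!: holomorphic_on_imp_continuous_on s_hol)
    ultimately have "open ((ball a r \<inter> (\<lambda>z. f z + z) -` (- {0})) \<inter> (- {0} \<inter> s -` ?W))" by (rule open_Int)
    moreover have "a \<in> (ball a r \<inter> (\<lambda>z. f z + z) -` (- {0})) \<inter> (- {0} \<inter> s -` ?W)"
      using f(1) f(3)[of a] aC a0 rel(1,3,4)[OF aC] by (simp add: s_def)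
    ultimately obtain e where e: "e > 0" "ball a e \<subseteq> (ball a r \<inter> (\<lambda>z. f z + z) -` (- {0})) \<inter> (- {0} \<inter> s -` ?W)"
      using open_contains_ball by blast
    define U where "U = ball a e"
    have U: "U \<subseteq> ball a r" "\<And>z. z \<in> U \<Longrightarrow> f z + z \<noteq> 0" "\<And>z. z \<in> U \<Longrightarrow> z \<noteq> 0" "\<And>z. z \<in> U \<Longrightarrow> s z \<in> ?W"
      and aU: "open U" "a \<in> U" using e by (auto simp: U_def)
    have v_hol: "(\<lambda>z. g (s z)) holomorphic_on U"
    proof -
      have "s holomorphic_on U" by (rule holomorphic_on_subset[OF s_hol]) (use U(3) in blast)
      then have "(g \<circ> s) holomorphic_on U"
        by (rule holomorphic_on_compose_gen[OF _ g]) (use U(4) in blast)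
      then show ?thesis by (simp only: o_def)
    qed
    have rad: "radical_on U (\<lambda>z. (f z - z) / (k * (f z + z)))"
      using k0 U(2) by (intro radical_intros radical_on_subset[OF f(2) U(1)]) auto
    \<comment> \<open>The equation on the arc extends to a neighbourhood by the identity theorem.\<close>
    have eq: "(f z - z) / (k * (f z + z)) - g (s z) = 0" if "z \<in> U" for z
    proof (rule analytic_continuation[of "\<lambda>z. (f z - z) / (k * (f z + z)) - g (s z)" U "unit_circle \<inter> U" a])
      show "(\<lambda>z. (f z - z) / (k * (f z + z)) - g (s z)) holomorphic_on U"
        by (intro holomorphic_on_diff radical_on_holomorphic[OF rad] v_hol)
      show "a islimpt unit_circle \<inter> U" by (rule unit_circle_islimpt[OF aC aU])
      show "(f z - z) / (k * (f z + z)) - g (s z) = 0" if z: "z \<in> unit_circle \<inter> U" for z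
      proof -
        have zc: "z \<in> unit_circle" and "f z = \<sigma> z" using z U(1) f(3)[of z] by auto
        then show ?thesis using rel(2,4)[OF zc] by (simp add: s_def)
      qed
    qed (use aU that in \<open>auto simp: U_def\<close>)
    have v_an: "(\<lambda>z. g (s z)) analytic_on {a}" using v_hol aU analytic_at by blast
    have inU: "\<forall>\<^sub>F z in nhds a. z \<in> U" using aU eventually_nhds by blast
    have Js: "\<forall>\<^sub>F z in nhds a. ico_J (g (s z)) = of_real t0 + of_real \<delta> / 2 * (z + 1 / z)"
      using inU by eventually_elim (use J U(4) in \<open>simp add: s_def\<close>)
    have Jf: "\<forall>\<^sub>F z in nhds a. (of_real t0 + of_real \<delta> / 2 * (z + 1 / z)) * ico_f (g (s z)) 1 ^ 5 = ico_H (g (s z)) 1 ^ 3"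
      using inU
    proof eventually_elim
      case (elim z)
      have "ico_f (g (s z)) 1 \<noteq> 0" "ico_J (g (s z)) = s z" using J[OF U(4)[OF elim]] by auto
      then have "s z * ico_f (g (s z)) 1 ^ 5 = ico_H (g (s z)) 1 ^ 3" by (simp add: ico_J_def field_simps)
      then show ?case by (simp only: s_def)
    qed
    have \<delta>2: "complex_of_real \<delta> / 2 \<noteq> 0" using \<delta> by simp
    have "\<not> (\<forall>\<^sub>F z in nhds a. (f z - z) / (k * (f z + z)) = g (s z))"
      by (rule icosahedral_inverse_not_radical[OF aU _ v_an germ_not_constant[OF v_an \<delta>2 a0 Js] \<delta>2 Jf rad])
        (use U(3) in blast)
    moreover have "\<forall>\<^sub>F z in nhds a. (f z - z) / (k * (f z + z)) = g (s z)"
      using inU by eventually_elim (use eq in simp)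
    ultimately show False by blast
  qed
  then show ?thesis using diff alg by (auto simp: AlgDiff_def)
qed

theorem radical_psubset_AlgDiff: "radical_diffeos \<subset> AlgDiff"
  using radical_subset_AlgDiff exists_nonradical_AlgDiff by (auto simp: radical_diffeos_def)

section \<open>Degrees of field extensions\<close>

text \<open>
  The field of Laurent series as a ring with explicit carrier, for which the dimension over a
  subfield is defined.
\<close>

definition fls_ring :: "complex fls ring" where
  "fls_ring = \<lparr>carrier = UNIV, monoid.mult = (*), one = 1, ring.zero = 0, add = (+)\<rparr>"

lemma fls_ring_simps [simp]:
  "carrier fls_ring = UNIV" "x \<otimes>\<^bsub>fls_ring\<^esub> y = x * y" "\<one>\<^bsub>fls_ring\<^esub> = 1" "\<zero>\<^bsub>fls_ring\<^esub> = 0" "x \<oplus>\<^bsub>fls_ring\<^esub> y = x + y"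
  by (simp_all add: fls_ring_def)

lemma field_fls_ring: "field fls_ring"
proof -
  have "cring fls_ring"
  proof (rule cringI)
    show "abelian_group fls_ring"
      by (rule abelian_groupI) (auto simp: algebra_simps intro: exI[of _ "- x" for x] left_minus)
    show "comm_monoid fls_ring" by (rule comm_monoidI) (auto simp: algebra_simps)
  qed (simp add: algebra_simps)
  then interpret cring fls_ring .
  show ?thesis
  proof (rule cring_fieldI2)
    show "\<zero>\<^bsub>fls_ring\<^esub> \<noteq> \<one>\<^bsub>fls_ring\<^esub>" by simp
    fix a assume "a \<in> carrier fls_ring" "a \<noteq> \<zero>\<^bsub>fls_ring\<^esub>"
    then show "\<exists>b\<in>carrier fls_ring. a \<otimes>\<^bsub>fls_ring\<^esub> b = \<one>\<^bsub>fls_ring\<^esub>"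
      by (intro bexI[of _ "inverse a"]) auto
  qed
qed

lemma fls_ring_uminus [simp]: "\<ominus>\<^bsub>fls_ring\<^esub> x = - x"
proof -
  interpret field fls_ring by (rule field_fls_ring)
  have "(- x) \<oplus>\<^bsub>fls_ring\<^esub> x = \<zero>\<^bsub>fls_ring\<^esub>" by simp
  then show ?thesis by (intro minus_equality) auto
qed

lemma fls_ring_inv: "x \<noteq> 0 \<Longrightarrow> inv\<^bsub>fls_ring\<^esub> x = inverse x"
proof -
  assume "x \<noteq> 0"
  interpret field fls_ring by (rule field_fls_ring)
  show ?thesis using \<open>x \<noteq> 0\<close> by (intro comm_inv_char) auto
qed

abbreviation "subfield_fls K \<equiv> subfield K fls_ring"
abbreviation "dimension_fls \<equiv> ring.dimension fls_ring"

lemma ring_fls_ring: "ring fls_ring"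
  using field_fls_ring by (simp add: field_def domain_def cring_def)

lemma subring_flsI:
  assumes "1 \<in> K" "\<And>x. x \<in> K \<Longrightarrow> - x \<in> K" "\<And>x y. x \<in> K \<Longrightarrow> y \<in> K \<Longrightarrow> x * y \<in> K"
    "\<And>x y. x \<in> K \<Longrightarrow> y \<in> K \<Longrightarrow> x + y \<in> K"
  shows "subring K fls_ring"
  by (rule ring.subringI[OF ring_fls_ring]) (use assms in auto)

lemma subfield_flsI: assumes "subfld K" shows "subfield_fls K"
proof (rule field.subfieldI'[OF field_fls_ring])
  show "subring K fls_ring"
    by (rule subring_flsI) (use subfld_intros[OF assms] in auto)
  show "inv\<^bsub>fls_ring\<^esub> k \<in> K" if "k \<in> K - {\<zero>\<^bsub>fls_ring\<^esub>}" for k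
    using that fls_ring_inv subfld_inverse[OF assms] by auto
qed

text \<open>
  The span of \<open>1, \<alpha>, \<dots>, \<alpha>\<^sup>n\<^sup>-\<^sup>1\<close>. The bound is put on the coefficients instead of the degree, so that
  \<open>n = 0\<close> yields \<open>{0}\<close>.
\<close>

definition polyspan :: "'a::field set \<Rightarrow> 'a \<Rightarrow> nat \<Rightarrow> 'a set" where
  "polyspan K \<alpha> n = {poly p \<alpha> |p. p \<in> polys K \<and> (\<forall>i\<ge>n. Polynomial.coeff p i = 0)}"

context
  fixes K :: "complex fls set" and \<alpha> :: "complex fls" and d :: nat
  assumes K: "subfld K" "range cst \<subseteq> K"
    and d: "0 < d" "\<alpha> ^ d \<in> K" "\<And>e. 0 < e \<Longrightarrow> e < d \<Longrightarrow> \<alpha> ^ e \<notin> K"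
begin

lemma radical_minimal_polynomial:
  assumes "p \<in> polys K" "p \<noteq> 0" "poly p \<alpha> = 0" shows "d \<le> Polynomial.degree p"
proof -
  obtain A where A: "\<And>\<beta>. Polynomial.monom 1 d - [:\<beta> ^ d:] = (\<Prod>z\<in>#A. [:- (cst z * \<beta>), 1:])"
    "\<And>z. z \<in># A \<Longrightarrow> z ^ d = 1" using binomial_splits[OF d(1)] by blast
  have split: "Polynomial.monom 1 d - [:\<alpha> ^ d:] = (\<Prod>z\<in>#image_mset cst A. [:- (z * \<alpha>), 1:])"
    unfolding A(1) by (simp add: image_mset.compositionality comp_def)
  have "z \<noteq> 0" if "z \<in># A" for z
    using A(2)[OF that] d(1) by (cases "z = 0") (auto simp: power_0_left)
  then have A0: "set_mset (image_mset cst A) \<subseteq> K - {0}" using K(2) by (auto simp: image_subset_iff)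
  show ?thesis by (rule radical_degree_minimal[OF K(1) d split A0 assms])
qed

lemma dimension_polyspan: "n \<le> d \<Longrightarrow> dimension_fls n K (polyspan K \<alpha> n)"
proof (induction n)
  case 0
  have "polyspan K \<alpha> 0 = {0}"
  proof -
    have "x = 0" if x: "x \<in> polyspan K \<alpha> 0" for x
    proof -
      obtain p where p: "\<forall>i\<ge>0. Polynomial.coeff p i = 0" "x = poly p \<alpha>" using x by (auto simp: polyspan_def)
      then have "p = 0" by (intro poly_eqI) simp
      then show ?thesis using p(2) by simp
    qed
    moreover have "poly 0 \<alpha> \<in> polyspan K \<alpha> 0"
      unfolding polyspan_def mem_Collect_eq
      by (rule exI[of _ 0]) (simp add: polys_0[OF K(1)])
    ultimately show ?thesis by auto
  qed
  then show ?case using ring.dimension.zero_dim[OF ring_fls_ring, of K] by simp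
next
  case (Suc n)
  interpret field fls_ring by (rule field_fls_ring)
  have notin: "\<alpha> ^ n \<notin> polyspan K \<alpha> n"
  proof
    assume "\<alpha> ^ n \<in> polyspan K \<alpha> n"
    then obtain p where p: "p \<in> polys K" "\<forall>i\<ge>n. Polynomial.coeff p i = 0" "\<alpha> ^ n = poly p \<alpha>"
      by (auto simp: polyspan_def)
    let ?q = "Polynomial.monom 1 n - p"
    have "Polynomial.coeff ?q n = 1" using p(2) by simp
    then have q0: "?q \<noteq> 0" by (metis coeff_0 zero_neq_one)
    have "?q \<in> polys K" by (intro polys_diff polys_monom K subfld_1 p)
    moreover have "poly ?q \<alpha> = 0" using p(3) by (simp add: poly_monom)
    ultimately have "d \<le> Polynomial.degree ?q" using radical_minimal_polynomial q0 by blast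
    moreover have "Polynomial.degree ?q \<le> n"
      by (rule degree_le) (use p(2) in \<open>auto\<close>)
    ultimately show False using Suc.prems by simp
  qed
  have "line_extension K (\<alpha> ^ n) (polyspan K \<alpha> n) = polyspan K \<alpha> (Suc n)"
  proof (rule Set.set_eqI, rule HOL.iffI)
    fix u assume "u \<in> line_extension K (\<alpha> ^ n) (polyspan K \<alpha> n)"
    then obtain k p where kp: "k \<in> K" "p \<in> polys K" "\<forall>i\<ge>n. Polynomial.coeff p i = 0" "u = k * \<alpha> ^ n + poly p \<alpha>"
      unfolding line_extension_mem_iff by (auto simp: polyspan_def)
    have "u = poly (Polynomial.monom k n + p) \<alpha>" using kp by (simp add: poly_monom)
    moreover have "Polynomial.monom k n + p \<in> polys K" using kp by (intro polys_add polys_monom K)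
    moreover have "\<forall>i\<ge>Suc n. Polynomial.coeff (Polynomial.monom k n + p) i = 0" using kp(3) by simp
    ultimately show "u \<in> polyspan K \<alpha> (Suc n)" unfolding polyspan_def by blast
  next
    fix u assume "u \<in> polyspan K \<alpha> (Suc n)"
    then obtain p where p: "p \<in> polys K" "\<forall>i\<ge>Suc n. Polynomial.coeff p i = 0" "u = poly p \<alpha>"
      by (auto simp: polyspan_def)
    let ?k = "Polynomial.coeff p n"
    let ?q = "p - Polynomial.monom ?k n"
    have k: "?k \<in> K" by (rule polys_coeff[OF p(1)])
    have "?q \<in> polys K" using p k by (intro polys_diff polys_monom K)
    moreover have "\<forall>i\<ge>n. Polynomial.coeff ?q i = 0" 
    proof (intro allI impI)
      fix i assume "n \<le> i"
      then consider "i = n" | "Suc n \<le> i" by linarith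
      then show "Polynomial.coeff ?q i = 0" using p(2) by cases auto
    qed
    ultimately have "poly ?q \<alpha> \<in> polyspan K \<alpha> n" unfolding polyspan_def by blast
    moreover have "u = ?k * \<alpha> ^ n + poly ?q \<alpha>" using p(3) by (simp add: poly_monom)
    ultimately show "u \<in> line_extension K (\<alpha> ^ n) (polyspan K \<alpha> n)"
      unfolding line_extension_mem_iff using k by auto
  qed
  then show ?case
    using dimension.Suc_dim[of "\<alpha> ^ n" "polyspan K \<alpha> n" n K] notin Suc by simp
qed

lemma poly_in_polyspan:
  assumes P: "P \<in> polys K" shows "poly P \<alpha> \<in> polyspan K \<alpha> d"
proof -
  let ?M = "Polynomial.monom 1 d - [:\<alpha> ^ d:]"
  have M: "?M \<in> polys K" by (intro polys_diff polys_monom polys_pCons polys_0 K d subfld_1)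
  have "Polynomial.coeff ?M d = 1" using d(1) by (cases d) auto
  then have M0: "?M \<noteq> 0" by (metis coeff_0 zero_neq_one)
  have deg: "Polynomial.degree ?M \<le> d" by (rule degree_diff_le) (auto simp: Polynomial.degree_monom_le)
  obtain q r where qr: "q \<in> polys K" "r \<in> polys K" "P = q * ?M + r" "r = 0 \<or> Polynomial.degree r < Polynomial.degree ?M"
    using polys_division[OF K(1) M M0 P] by blast
  have "poly P \<alpha> = poly r \<alpha>" using qr(3) by (simp add: poly_monom)
  moreover have "\<forall>i\<ge>d. Polynomial.coeff r i = 0" using qr(4) deg by (auto intro: coeff_eq_0)
  ultimately show ?thesis using qr(2) by (auto simp: polyspan_def)
qed

text \<open>
  By Kummer theory the powers \<open>\<alpha>\<^sup>i\<close> with \<open>i < d\<close> are independent, and their span is a ring. It is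
  a field because its elements are algebraic.
\<close>

lemma dimension_adjoin_radical: "dimension_fls d K (adjoin K \<alpha>)"
proof -
  interpret field fls_ring by (rule field_fls_ring)
  let ?E = "polyspan K \<alpha> d"
  have Ein: "\<exists>p. p \<in> polys K \<and> x = poly p \<alpha>" if "x \<in> ?E" for x using that by (auto simp: polyspan_def)
  have dim: "dimension d K ?E" by (rule dimension_polyspan) simp
  have "subring ?E fls_ring"
  proof (rule subring_flsI)
    show "1 \<in> ?E" using poly_in_polyspan[OF polys_1[OF K(1)]] by simp
    fix x assume "x \<in> ?E"
    then obtain p where p: "p \<in> polys K" "x = poly p \<alpha>" using Ein by blast
    show "- x \<in> ?E" using poly_in_polyspan[OF polys_diff[OF K(1) polys_0[OF K(1)] p(1)]] p(2) by simp
    fix y assume "y \<in> ?E"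
    then obtain q where q: "q \<in> polys K" "y = poly q \<alpha>" using Ein by blast
    show "x * y \<in> ?E" using poly_in_polyspan[OF polys_mult[OF K(1) p(1) q(1)]] p(2) q(2) by simp
    show "x + y \<in> ?E" using poly_in_polyspan[OF polys_add[OF K(1) p(1) q(1)]] p(2) q(2) by simp
  qed
  note ring_E = this
  note subK = subfield_flsI[OF K(1)]
  have KE: "K \<subseteq> ?E"
  proof
    fix x assume "x \<in> K"
    then have "poly [:x:] \<alpha> \<in> ?E" by (intro poly_in_polyspan polys_pCons polys_0 K)
    then show "x \<in> ?E" by simp
  qed
  have inv: "inverse x \<in> ?E" if x: "x \<in> ?E" for x
  proof (cases "x = 0")
    case False
    have "(algebraic over K) x"
      by (rule finite_dimension_imp_algebraic[OF subK ring_E finite_dimensionI[OF dim] x])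
    then have sub: "subfield (simple_extension K x) fls_ring"
      using simple_extension_is_subfield[OF subK, of x] by simp
    have xs: "x \<in> simple_extension K x" using simple_extension_mem[OF subfieldE(1)[OF subK], of x] by simp
    have "inv\<^bsub>fls_ring\<^esub> x \<in> simple_extension K x"
      using subfield_m_inv(1)[OF sub, of x] xs False by simp
    then show ?thesis
      using simple_extension_subring_incl[OF ring_E KE x] fls_ring_inv[OF False] by auto
  qed (use x in simp)
  have "subfld ?E"
    unfolding subfld_def using subringE[OF ring_E] inv by auto
  moreover have "\<alpha> \<in> ?E"
  proof -
    have "poly [:0, 1:] \<alpha> \<in> ?E" by (intro poly_in_polyspan polys_pCons polys_0 K subfld_0 subfld_1)
    then show ?thesis by simp
  qed
  ultimately have "adjoin K \<alpha> \<subseteq> ?E" by (rule adjoin_least[OF _ KE])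
  moreover have "?E \<subseteq> adjoin K \<alpha>"
  proof
    fix x assume "x \<in> ?E"
    then obtain p where "p \<in> polys K" "x = poly p \<alpha>" using Ein by blast
    then show "x \<in> adjoin K \<alpha>" using adjoinI[of p K 1 \<alpha>] polys_1[OF K(1)] by simp
  qed
  ultimately show ?thesis using dim by simp
qed

end

lemma dimension_fls_unique:
  assumes "subfld K" "dimension_fls n K E" "dimension_fls m K E" shows "n = m"
  by (rule ring.dimension_is_inj[OF ring_fls_ring subfield_flsI[OF assms(1)] assms(2,3)])

lemma dimension_fls_tower:
  assumes "subfld K" "subfld F" "dimension_fls n K F" "dimension_fls m F E"
  shows "dimension_fls (n * m) K E"
  by (rule ring.telescopic_base[OF ring_fls_ring subfield_flsI[OF assms(1)] subfield_flsI[OF assms(2)] assms(3,4)])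

lemma dimension_fls_one: "subfld K \<Longrightarrow> dimension_fls 1 K K"
  using ring.dimension_one[OF ring_fls_ring subfield_flsI] by simp

lemma subalgebra_fls:
  assumes "subfld E" "F \<subseteq> E" shows "subalgebra F E fls_ring"
proof -
  interpret field fls_ring by (rule field_fls_ring)
  have "subring E fls_ring" using subfieldE(1)[OF subfield_flsI[OF assms(1)]] .
  then have "subgroup E (add_monoid fls_ring)" by (simp add: subring_def)
  then show ?thesis using assms subfld_mult[OF assms(1)] by (auto simp: subalgebra_def subalgebra_axioms_def)
qed

lemma finite_dimension_larger_base:
  assumes K: "subfld K" and F: "subfld F" and E: "subfld E" and sub: "K \<subseteq> F" "F \<subseteq> E"
    and dim: "dimension_fls n K E"
  shows "\<exists>m. dimension_fls m F E"
proof -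
  interpret field fls_ring by (rule field_fls_ring)
  note sK = subfield_flsI[OF K] and sF = subfield_flsI[OF F]
  obtain Us where Us: "set Us \<subseteq> carrier fls_ring" "Span K Us = E" using exists_base[OF sK dim] by blast
  have UE: "set Us \<subseteq> E" using Span_base_incl[OF sK Us(1)] Us(2) by simp
  have "Span F Us \<subseteq> E" by (rule subalgebra_Span_incl[OF sF subalgebra_fls[OF E sub(2)] UE])
  moreover have "Span K Us \<subseteq> Span F Us"
  proof (rule subalgebra_Span_incl[OF sK _ Span_base_incl[OF sF Us(1)]])
    show "subalgebra K (Span F Us) fls_ring"
      using Span_is_subalgebra[OF sF Us(1)] sub(1) by (auto simp: subalgebra_def subalgebra_axioms_def)
  qed
  ultimately have "Span F Us = E" using Us(2) by simp
  then have "finite_dimension F E" using Span_finite_dimension[OF sF Us(1)] by simp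
  then show ?thesis by (simp add: finite_dimension_def)
qed

text \<open>
  By the tower law the dimension of \<open>F\<close> over \<open>K\<close> is \<open>1\<close>.
\<close>

lemma equal_dimension_imp_equal_base:
  assumes K: "subfld K" and F: "subfld F" and E: "subfld E" and sub: "K \<subseteq> F" "F \<subseteq> E"
    and dim: "dimension_fls m K E" "dimension_fls m F E" "0 < m"
  shows "K = F"
proof -
  interpret field fls_ring by (rule field_fls_ring)
  note sK = subfield_flsI[OF K]
  have "finite_dimension K F"
    by (rule subalbegra_incl_imp_finite_dimension[OF sK finite_dimensionI[OF dim(1)] subalgebra_fls[OF F sub(1)] sub(2)])
  then obtain n where n: "dimension n K F" by (auto simp: finite_dimension_def)
  have "n * m = m" by (rule dimension_fls_unique[OF K dimension_fls_tower[OF K F n dim(2)] dim(1)])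
  then have n1: "n = 1" using dim(3) by simp
  have S1: "Span K [1] = K"
    using line_extension_mem_iff[of _ K 1 "{0}"] by auto
  have "independent K [1]"
  proof (rule li_Cons)
    show "1 \<notin> Span K []" by simp
  qed simp_all
  then have "Span K [1] = F"
    using independent_length_eq_dimension[OF sK n, of "[1]"] n1 subfld_1[OF F] by simp
  then show ?thesis using S1 by simp
qed

section \<open>Balanced germs\<close>

abbreviation CF :: "complex fls \<Rightarrow> complex fls set" where "CF f \<equiv> adjoin (range cst) f"

lemma subfld_CF: "subfld (CF f)" by (rule subfld_adjoin[OF subfld_range_cst])
lemma cst_CF: "range cst \<subseteq> CF f" using adjoin_base[OF subfld_range_cst] by auto
lemma self_CF: "f \<in> CF f" by (rule adjoin_self[OF subfld_range_cst])
lemma CF_least: "subfld M \<Longrightarrow> range cst \<subseteq> M \<Longrightarrow> f \<in> M \<Longrightarrow> CF f \<subseteq> M" by (rule adjoin_least)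

text \<open>
  A relation \<open>f\<^sup>e Q(f\<^sup>n) = P(f\<^sup>n)\<close> would be an identity of polynomials because \<open>f\<close> is transcendental, but
  all exponents on the left are congruent to \<open>e\<close> modulo \<open>n\<close> and those on the right to \<open>0\<close>.
\<close>

lemma power_not_in_CF_power:
  assumes f: "f \<notin> range cst" and e: "0 < e" "e < n"
  shows "f ^ e \<notin> CF (f ^ n)"
proof
  assume "f ^ e \<in> CF (f ^ n)"
  then obtain P Q where P: "P \<in> polys (range cst)" "Q \<in> polys (range cst)" "poly Q (f ^ n) \<noteq> 0"
      "f ^ e = poly P (f ^ n) / poly Q (f ^ n)" by (rule adjoinE)
  let ?X = "Polynomial.monom 1 n :: complex fls poly"
  let ?R = "Polynomial.monom 1 e * pcompose Q ?X - pcompose P ?X"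
  have pX: "pcompose p ?X \<in> polys (range cst)" if "p \<in> polys (range cst)" for p
    using that
  proof (induction p)
    case (pCons a p)
    have "a \<in> range cst" using polys_coeff[OF pCons.prems, of 0] by simp
    moreover have "p \<in> polys (range cst)"
      unfolding polys_def using polys_coeff[OF pCons.prems, of "Suc _"] by auto
    ultimately show ?case using pCons.IH unfolding pcompose_pCons
      by (intro polys_add polys_mult polys_pCons polys_monom polys_0 subfld_range_cst subfld_1)
  qed (simp add: polys_0[OF subfld_range_cst])
  have "?R \<in> polys (range cst)"
    by (intro polys_diff polys_mult polys_monom pX P subfld_range_cst subfld_1)
  moreover have "poly ?R f = 0" using P(3,4) by (simp add: poly_pcompose poly_monom)
  ultimately have "?R = 0" using transcendental_over_constants[OF f] by blast
  then have eq: "Polynomial.monom 1 e * pcompose Q ?X = pcompose P ?X" by simp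
  have deg: "Polynomial.degree (pcompose p ?X) = Polynomial.degree p * n" for p :: "complex fls poly"
    by (simp add: degree_pcompose Polynomial.degree_monom_eq)
  have "Q \<noteq> 0" using P(3) by auto
  then have "pcompose Q ?X \<noteq> 0" using e by (auto simp: pcompose_eq_0_iff Polynomial.degree_monom_eq)
  then have "Polynomial.degree (Polynomial.monom 1 e * pcompose Q ?X) = e + Polynomial.degree Q * n"
    by (subst degree_mult_eq) (auto simp: deg Polynomial.degree_monom_eq)
  then have "e + Polynomial.degree Q * n = Polynomial.degree P * n" unfolding eq deg by (rule sym)
  then have "n dvd e" by (metis dvd_add_left_iff dvd_triv_right)
  then show False using e by (auto dest: dvd_imp_le)
qed

lemma power_not_constant:
  assumes f: "f \<notin> range cst" and n: "0 < n" shows "f ^ n \<notin> range cst"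
proof
  assume "f ^ n \<in> range cst"
  then obtain c where c: "f ^ n = cst c" by blast
  let ?R = "Polynomial.monom 1 n - [:cst c:]"
  have "?R \<in> polys (range cst)"
    by (intro polys_diff polys_monom polys_pCons polys_0 subfld_range_cst subfld_1) simp
  moreover have "poly ?R f = 0" using c by (simp add: poly_monom)
  ultimately have "?R = 0" using transcendental_over_constants[OF f] by blast
  moreover have "Polynomial.coeff ?R n = 1" using n by (cases n) auto
  ultimately show False by (metis coeff_0 zero_neq_one)
qed

text \<open>
  The fields C(Z) and C(f) have the same degree in a common finite extension. For an algebraic curve with functions \<open>Z\<close> and
  \<open>f\<close> this says that both projections of the curve have the same degree.
\<close>

definition balanced :: "complex fls \<Rightarrow> complex fls \<Rightarrow> bool" where
  "balanced Z f \<longleftrightarrow> f \<notin> range cst \<and> (\<exists>M m. subfld M \<and> range cst \<subseteq> M \<and> Z \<in> M \<and> f \<in> M \<and> 0 < m \<and>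
     dimension_fls m (CF Z) M \<and> dimension_fls m (CF f) M)"

lemma balanced_refl: "Z \<notin> range cst \<Longrightarrow> balanced Z Z"
  unfolding balanced_def
  by (intro conjI exI[of _ "CF Z"] exI[of _ 1] subfld_CF cst_CF self_CF dimension_fls_one) auto

text \<open>
  The relation is that of \<open>f' = \<phi>\<^sub>n(w) \<circ> f\<close>. Since \<open>f'\<^sup>n\<close> is a Moebius transform of \<open>f\<^sup>n\<close>, both
  generate the same field \<open>K\<close>, and \<open>C(f)\<close> and \<open>C(f')\<close> have degree \<open>n\<close> over it. The old extension
  \<open>M\<close> is enlarged by the radical \<open>f'\<close>, of degree \<open>d\<close> over \<open>M\<close>. The degree of the new extension over
  \<open>K\<close> is \<open>n m d\<close> when computed through \<open>C(f)\<close> and \<open>n m'\<close> when computed through \<open>C(f')\<close>, so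
  \<open>m' = m d\<close>, which is also its degree over \<open>C(Z)\<close>.
\<close>

lemma balanced_step:
  assumes bal: "balanced Z f" and n: "0 < n" and w: "w * w' \<noteq> 1"
    and rel: "f' ^ n * (1 + cst w * f ^ n) = f ^ n + cst w'"
  shows "balanced Z f'"
proof -
  obtain M m where M: "subfld M" "range cst \<subseteq> M" "Z \<in> M" "f \<in> M" "0 < m"
      "dimension_fls m (CF Z) M" "dimension_fls m (CF f) M" and f: "f \<notin> range cst"
    using bal by (auto simp: balanced_def)
  note F = subfld_range_cst
  have fn: "f ^ n \<notin> range cst" by (rule power_not_constant[OF f n])
  have nz: "a * f ^ n + b \<noteq> 0" if "a \<in> range cst" "b \<in> range cst" "a \<noteq> 0 \<or> b \<noteq> 0" for a b
  proof
    assume *: "a * f ^ n + b = 0"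
    show False
    proof (cases "a = 0")
      case False
      then have "f ^ n = - b / a" using * by (simp add: field_simps eq_neg_iff_add_eq_0)
      then show False using that(1,2) fn by (metis F subfld_divide subfld_uminus)
    qed (use * that in simp)
  qed
  have den: "1 + cst w * f ^ n \<noteq> 0" using nz[of "cst w" 1] subfld_1[OF F] by (simp add: add.commute)
  have f': "f' \<notin> range cst"
  proof
    assume "f' \<in> range cst"
    then have c: "f' ^ n \<in> range cst" by (rule subfld_power[OF F])
    have "(f' ^ n * cst w - 1) * f ^ n + (f' ^ n - cst w') = 0" using rel by (simp add: algebra_simps)
    moreover have "f' ^ n * cst w - 1 \<in> range cst" "f' ^ n - cst w' \<in> range cst"
      using c F by (auto intro!: subfld_diff subfld_mult subfld_1)
    ultimately have "f' ^ n * cst w - 1 = 0" "f' ^ n - cst w' = 0" using nz by blast+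
    then have "cst (w * w') = 1" by (simp add: mult.commute)
    then show False using w fls_const_eq_1_iff by blast
  qed
  have pow: "f ^ n \<in> CF (f' ^ n)" "f' ^ n \<in> CF (f ^ n)"
  proof -
    note I1 = subfld_intros[OF subfld_CF[of "f ^ n"]] and I2 = subfld_intros[OF subfld_CF[of "f' ^ n"]]
    have "f' ^ n = (f ^ n + cst w') / (1 + cst w * f ^ n)" using rel den by (simp add: field_simps)
    moreover have "(f ^ n + cst w') / (1 + cst w * f ^ n) \<in> CF (f ^ n)"
      using cst_CF by (intro I1 self_CF) auto
    ultimately show "f' ^ n \<in> CF (f ^ n)" by simp
    have r': "f ^ n * (1 - cst w * f' ^ n) = f' ^ n - cst w'" using rel by (simp add: algebra_simps)
    have "1 - cst w * f' ^ n \<noteq> 0"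
    proof
      assume 0: "1 - cst w * f' ^ n = 0"
      then have "f' ^ n = cst w'" using r' by simp
      then have "cst (w * w') = 1" using 0 by simp
      then show False using w fls_const_eq_1_iff by blast
    qed
    then have "f ^ n = (f' ^ n - cst w') / (1 - cst w * f' ^ n)" using r' by (simp add: field_simps)
    moreover have "(f' ^ n - cst w') / (1 - cst w * f' ^ n) \<in> CF (f' ^ n)"
      using cst_CF by (intro I2 self_CF) auto
    ultimately show "f ^ n \<in> CF (f' ^ n)" by simp
  qed
  have K: "CF (f ^ n) = CF (f' ^ n)"
    using CF_least[OF subfld_CF cst_CF pow(1)] CF_least[OF subfld_CF cst_CF pow(2)] by blast
  let ?K = "CF (f ^ n)"
  let ?M = "adjoin M f'"
  have "f' ^ n \<in> M" using pow(2) CF_least[OF M(1,2) subfld_power[OF M(1,4)]] by blast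
  define d where "d = (LEAST d. 0 < d \<and> f' ^ d \<in> M)"
  have "0 < n \<and> f' ^ n \<in> M" using n \<open>f' ^ n \<in> M\<close> by simp
  then have d: "0 < d" "f' ^ d \<in> M" and min: "\<And>e. 0 < e \<Longrightarrow> e < d \<Longrightarrow> f' ^ e \<notin> M"
    using LeastI[of "\<lambda>d. 0 < d \<and> f' ^ d \<in> M" n] not_less_Least[of _ "\<lambda>d. 0 < d \<and> f' ^ d \<in> M"]
    unfolding d_def by auto
  have dimM: "dimension_fls d M ?M" by (rule dimension_adjoin_radical[OF M(1,2) d min])
  have M': "subfld ?M" by (rule subfld_adjoin[OF M(1)])
  have MM: "M \<subseteq> ?M" using adjoin_base[OF M(1)] by auto
  have f'M: "f' \<in> ?M" by (rule adjoin_self[OF M(1)])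
  have dimZ: "dimension_fls (m * d) (CF Z) ?M" and dimf: "dimension_fls (m * d) (CF f) ?M"
    by (rule dimension_fls_tower[OF subfld_CF M(1) M(6) dimM], rule dimension_fls_tower[OF subfld_CF M(1) M(7) dimM])
  have CFn: "dimension_fls n (CF (x ^ n)) (CF x)" if x: "x \<notin> range cst" for x
  proof -
    have "CF x = adjoin (CF (x ^ n)) x"
    proof
      show "CF x \<subseteq> adjoin (CF (x ^ n)) x"
        by (rule CF_least[OF subfld_adjoin[OF subfld_CF] _ adjoin_self[OF subfld_CF]])
          (use cst_CF adjoin_base[OF subfld_CF] in blast)
      show "adjoin (CF (x ^ n)) x \<subseteq> CF x"
        by (rule adjoin_least[OF subfld_CF CF_least[OF subfld_CF cst_CF subfld_power[OF subfld_CF self_CF]] self_CF])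
    qed
    then show ?thesis
      using dimension_adjoin_radical[OF subfld_CF cst_CF n self_CF power_not_in_CF_power[OF x]] by simp
  qed
  have dimK: "dimension_fls (n * (m * d)) ?K ?M"
    by (rule dimension_fls_tower[OF subfld_CF subfld_CF CFn[OF f] dimf])
  have KF: "?K \<subseteq> CF f'" unfolding K by (rule CF_least[OF subfld_CF cst_CF subfld_power[OF subfld_CF self_CF]])
  have F'M: "CF f' \<subseteq> ?M" by (rule CF_least[OF M' subset_trans[OF M(2) MM] f'M])
  obtain m' where m': "dimension_fls m' (CF f') ?M"
    using finite_dimension_larger_base[OF subfld_CF subfld_CF M' KF F'M dimK] by blast
  have "dimension_fls (n * m') ?K ?M"
    using dimension_fls_tower[OF subfld_CF subfld_CF CFn[OF f'] m'] unfolding K .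
  then have "n * m' = n * (m * d)" by (rule dimension_fls_unique[OF subfld_CF _ dimK])
  then have "m' = m * d" using n by simp
  then show ?thesis
    unfolding balanced_def using f' M' MM M f'M dimZ m' d(1)
    by (intro conjI exI[of _ ?M] exI[of _ "m * d"]) auto
qed

lemma balanced_rational:
  assumes bal: "balanced Z s" and s: "s \<in> CF Z"
  shows "Z \<in> CF s"
proof -
  obtain M m where M: "subfld M" "range cst \<subseteq> M" "Z \<in> M" "s \<in> M" "0 < m"
      "dimension_fls m (CF Z) M" "dimension_fls m (CF s) M"
    using bal by (auto simp: balanced_def)
  have "CF s \<subseteq> CF Z" by (rule CF_least[OF subfld_CF cst_CF s])
  moreover have "CF Z \<subseteq> M" by (rule CF_least[OF M(1,2,3)])
  ultimately have "CF s = CF Z"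
    using equal_dimension_imp_equal_base[OF subfld_CF subfld_CF M(1) _ _ M(7,6,5)] by blast
  then show ?thesis using self_CF by simp
qed

section \<open>A radical diffeomorphism that is not of finite type\<close>

lemma germ_id_not_constant: "germ a (\<lambda>z. z) \<notin> range cst"
proof
  assume "germ a (\<lambda>z. z) \<in> range cst"
  then obtain c where "germ a (\<lambda>z. z) = germ a (\<lambda>z. c)" by (auto simp: germ_const)
  then have "\<forall>\<^sub>F z in nhds a. z = c" using germ_eq_iff[OF analytic_on_ident analytic_on_const] by simp
  then obtain e where e: "e > 0" "\<And>z. dist z a < e \<Longrightarrow> z = c" unfolding eventually_nhds_metric by blast
  have "ball a e \<subseteq> {c}" using e(2) by (auto simp: dist_commute)
  moreover have "infinite (ball a e)" using e(1) by (simp add: uncountable_ball uncountable_infinite)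
  ultimately show False using finite_subset by blast
qed

text \<open>
  Composition from the left does not move the base point of a germ, so all germs are taken at \<open>1\<close>. The map
  being composed is evaluated at the image of \<open>1\<close>, which may be any point of the circle.
\<close>

definition balanced_at_1 :: "(complex \<Rightarrow> complex) \<Rightarrow> bool" where
  "balanced_at_1 \<tau> \<longleftrightarrow> (\<forall>z\<in>unit_circle. \<tau> z \<in> unit_circle) \<and>
     (\<exists>r>0. \<exists>g. g holomorphic_on ball 1 r \<and> (\<forall>z\<in>unit_circle \<inter> ball 1 r. \<tau> z = g z) \<and>
        balanced (germ 1 (\<lambda>z. z)) (germ 1 g))"

lemma balanced_at_1_cong:
  "(\<And>z. z \<in> unit_circle \<Longrightarrow> \<sigma> z = \<tau> z) \<Longrightarrow> balanced_at_1 \<sigma> \<Longrightarrow> balanced_at_1 \<tau>"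
  unfolding balanced_at_1_def by (metis IntD1)

lemma balanced_at_1_id: "balanced_at_1 (\<lambda>z. z)"
  unfolding balanced_at_1_def
  by (intro conjI exI[of _ 1] exI[of _ "\<lambda>z. z"] balanced_refl germ_id_not_constant) (auto intro: holomorphic_intros)

lemma balanced_at_1_phi:
  assumes \<tau>: "balanced_at_1 \<tau>" and n: "0 < n" and w: "norm w < 1"
  shows "balanced_at_1 (\<lambda>z. phi n w (\<tau> z))"
proof -
  obtain r g where r: "r > 0" "g holomorphic_on ball 1 r" "\<And>z. z \<in> unit_circle \<inter> ball 1 r \<Longrightarrow> \<tau> z = g z"
      "balanced (germ 1 (\<lambda>z. z)) (germ 1 g)" and \<tau>C: "\<And>z. z \<in> unit_circle \<Longrightarrow> \<tau> z \<in> unit_circle"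
    using \<tau> unfolding balanced_at_1_def by blast
  have "g 1 \<in> unit_circle" using r(1) r(3)[of 1] \<tau>C[of 1] by simp
  then have g1: "g 1 \<in> Phi_domain n w" by (rule unit_circle_Phi_domain[OF w])
  have "open (ball 1 r \<inter> g -` Phi_domain n w)"
    by (rule continuous_open_preimage[OF holomorphic_on_imp_continuous_on[OF r(2)] _ open_Phi_domain]) simp
  moreover have "1 \<in> ball 1 r \<inter> g -` Phi_domain n w" using r(1) g1 by simp
  ultimately obtain e where e: "e > 0" "ball 1 e \<subseteq> ball 1 r \<inter> g -` Phi_domain n w" using open_contains_ball by blast
  define g' where "g' z = Phi n w (g z)" for z
  have gD: "g z \<in> Phi_domain n w" if "z \<in> ball 1 e" for z using e(2) that by blast
  have "(Phi n w \<circ> g) holomorphic_on ball 1 e"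
    by (rule holomorphic_on_compose_gen[OF holomorphic_on_subset[OF r(2)] Phi_holomorphic[OF n]]) (use e(2) in auto)
  then have g'h: "g' holomorphic_on ball 1 e" by (simp add: g'_def[abs_def] o_def)
  have in1: "1 \<in> ball 1 r" "1 \<in> ball 1 e" using r(1) e(1) by simp_all
  have an: "g analytic_on {1}" "g' analytic_on {1}"
    using r(2) g'h in1 analytic_at open_ball by blast+
  have "\<forall>\<^sub>F z in nhds 1. z \<in> ball 1 e" using in1(2) eventually_nhds open_ball by blast
  then have "\<forall>\<^sub>F z in nhds 1. g' z ^ n * (1 + w * g z ^ n) = g z ^ n + cnj w"
  proof eventually_elim
    case (elim z)
    show ?case using Phi_power[OF n gD[OF elim]] Phi_domainD(5)[OF gD[OF elim]] by (simp add: g'_def)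
  qed
  moreover have a1: "(\<lambda>z. 1 + w * g z ^ n) analytic_on {1}" "(\<lambda>z. g z ^ n + cnj w) analytic_on {1}"
    "(\<lambda>z. w * g z ^ n) analytic_on {1}" "(\<lambda>z. g z ^ n) analytic_on {1}" "(\<lambda>z. g' z ^ n) analytic_on {1}"
    using an by (auto intro!: analytic_on_add analytic_on_mult analytic_on_power)
  ultimately have "germ 1 (\<lambda>z. g' z ^ n * (1 + w * g z ^ n)) = germ 1 (\<lambda>z. g z ^ n + cnj w)"
    using germ_eq_iff[OF analytic_on_mult[OF a1(5,1)] a1(2)] by simp
  then have "germ 1 g' ^ n * (1 + cst w * germ 1 g ^ n) = germ 1 g ^ n + cst (cnj w)"
    unfolding germ_mult[OF a1(5,1)] germ_add[OF analytic_on_const a1(3)] germ_mult[OF analytic_on_const a1(4)]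
      germ_add[OF a1(4) analytic_on_const] germ_const germ_power[OF an(1)] germ_power[OF an(2)] by simp
  moreover have "w * cnj w \<noteq> 1"
  proof
    assume "w * cnj w = 1"
    then have "norm w * norm w = 1" by (metis complex_mod_cnj norm_mult norm_one)
    moreover have "norm w * norm w \<le> norm w * 1" using w by (intro mult_left_mono) auto
    ultimately show False using w by simp
  qed
  ultimately have "balanced (germ 1 (\<lambda>z. z)) (germ 1 g')" by (intro balanced_step[OF r(4) n])
  moreover have "phi n w (\<tau> z) = g' z" if "z \<in> unit_circle \<inter> ball 1 e" for z
    using that r(3)[of z] e(2) phi_eq_Phi[OF \<tau>C[of z]] by (auto simp: g'_def)
  ultimately show ?thesis
    unfolding balanced_at_1_def using g'h e(1) phi_in_unit_circle[OF n w] \<tau>C by blast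
qed

text \<open>
  The stronger statement that composition with \<open>\<sigma>\<close> from the left preserves balanced maps goes through the
  generation of the group.
\<close>

lemma finite_type_balanced:
  assumes "\<sigma> \<in> finite_type_diffeos"
  shows "balanced_at_1 \<sigma>"
proof -
  let ?G = "BijGroup unit_circle"
  have "\<sigma> \<in> Bij unit_circle \<and> (\<forall>\<tau>. balanced_at_1 \<tau> \<longrightarrow> balanced_at_1 (\<lambda>z. \<sigma> (\<tau> z)))"
    using assms unfolding finite_type_diffeos_def
  proof (induction rule: generate.induct)
    case one
    have "balanced_at_1 (\<lambda>z. (\<lambda>x\<in>unit_circle. x) (\<tau> z))" if "balanced_at_1 \<tau>" for \<tau>
      by (rule balanced_at_1_cong[OF _ that]) (use that in \<open>simp add: balanced_at_1_def\<close>)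
    moreover have "\<one>\<^bsub>?G\<^esub> = (\<lambda>x\<in>unit_circle. x)" by (simp add: BijGroup_def)
    ultimately show ?case using id_Bij[of unit_circle] by (simp only:) blast
  next
    case (incl h)
    then show ?case using phi_Bij(1) balanced_at_1_phi by auto
  next
    case (inv h)
    then obtain n w where h: "h = phi n w" and n: "0 < n" and w: "norm (w :: complex) < 1" by auto
    have w': "norm (- w) < 1" using w by simp
    have B: "h \<in> Bij unit_circle" unfolding h by (rule phi_Bij(1)[OF n w])
    have hinv: "inv\<^bsub>?G\<^esub> h = restrict (inv_into unit_circle h) unit_circle" by (rule inv_BijGroup[OF B])
    have "balanced_at_1 (\<lambda>z. restrict (inv_into unit_circle h) unit_circle (\<tau> z))" if \<tau>: "balanced_at_1 \<tau>" for \<tau>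
    proof (rule balanced_at_1_cong[OF _ balanced_at_1_phi[OF \<tau> n w']])
      fix z :: complex assume "z \<in> unit_circle"
      then have "\<tau> z \<in> unit_circle" using \<tau> by (simp add: balanced_at_1_def)
      then show "phi n (- w) (\<tau> z) = restrict (inv_into unit_circle h) unit_circle (\<tau> z)"
        unfolding h by (simp add: phi_Bij(2)[OF n w])
    qed
    then show ?case unfolding hinv using restrict_inv_into_Bij[OF B] by blast
  next
    case (eng h1 h2)
    have mult: "h1 \<otimes>\<^bsub>?G\<^esub> h2 = compose unit_circle h1 h2" using eng.IH by (simp add: BijGroup_def)
    have "balanced_at_1 (\<lambda>z. compose unit_circle h1 h2 (\<tau> z))" if \<tau>: "balanced_at_1 \<tau>" for \<tau>
    proof (rule balanced_at_1_cong)
      show "balanced_at_1 (\<lambda>z. h1 (h2 (\<tau> z)))" using eng.IH \<tau> by blast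
      show "h1 (h2 (\<tau> z)) = compose unit_circle h1 h2 (\<tau> z)" if "z \<in> unit_circle" for z
        using \<tau> that by (simp add: balanced_at_1_def compose_def)
    qed
    then show ?case unfolding mult using eng.IH compose_Bij by blast
  qed
  then show ?thesis using balanced_at_1_id by blast
qed

text \<open>
  On the circle \<open>2 \<i> z Im z = z\<^sup>2 - 1\<close>, so the twist by \<open>Im z / 4\<close> is the rational function
  \<open>num3 / den3\<close>.
\<close>

definition num3 :: "complex \<Rightarrow> complex" where "num3 z = z ^ 3 + 8 * z ^ 2 - z"
definition den3 :: "complex \<Rightarrow> complex" where "den3 z = - (z ^ 2) + 8 * z + 1"
definition cubic_twist :: "complex \<Rightarrow> complex" where "cubic_twist = twist (\<lambda>z. Im z / 4)"

lemma cubic_twist_rational: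
  assumes z: "z \<in> unit_circle" shows "den3 z \<noteq> 0" "cubic_twist z = num3 z / den3 z"
proof -
  define x where "x = complex_of_real (Im z / 4)"
  have z0: "z \<noteq> 0" using z by auto
  have "8 * (\<i> * z * x) = 2 * \<i> * z * of_real (Im z)" by (simp add: x_def)
  then have x: "8 * (\<i> * z * x) = z ^ 2 - 1" using unit_circle_Re_Im(2)[OF z] by simp
  have d: "den3 z = 8 * z * (1 - \<i> * x)" using x by (simp add: den3_def algebra_simps)
  have n: "num3 z = 8 * z * (z * (1 + \<i> * x))"
  proof -
    have "8 * z * (z * (1 + \<i> * x)) = z * (8 * z + 8 * (\<i> * z * x))" by (simp add: algebra_simps)
    also have "\<dots> = num3 z" unfolding x num3_def by (simp add: algebra_simps power3_eq_cube power2_eq_square)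
    finally show ?thesis by simp
  qed
  have nz: "1 - \<i> * x \<noteq> 0" unfolding x_def by (rule one_minus_i_real_nonzero)
  show "den3 z \<noteq> 0" unfolding d using z0 nz by simp
  have "cubic_twist z = z * (1 + \<i> * x) / (1 - \<i> * x)" using z by (simp add: cubic_twist_def twist_def x_def)
  then show "cubic_twist z = num3 z / den3 z" unfolding n d using z0 by simp
qed

lemma cubic_twist_diffeo: "cubic_twist \<in> circle_diffeos"
  unfolding cubic_twist_def
proof (rule twist_diffeo)
  show "continuous_on unit_circle (\<lambda>z. Im z / 4)" by (intro continuous_intros) auto
  have "smooth (\<lambda>t. (1 / 4) * Im (cis t))"
    by (rule smooth_mult[OF smooth_const smooth_bounded_linear[OF bounded_linear_Im smooth_cis]])
  then show "smooth (\<lambda>t. Im (cis t) / 4)" by simp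
  show "((\<lambda>t. Im (cis t) / 4) has_real_derivative cos t / 4) (at t)" for t
    by (auto intro!: derivative_eq_intros)
  show "\<bar>cos t / 4\<bar> < 1 / 2" for t :: real using abs_cos_le_one[of t] by linarith
qed

lemma cubic_twist_algebraic: "algebraic_map cubic_twist"
proof (rule algebraic_mapI)
  show "bipoly (\<lambda>z w. den3 z * w - num3 z)" unfolding den3_def num3_def
    by (rule bipoly_diff, rule bipoly_mult, rule bipoly_add, rule bipoly_add)
      (use bipoly_mult[OF bipoly_const[of "- 1"] bipoly_power[OF bipoly_fst, of 2]] in \<open>auto intro!: bipoly_intros\<close>)
  show "den3 0 * 1 - num3 0 \<noteq> 0" by (simp add: den3_def num3_def)
  show "den3 z * cubic_twist z - num3 z = 0" if "z \<in> unit_circle" for z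
    using cubic_twist_rational[OF that] by simp
qed

lemma den3_holomorphic: "den3 holomorphic_on S" and num3_holomorphic: "num3 holomorphic_on S"
  unfolding den3_def[abs_def] num3_def[abs_def] by (intro holomorphic_intros)+

lemma open_den3: "open {z. den3 z \<noteq> 0}"
  unfolding den3_def by (intro open_Collect_neq continuous_intros)

lemma radical_on_num3: "radical_on U num3" and radical_on_den3: "radical_on U den3"
  unfolding num3_def[abs_def] den3_def[abs_def] by (intro radical_intros)+

lemma cubic_twist_radical: "radical_map cubic_twist"
  unfolding radical_map_def
proof (intro conjI cubic_twist_algebraic exI[of _ "{}"] ballI)
  fix a assume "a \<in> unit_circle - {}"
  then have "a \<in> {z. den3 z \<noteq> 0}" using cubic_twist_rational(1) by simp
  then obtain r where r: "r > 0" "ball a r \<subseteq> {z. den3 z \<noteq> 0}" using open_den3 open_contains_ball by blast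
  then have "radical_on (ball a r) (\<lambda>z. num3 z / den3 z)"
    by (intro radical_on.divide radical_on_num3 radical_on_den3) auto
  then show "\<exists>r>0. \<exists>f. radical_on (ball a r) f \<and> (\<forall>z\<in>unit_circle \<inter> ball a r. cubic_twist z = f z)"
    using r(1) cubic_twist_rational(2) by blast
qed simp

text \<open>
  The inverse is a holomorphic root of the cubic equation \<open>num3 y = w den3 y\<close> for \<open>y\<close> near each point of the circle
  outside a finite set, which contains the zeros of the discriminant and the critical values of the rational function.
\<close>

lemma cubic_twist_inverse_radical: "radical_map (inv_into unit_circle cubic_twist)"
proof -
  let ?i = "inv_into unit_circle cubic_twist"
  have homeo: "cubic_twist \<in> circle_homeos" using cubic_twist_diffeo by (simp add: circle_diffeos_def)
  note B = circle_homeos_Bij[OF homeo]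
  define p2 where "p2 = [:8, 1 :: complex:]"
  define p1 where "p1 = [:-1, - 8 :: complex:]"
  define p0 where "p0 = [:0, - 1 :: complex:]"
  \<comment> \<open>The discriminant of \<open>y\<^sup>3 + p2 y\<^sup>2 + p1 y + p0\<close> as a polynomial in \<open>w\<close>.\<close>
  define disc where "disc = p2 ^ 2 * p1 ^ 2 - 4 * p1 ^ 3 - 4 * p2 ^ 3 * p0 + 18 * p2 * p1 * p0 - 27 * p0 ^ 2"
  have disc: "poly disc w = poly p2 w ^ 2 * poly p1 w ^ 2 - 4 * poly p1 w ^ 3 - 4 * poly p2 w ^ 3 * poly p0 w
      + 18 * poly p2 w * poly p1 w * poly p0 w - 27 * poly p0 w ^ 2" for w
    by (simp add: disc_def)
  have "poly disc 0 \<noteq> 0" unfolding disc by (simp add: p0_def p1_def p2_def)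
  then have disc0: "disc \<noteq> 0" by auto
  \<comment> \<open>The numerator of the derivative of \<open>num3 / den3\<close>.\<close>
  define W where "W = [:-1, 16, 66, 16, - 1 :: complex:]"
  define R where "R z = num3 z / den3 z" for z
  have R_hol: "R holomorphic_on {z. den3 z \<noteq> 0}"
    unfolding R_def[abs_def] by (intro holomorphic_on_divide num3_holomorphic den3_holomorphic) simp
  have dR: "deriv R b = poly W b / den3 b ^ 2" if "den3 b \<noteq> 0" for b
  proof -
    have "(num3 has_field_derivative (3 * b ^ 2 + 16 * b - 1)) (at b)"
      unfolding num3_def[abs_def] by (auto intro!: derivative_eq_intros simp: power2_eq_square)
    moreover have "(den3 has_field_derivative (- 2 * b + 8)) (at b)"
      unfolding den3_def[abs_def] by (auto intro!: derivative_eq_intros)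
    ultimately have "(R has_field_derivative ((3 * b ^ 2 + 16 * b - 1) * den3 b - num3 b * (- 2 * b + 8)) / (den3 b * den3 b)) (at b)"
      unfolding R_def[abs_def] using that by (rule DERIV_divide)
    moreover have "(3 * b ^ 2 + 16 * b - 1) * den3 b - num3 b * (- 2 * b + 8) = poly W b"
      unfolding den3_def num3_def W_def by (simp add: algebra_simps power2_eq_square power3_eq_cube)
    ultimately show ?thesis by (simp add: DERIV_imp_deriv power2_eq_square)
  qed
  define E where "E = {w. poly disc w = 0} \<union> R ` {b. poly W b = 0}"
  have "W \<noteq> 0" by (simp add: W_def)
  then have finE: "finite E" unfolding E_def using poly_roots_finite disc0 by blast
  show ?thesis
    unfolding radical_map_def
  proof (intro conjI exI[of _ E] finE ballI)
    show "algebraic_map ?i" by (rule algebraic_map_inverse[OF B cubic_twist_algebraic])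
    fix a assume a: "a \<in> unit_circle - E"
    define b where "b = ?i a"
    have b: "b \<in> unit_circle" and Rb: "R b = a"
      using a Bij_unit_circle(2,4)[OF B, of a] cubic_twist_rational(2)[of b] by (auto simp: b_def R_def)
    have "poly W b \<noteq> 0" using a Rb by (auto simp: E_def)
    then have d0: "deriv R b \<noteq> 0" using dR cubic_twist_rational(1)[OF b] by simp
    have bS: "b \<in> {z. den3 z \<noteq> 0}" using cubic_twist_rational(1)[OF b] by simp
    obtain \<rho> where \<rho>: "\<rho> > 0" "ball b \<rho> \<subseteq> {z. den3 z \<noteq> 0}" "open (R ` ball b \<rho>)" "inj_on R (ball b \<rho>)"
      by (rule has_complex_derivative_locally_invertible[OF R_hol bS open_den3 d0]) (rule that)
    obtain g where g: "g holomorphic_on R ` ball b \<rho>" "\<And>z. z \<in> ball b \<rho> \<Longrightarrow> g (R z) = z"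
      using holomorphic_has_inverse[OF holomorphic_on_subset[OF R_hol \<rho>(2)] open_ball \<rho>(4)] by metis
    have aR: "a \<in> R ` ball b \<rho>" using Rb \<rho>(1) by (metis centre_in_ball imageI)
    have "open (- {w. poly disc w = 0})"
      using poly_roots_finite[OF disc0] by (simp add: finite_imp_closed open_Compl)
    then have "open (R ` ball b \<rho> \<inter> - {w. poly disc w = 0})" using \<rho>(3) by (rule open_Int[rotated])
    moreover have "a \<in> R ` ball b \<rho> \<inter> - {w. poly disc w = 0}" using aR a by (simp add: E_def)
    ultimately obtain r1 where r1: "r1 > 0" "ball a r1 \<subseteq> R ` ball b \<rho> \<inter> - {w. poly disc w = 0}"
      using open_contains_ball by blast
    have "continuous_on unit_circle ?i" using homeo by (auto simp: circle_homeos_def homeomorphism_def)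
    then obtain r2 where r2: "r2 > 0" "\<And>z. z \<in> unit_circle \<Longrightarrow> dist z a < r2 \<Longrightarrow> dist (?i z) b < \<rho>"
      unfolding continuous_on_iff b_def using a \<rho>(1) by blast
    define r where "r = min r1 r2"
    have r: "r > 0" "ball a r \<subseteq> R ` ball b \<rho>" "\<And>w. w \<in> ball a r \<Longrightarrow> poly disc w \<noteq> 0"
      using r1 r2(1) by (auto simp: r_def)
    have p: "radical_on (ball a r) (poly p)" for p
      using radical_on_poly[OF radical_on_ident, of "ball a r" p] by simp
    have "radical_on (ball a r) g"
    proof (rule radical_on_cubic[OF refl p[of p0] p[of p1] p[of p2]])
      show "g holomorphic_on ball a r" by (rule holomorphic_on_subset[OF g(1) r(2)])
      fix w assume w: "w \<in> ball a r"
      then obtain y where y: "y \<in> ball b \<rho>" "w = R y" using r(2) by blast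
      have gy: "g w = y" using g(2)[OF y(1)] y(2) by simp
      have "den3 y \<noteq> 0" using y(1) \<rho>(2) by blast
      then have "num3 y = w * den3 y" using y(2) by (simp add: R_def)
      then have "y ^ 3 + (8 + w) * y ^ 2 + (- 1 - 8 * w) * y + - w = 0"
        unfolding num3_def den3_def by Groebner_Basis.algebra
      then show "g w ^ 3 + poly p2 w * g w ^ 2 + poly p1 w * g w + poly p0 w = 0"
        unfolding gy by (simp add: p0_def p1_def p2_def mult.commute)
      show "poly p2 w ^ 2 * poly p1 w ^ 2 - 4 * poly p1 w ^ 3 - 4 * poly p2 w ^ 3 * poly p0 w
          + 18 * poly p2 w * poly p1 w * poly p0 w - 27 * poly p0 w ^ 2 \<noteq> 0"
        using r(3)[OF w] unfolding disc .
    qed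
    moreover have "?i z = g z" if z: "z \<in> unit_circle \<inter> ball a r" for z
    proof -
      have "dist (?i z) b < \<rho>" using r2(2)[of z] z by (auto simp: r_def dist_commute)
      then have "?i z \<in> ball b \<rho>" by (simp add: dist_commute)
      moreover have "R (?i z) = z"
        using Bij_unit_circle(2,4)[OF B, of z] cubic_twist_rational(2)[of "?i z"] z by (auto simp: R_def)
      ultimately show ?thesis using g(2) by metis
    qed
    ultimately show "\<exists>r>0. \<exists>f. radical_on (ball a r) f \<and> (\<forall>z\<in>unit_circle \<inter> ball a r. ?i z = f z)"
      using r(1) by blast
  qed
qed

text \<open>
  Otherwise \<open>z\<close> would be a rational function \<open>P(s) / Q(s)\<close> of \<open>s = num3 / den3\<close>, where \<open>Q\<close> may be
  taken of least degree. But \<open>s\<close> vanishes at \<open>0\<close> and at a point \<open>z1 \<noteq> 0\<close>. This implies first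
  \<open>P(0) = 0\<close> and then \<open>Q(0) = 0\<close>, so a common factor can be cancelled.
\<close>

lemma cubic_twist_not_finite_type: "cubic_twist \<notin> finite_type_diffeos"
proof
  assume "cubic_twist \<in> finite_type_diffeos"
  then have "balanced_at_1 cubic_twist" by (rule finite_type_balanced)
  then obtain r g where g: "r > 0" "g holomorphic_on ball 1 r" "\<And>z. z \<in> unit_circle \<inter> ball 1 r \<Longrightarrow> cubic_twist z = g z"
      "balanced (germ 1 (\<lambda>z. z)) (germ 1 g)" unfolding balanced_at_1_def by blast
  define Z where "Z = germ 1 (\<lambda>z. z)"
  define R where "R z = num3 z / den3 z" for z
  have "(1 :: complex) \<in> unit_circle" by simp
  then have d1: "den3 1 \<noteq> 0" by (rule cubic_twist_rational(1))
  have an: "num3 analytic_on {1}" "den3 analytic_on {1}" "R analytic_on {1}" "g analytic_on {1}"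
  proof -
    show "num3 analytic_on {1}" "den3 analytic_on {1}"
      using num3_holomorphic[of UNIV] den3_holomorphic[of UNIV] analytic_at by blast+
    then show "R analytic_on {1}" unfolding R_def[abs_def] using d1 by (intro analytic_on_divide) auto
    have "1 \<in> ball 1 r" using g(1) by simp
    then show "g analytic_on {1}" using g(2) analytic_at open_ball by blast
  qed
  have gR: "\<forall>\<^sub>F z in nhds 1. g z = R z"
  proof -
    have "open (ball 1 r \<inter> {z. den3 z \<noteq> 0})" by (intro open_Int open_ball open_den3)
    moreover have "1 \<in> ball 1 r \<inter> {z. den3 z \<noteq> 0}" using g(1) d1 by simp
    ultimately obtain e where e: "e > 0" "ball 1 e \<subseteq> ball 1 r \<inter> {z. den3 z \<noteq> 0}" using open_contains_ball by blast
    have "g z - R z = 0" if "z \<in> ball 1 e" for z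
    proof (rule analytic_continuation[of "\<lambda>z. g z - R z" "ball 1 e" "unit_circle \<inter> ball 1 e" 1])
      have "R holomorphic_on ball 1 e"
        unfolding R_def[abs_def] using e(2) by (intro holomorphic_on_divide num3_holomorphic den3_holomorphic) auto
      then show "(\<lambda>z. g z - R z) holomorphic_on ball 1 e"
        using holomorphic_on_subset[OF g(2)] e(2) by (intro holomorphic_on_diff) auto
      show "1 islimpt unit_circle \<inter> ball 1 e" by (rule unit_circle_islimpt) (use e(1) in auto)
      show "g z - R z = 0" if "z \<in> unit_circle \<inter> ball 1 e" for z
        using that e(2) g(3)[of z] cubic_twist_rational(2)[of z] by (auto simp: R_def)
    qed (use e(1) that in auto)
    then show ?thesis unfolding eventually_nhds_metric using e(1) by (intro exI[of _ e]) (auto simp: dist_commute)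
  qed
  define s where "s = germ 1 R"
  have "germ 1 g = s" unfolding s_def using germ_eq_iff[OF an(4,3)] gR by simp
  then have bal: "balanced Z s" using g(4) by (simp add: Z_def)
  have "s \<in> CF Z"
  proof -
    define pn where "pn = [:0, -1, 8, 1 :: complex:]"
    define pd where "pd = [:1, 8, -1 :: complex:]"
    have "num3 = poly pn" "den3 = poly pd"
      by (auto simp: num3_def den3_def pn_def pd_def algebra_simps power2_eq_square power3_eq_cube)
    then have "s = poly (map_poly cst pn) Z / poly (map_poly cst pd) Z" "poly (map_poly cst pd) Z \<noteq> 0"
      using germ_divide[OF an(1,2) d1] germ_poly[OF analytic_on_ident, of 1 pn] germ_poly[OF analytic_on_ident, of 1 pd]
      by (simp_all add: s_def R_def[abs_def] Z_def)
    moreover have "map_poly cst q \<in> polys (range cst)" for q by (auto simp: polys_def coeff_map_poly)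
    ultimately show ?thesis using adjoinI by metis
  qed
  then have "Z \<in> CF s" by (rule balanced_rational[OF bal])
  then obtain P0 Q0 where PQ0: "P0 \<in> polys (range cst)" "Q0 \<in> polys (range cst)" "poly Q0 s \<noteq> 0" "Z = poly P0 s / poly Q0 s"
    by (rule adjoinE)
  obtain P1 Q1 where PQ1: "P0 = map_poly cst P1" "Q0 = map_poly cst Q1" using polys_range_cst PQ0(1,2) by metis
  have s0: "s \<noteq> 0"
  proof -
    have "s \<notin> range cst" using bal by (simp add: balanced_def)
    moreover have "(0 :: complex fls) \<in> range cst" by (rule subfld_0[OF subfld_range_cst])
    ultimately show ?thesis by metis
  qed
  define ok where "ok Q \<longleftrightarrow> Q \<noteq> 0 \<and> (\<exists>P. Z * poly (map_poly cst Q) s = poly (map_poly cst P) s)" for Q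
  have "ok Q1" unfolding ok_def using PQ0(3,4) PQ1 by (auto simp: field_simps)
  then obtain Q where Q: "ok Q" and minQ: "\<And>Q'. ok Q' \<Longrightarrow> Polynomial.degree Q \<le> Polynomial.degree Q'"
    using ex_has_least_nat[of ok Q1 Polynomial.degree] by blast
  obtain P where P: "Z * poly (map_poly cst Q) s = poly (map_poly cst P) s" and Q0: "Q \<noteq> 0"
    using Q by (auto simp: ok_def)
  have ev: "\<forall>\<^sub>F z in nhds 1. z * poly Q (R z) = poly P (R z)"
  proof -
    have "germ 1 (\<lambda>z. z * poly Q (R z)) = germ 1 (\<lambda>z. poly P (R z))"
      unfolding germ_mult[OF analytic_on_ident analytic_on_poly_comp[OF an(3)]] germ_poly[OF an(3)]
      using P by (simp add: Z_def s_def)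
    then show ?thesis
      using germ_eq_iff[OF analytic_on_mult[OF analytic_on_ident analytic_on_poly_comp[OF an(3)]] analytic_on_poly_comp[OF an(3)]]
      by simp
  qed
  \<comment> \<open>The relation between germs at \<open>1\<close> extends to the connected domain of the rational function.\<close>
  have all: "z * poly Q (R z) - poly P (R z) = 0" if z: "den3 z \<noteq> 0" for z
  proof -
    define S where "S = {z. den3 z \<noteq> 0}"
    obtain e where e: "e > 0" "\<And>z. dist z 1 < e \<Longrightarrow> z * poly Q (R z) = poly P (R z)"
      using ev unfolding eventually_nhds_metric by blast
    have "finite {z. poly [:1, 8, -1 :: complex:] z = 0}" by (rule poly_roots_finite) simp
    moreover have "{z. poly [:1, 8, -1 :: complex:] z = 0} = - S"
      by (auto simp: S_def den3_def algebra_simps power2_eq_square)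
    ultimately have fin: "finite (- S)" by simp
    have conn: "connected S"
      using connected_open_delete_finite[OF open_UNIV connected_UNIV _ fin] by (simp add: Diff_eq)
    show ?thesis
    proof (rule analytic_continuation[of "\<lambda>z. z * poly Q (R z) - poly P (R z)" S "S \<inter> ball 1 e" 1])
      have "R holomorphic_on S"
        unfolding R_def[abs_def] by (intro holomorphic_on_divide num3_holomorphic den3_holomorphic) (simp add: S_def)
      then show "(\<lambda>z. z * poly Q (R z) - poly P (R z)) holomorphic_on S"
        by (intro holomorphic_intros)
      have oS: "open S" unfolding S_def by (rule open_den3)
      show "open S" by (rule oS)
      have "1 \<in> S \<inter> ball 1 e" "open (S \<inter> ball 1 e)" using d1 e(1) oS by (auto simp: S_def)
      then show "1 islimpt S \<inter> ball 1 e" by (rule interior_limit_point[OF interiorI[rotated 1, OF _ order_refl]])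
      show "z * poly Q (R z) - poly P (R z) = 0" if "z \<in> S \<inter> ball 1 e" for z
        using that e(2)[of z] by (simp add: dist_commute)
    qed (use conn d1 z in \<open>auto simp: S_def\<close>)
  qed
  \<comment> \<open>A zero of \<open>z\<^sup>2 + 8 z - 1\<close>, the cofactor of \<open>z\<close> in \<open>num3\<close>.\<close>
  define z1 where "z1 = - 4 + csqrt 17"
  have z1: "z1 ^ 2 + 8 * z1 - 1 = 0"
  proof -
    have "csqrt 17 ^ 2 = 17" by (rule power2_csqrt)
    moreover have "csqrt 17 = z1 + 4" by (simp add: z1_def)
    ultimately have "(z1 + 4) ^ 2 = 17" by simp
    moreover have "(z1 + 4) ^ 2 = z1 ^ 2 + 8 * z1 + 16" by (simp add: power2_eq_square algebra_simps)
    ultimately have "z1 ^ 2 + 8 * z1 + 16 = 17" by simp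
    then have "(z1 ^ 2 + 8 * z1 + 16) - 17 = 0" by simp
    then show ?thesis by (simp add: algebra_simps)
  qed
  have z10: "z1 \<noteq> 0" using z1 by auto
  have "den3 z1 = 16 * z1"
  proof -
    have "den3 z1 = 16 * z1 - (z1 ^ 2 + 8 * z1 - 1)" by (simp add: den3_def)
    then show ?thesis unfolding z1 by simp
  qed
  then have dz1: "den3 z1 \<noteq> 0" using z10 by simp
  have "num3 z1 = z1 * (z1 ^ 2 + 8 * z1 - 1)"
    by (simp add: num3_def algebra_simps power2_eq_square power3_eq_cube)
  then have "num3 z1 = 0" unfolding z1 by simp
  then have R1: "R z1 = 0" by (simp add: R_def)
  have R0: "R 0 = 0" and dz0: "den3 0 \<noteq> 0" by (simp_all add: R_def num3_def den3_def)
  have "poly P 0 = 0" using all[OF dz0] unfolding R0 by simp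
  moreover from this have "poly Q 0 = 0" using all[OF dz1] z10 unfolding R1 by simp
  ultimately obtain P' Q' where P': "P = [:0, 1:] * P'" and Q': "Q = [:0, 1:] * Q'"
    using poly_eq_0_iff_dvd[of P 0] poly_eq_0_iff_dvd[of Q 0] by (auto elim!: dvdE)
  have "map_poly cst ([:0, 1:] * q) = [:0, 1:] * map_poly cst q" for q
    unfolding map_cst_mult by (simp add: map_cst_pCons)
  then have "s * (Z * poly (map_poly cst Q') s) = s * poly (map_poly cst P') s"
    using P unfolding P' Q' by (simp del: mult_pCons_left add: ac_simps)
  then have "Z * poly (map_poly cst Q') s = poly (map_poly cst P') s" using s0 by simp
  moreover have Q'0: "Q' \<noteq> 0" using Q0 Q' by auto
  ultimately have "ok Q'" unfolding ok_def by blast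
  then have "Polynomial.degree Q \<le> Polynomial.degree Q'" by (rule minQ)
  moreover have "Polynomial.degree Q = Suc (Polynomial.degree Q')"
    unfolding Q' using Q'0 by (subst degree_mult_eq) auto
  ultimately show False by simp
qed

theorem finite_type_psubset_radical: "finite_type_diffeos \<subset> radical_diffeos"
proof -
  have "cubic_twist \<in> radical_diffeos"
    using cubic_twist_diffeo cubic_twist_radical cubic_twist_inverse_radical by (simp add: radical_diffeos_def)
  then show ?thesis using finite_type_subset_radical cubic_twist_not_finite_type by blast
qed

theorem proposition1:
  shows "subgroup finite_type_diffeos (BijGroup unit_circle) \<and>
         subgroup radical_diffeos (BijGroup unit_circle) \<and>
         subgroup AlgDiff (BijGroup unit_circle) \<and>
         subgroup AlgHomeo (BijGroup unit_circle) \<and>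
         finite_type_diffeos \<subset> radical_diffeos \<and>
         radical_diffeos \<subset> AlgDiff \<and>
         AlgDiff \<subset> AlgHomeo"
  using subgroup_finite_type subgroup_radical_diffeos subgroup_AlgDiff subgroup_AlgHomeo
    finite_type_psubset_radical radical_psubset_AlgDiff AlgDiff_psubset_AlgHomeo by blast

end
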